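(* Let $k$ be a field, and let $H=(h_0,h_1,\dots,h_u)$ be a $2$-admissible sequence with $h_0=2$, $1\le u\le 3$ and $h_u\neq 0$. Then there exist an ideal $J\subset k[[x,y]]$ such that $A=k[[x,y]]/J$ is an Artinian Gorenstein $k$-algebra and an ideal $I$ in $A$ such that the Hilbert function of $G(I)$ is $H$ if and only if $H$ is one of the following sequences: $$(2,1),\ (2,2),\ (2,1,1),\ (2,2,1),\ (2,2,2),\ (2,3,1),\ (2,3,2),\ (2,4,2),$$ $$(2,1,1,1),\ (2,2,1,1),\ (2,2,2,1),\ (2,2,2,2),\ (2,3,1,1),\ (2,3,2,1),\ (2,3,2,2),\ (2,3,3,1),\ (2,3,3,2),$$ $$(2,4,2,1),\ (2,4,2,2),\ (2,4,3,1),\ (2,4,3,2),\ (2,4,4,2).$$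
   Context: An AG $k$-algebra is an Artinian Gorenstein local $k$-algebra with residue field $k$. For an ideal $I$ of $A$, $G(I)=\bigoplus_{n\ge0}I^n/I^{n+1}$ and its Hilbert function is $\mathrm{HF}(G(I))_i=\ell_{A/I}(I^i/I^{i+1})$. Saying that the Hilbert function equals $(h_0,\dots,h_u)$ means $\mathrm{HF}(G(I))_i=h_i$ for $0\le i\le u$ and $\mathrm{HF}(G(I))_i=0$ for $i>u$. For a positive integer $b$, a sequence (numerical function) $H:\mathbb N\to\mathbb N$ is $b$-admissible if it is the Hilbert function $n\mapsto \ell_{R_0}((R_0[x_1,\dots,x_b]/L)_n)$ for some Artinian ring $R_0$ and some homogeneous ideal $L\subset R_0[x_1,\dots,x_b]$. Equivalently (Blancafort–Nollet), writing $H(n)=\binom{n+b-1}{b-1}q(n)+r(n)$ with $0\le r(n)<\binom{n+b-1}{b-1}$, one has $H(n+1)\le\binom{n+b}{b-1}q(n)+(r(n)_n)^+_+$ for all $n\ge0$, where, if $r(n)=\binom{k(n)}{n}+\cdots+\binom{k(1)}{1}$ is the $n$-th Macaulay representation, $(r(n)_n)^+_+=\binom{k(n)+1}{n+1}+\cdots+\binom{k(1)+1}{2}$ (and it is $0$ when $r(n)=0$). Finite sequences are extended by $0$. *)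

theory Defs
  imports
    "HOL-Algebra.Algebra"
    "HOL-Algebra.Algebraic_Closure_Type"
    "HOL-Library.Poly_Mapping"
    "HOL-Library.Extended_Nat"
    "HOL-Computational_Algebra.Formal_Power_Series"
begin

section \<open>Length, Artinian, local and Gorenstein rings\<close>

definition module_length :: "('a, 'm) ring_scheme \<Rightarrow> ('a, 'b, 'n) module_scheme \<Rightarrow> enat" where
  "module_length R M = Sup {enat n |n. \<exists>N :: nat \<Rightarrow> 'b set.
      (\<forall>i\<le>n. submodule (N i) R M) \<and> (\<forall>i<n. N i \<subset> N (Suc i))}"

definition artinian_ring :: "('a, 'm) ring_scheme \<Rightarrow> bool" where
  "artinian_ring R \<longleftrightarrow> cring R \<and>
    (\<forall>C :: nat \<Rightarrow> 'a set. (\<forall>n. ideal (C n) R) \<and> (\<forall>n. C (Suc n) \<subseteq> C n)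
        \<longrightarrow> (\<exists>N. \<forall>n\<ge>N. C n = C N))"

definition local_ring :: "('a, 'm) ring_scheme \<Rightarrow> bool" where
  "local_ring R \<longleftrightarrow> cring R \<and> (\<exists>!M. maximalideal M R)"

definition max_ideal :: "('a, 'm) ring_scheme \<Rightarrow> 'a set" where
  "max_ideal R = (THE M. maximalideal M R)"

definition socle :: "('a, 'm) ring_scheme \<Rightarrow> 'a set" where
  "socle R = {x \<in> carrier R. \<forall>m \<in> max_ideal R. m \<otimes>\<^bsub>R\<^esub> x = \<zero>\<^bsub>R\<^esub>}"

definition ideal_module :: "('a, 'm) ring_scheme \<Rightarrow> 'a set \<Rightarrow> ('a, 'a) module" where
  "ideal_module R I = \<lparr>carrier = I, monoid.mult = monoid.mult R, one = monoid.one R,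
     ring.zero = ring.zero R, ring.add = ring.add R,
     module.smult = monoid.mult R\<rparr>"

text \<open>An Artinian local ring is Gorenstein iff its socle is one-dimensional over the residue
  field; as the socle is killed by the maximal ideal, its dimension is its length.\<close>

definition artinian_gorenstein_local :: "('a, 'm) ring_scheme \<Rightarrow> bool" where
  "artinian_gorenstein_local R \<longleftrightarrow> artinian_ring R \<and> local_ring R \<and>
     module_length R (ideal_module R (socle R)) = 1"

text \<open>\<open>\<phi>\<close> is the structure map of the \<open>K\<close>-algebra \<open>A\<close>; the last conjunct says that \<open>\<phi>\<close> identifies
  \<open>K\<close> with the residue field of \<open>A\<close>.\<close>

definition AG_algebra ::
    "('k, 'm) ring_scheme \<Rightarrow> ('a, 'n) ring_scheme \<Rightarrow> ('k \<Rightarrow> 'a) \<Rightarrow> bool" where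
  "AG_algebra K A \<phi> \<longleftrightarrow> field K \<and> \<phi> \<in> ring_hom K A \<and> artinian_gorenstein_local A \<and>
     (\<lambda>c. max_ideal A +>\<^bsub>A\<^esub> \<phi> c) \<in> ring_iso K (A Quot max_ideal A)"


section \<open>The Hilbert function of the associated graded ring\<close>

primrec ideal_pow :: "('a, 'm) ring_scheme \<Rightarrow> 'a set \<Rightarrow> nat \<Rightarrow> 'a set" where
  "ideal_pow A I 0 = carrier A"
| "ideal_pow A I (Suc n) = ideal_prod A I (ideal_pow A I n)"

text \<open>The \<open>A/I\<close>-module \<open>I\<^sup>n/I\<^sup>n\<^sup>+\<^sup>1\<close>. The ring fields \<open>mult\<close> and \<open>one\<close> of a module record are
  irrelevant for modules.\<close>

definition gr_piece :: "('a, 'm) ring_scheme \<Rightarrow> 'a set \<Rightarrow> nat \<Rightarrow> ('a set, 'a set) module" where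
  "gr_piece A I n =
    \<lparr>carrier = (\<lambda>x. ideal_pow A I (Suc n) +>\<^bsub>A\<^esub> x) ` ideal_pow A I n,
     monoid.mult = undefined, one = undefined,
     ring.zero = ideal_pow A I (Suc n), ring.add = set_add A,
     module.smult = (\<lambda>r S. \<Union>a\<in>r. \<Union>x\<in>S. ideal_pow A I (Suc n) +>\<^bsub>A\<^esub> (a \<otimes>\<^bsub>A\<^esub> x))\<rparr>"

definition gr_HF :: "('a, 'm) ring_scheme \<Rightarrow> 'a set \<Rightarrow> nat \<Rightarrow> enat" where
  "gr_HF A I i = module_length (A Quot I) (gr_piece A I i)"


section \<open>Admissible numerical functions\<close>

text \<open>\<open>R\<^sub>0[x\<^sub>1,\<dots>,x\<^sub>b]\<close> for \<open>R\<^sub>0\<close> the type \<open>'r\<close>: the polynomials, as finitely supported functions on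
  exponent vectors, in which only the variables with index less than \<open>b\<close> occur.\<close>

definition mpoly_ring :: "nat \<Rightarrow> ((nat \<Rightarrow>\<^sub>0 nat) \<Rightarrow>\<^sub>0 'r::comm_ring_1) ring" where
  "mpoly_ring b = ring_of_type_algebra
     \<lparr>carrier := {p. \<forall>m \<in> Poly_Mapping.keys p. Poly_Mapping.keys m \<subseteq> {..<b}}\<rparr>"

definition mdeg :: "(nat \<Rightarrow>\<^sub>0 nat) \<Rightarrow> nat" where
  "mdeg m = (\<Sum>i \<in> Poly_Mapping.keys m. Poly_Mapping.lookup m i)"

definition homog_part :: "nat \<Rightarrow> nat \<Rightarrow> ((nat \<Rightarrow>\<^sub>0 nat) \<Rightarrow>\<^sub>0 'r::comm_ring_1) set" where
  "homog_part b n = {p \<in> carrier (mpoly_ring b). \<forall>m \<in> Poly_Mapping.keys p. mdeg m = n}"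

definition homogeneous_ideal :: "nat \<Rightarrow> ((nat \<Rightarrow>\<^sub>0 nat) \<Rightarrow>\<^sub>0 'r::comm_ring_1) set \<Rightarrow> bool" where
  "homogeneous_ideal b L \<longleftrightarrow> ideal L (mpoly_ring b) \<and>
     L = genideal (mpoly_ring b) (L \<inter> (\<Union>n. homog_part b n))"

text \<open>The \<open>R\<^sub>0\<close>-module \<open>(R\<^sub>0[x\<^sub>1,\<dots>,x\<^sub>b]/L)\<^sub>n\<close>.\<close>

definition quot_piece ::
    "nat \<Rightarrow> ((nat \<Rightarrow>\<^sub>0 nat) \<Rightarrow>\<^sub>0 'r) set \<Rightarrow> nat
      \<Rightarrow> ('r::comm_ring_1, ((nat \<Rightarrow>\<^sub>0 nat) \<Rightarrow>\<^sub>0 'r) set) module" where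
  "quot_piece b L n =
    \<lparr>carrier = (\<lambda>p. L +>\<^bsub>mpoly_ring b\<^esub> p) ` homog_part b n,
     monoid.mult = undefined, one = undefined,
     ring.zero = L, ring.add = set_add (mpoly_ring b),
     module.smult = (\<lambda>c S. \<Union>p\<in>S. L +>\<^bsub>mpoly_ring b\<^esub> (Poly_Mapping.single 0 c * p))\<rparr>"

text \<open>Admissibility quantifies existentially over all Artinian rings \<open>R\<^sub>0\<close>, hence over types. The
  ring is therefore a parameter: \<open>H\<close> is \<open>b\<close>-admissible iff \<open>admissible_over TYPE('r) b H\<close>
  holds for some \<open>'r\<close>. A theorem assuming \<open>admissible_over TYPE('r) b H\<close> with \<open>'r\<close> a type
  variable not occurring in the conclusion is thus a theorem about all \<open>b\<close>-admissible \<open>H\<close>.\<close>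

definition admissible_over :: "'r::comm_ring_1 itself \<Rightarrow> nat \<Rightarrow> (nat \<Rightarrow> nat) \<Rightarrow> bool" where
  "admissible_over ty b H \<longleftrightarrow> b > 0 \<and> artinian_ring (ring_of_type_algebra :: 'r ring) \<and>
     (\<exists>L :: ((nat \<Rightarrow>\<^sub>0 nat) \<Rightarrow>\<^sub>0 'r) set. homogeneous_ideal b L \<and>
        (\<forall>n. module_length (ring_of_type_algebra :: 'r ring) (quot_piece b L n) = enat (H n)))"

definition extend_by_zero :: "nat list \<Rightarrow> nat \<Rightarrow> nat" where
  "extend_by_zero hs n = (if n < length hs then hs ! n else 0)"


section \<open>Power series in two variables\<close>

text \<open>\<open>k[[x,y]]\<close> is realised as \<open>k[[x]][[y]]\<close>.\<close>

definition fps2_ring :: "'k::field fps fps ring" where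
  "fps2_ring = ring_of_type_algebra"

definition fps2_const :: "'k::field \<Rightarrow> 'k fps fps" where
  "fps2_const c = fps_const (fps_const c)"

end

(* Put R = k[[x,y]] and let I^n also denote the preimage I^n + J in R, so that the Hilbert function at n
   is the length of I^n/I^(n+1), counted in chains of ideals of R.

   Necessity.  An ideal of colength 2 in R has the form (a, y^2) with m = (a, y).  Having two generators,
   it satisfies the growth bounds on h_1 and h_2 without appeal to Macaulay's theorem.  Since A = R/J is
   Gorenstein, an ideal P of A and its annihilator satisfy l(P) + l(0:P) = l(A), so PQ = 0 implies
   l(P) + l(Q) <= l(A).  The vanishing products I * I^u, m * I^u, I^2 * I^2, mI * I^(u-1) then exclude
   all remaining sequences but (2,4,1,1), where m^2 * mI = 0 does.

   Sufficiency.  The sequences are realised by I = (x, y^2) in k[[x,y]]/(xy^s, x^p - y^q): those with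
   h_1 <= 3 with s = 1, those with h_1 = 4 with p = 2. *)

theory Submission
  imports Defs
begin

section \<open>Lengths of intervals of ideals\<close>

text \<open>Every bound is a count using l(A) = l(I) + 2, l(A) <= l(m) + 1 and l(I) <= l(mI) + 2,
  the last because I has two generators. From I I^u = 0 comes h_u <= 2. If some h_i = 1, then m I^i
  lies in I^(i+1), hence m I^u = 0 and h_u = 1. For the same reason mI * I^(u-1) vanishes when h_u =
  1, which yields h_1 <= 3 for u = 2 and h_2 <= 3 for u = 3. For u = 3, I^2 I^2 = 0 gives h_2 + h_3
  <= 2 + h_1. The sequence (2,4,1,1) passes all these tests; there l(mI) >= 4 and l(m^2) >= 5 add up
  to more than l(A) = 8. The duality is proved one simple step at a time: if Q = N + (z) with m z
  inside N, multiplication by z embeds (0:N)/(0:Q) into the socle. Composition series from 0 to P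
  and from P to A give the two inequalities behind the equation. The quotients used for sufficiency
  have a k-basis of q + ps monomials on which the powers of I are cut out by weight, so h_n counts
  basis monomials and each listed sequence is a finite computation.\<close>

interpretation ring_module: Modules.module "(*) :: 'a::comm_ring_1 \<Rightarrow> 'a \<Rightarrow> 'a"
  by unfold_locales (auto simp: algebra_simps)

declare ring_module.scale_scale [simp del]  \<comment> \<open>loops with associativity\<close>

abbreviation is_ideal :: "'a::comm_ring_1 set \<Rightarrow> bool" where
  "is_ideal \<equiv> ring_module.subspace"

abbreviation ideal_gen :: "'a::comm_ring_1 set \<Rightarrow> 'a set" where
  "ideal_gen \<equiv> ring_module.span"

lemmas is_ideal_0 = ring_module.subspace_0
  and is_ideal_add = ring_module.subspace_add
  and is_ideal_mult = ring_module.subspace_scale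
  and is_ideal_diff = ring_module.subspace_diff

lemma is_ideal_mult_right: "is_ideal P \<Longrightarrow> x \<in> P \<Longrightarrow> x * c \<in> P"
  by (metis is_ideal_mult mult.commute)

lemma is_ideal_sums: "is_ideal P \<Longrightarrow> is_ideal Q \<Longrightarrow> is_ideal {x + y |x y. x \<in> P \<and> y \<in> Q}"
  using ring_module.span_Un[of P Q] ring_module.subspace_span[of "P \<union> Q"]
  by (simp add: ring_module.span_subspace[OF order_refl ring_module.span_superset])

text \<open>A chain has \<open>n\<close> steps and \<open>n + 1\<close> members, and its ends need
  not be \<open>P\<close> and \<open>Q\<close>; a truncated chain is therefore again a
  chain.\<close>

definition ideal_chain :: "'a::comm_ring_1 set \<Rightarrow> 'a set \<Rightarrow> nat \<Rightarrow> (nat \<Rightarrow> 'a set) \<Rightarrow> bool" where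
  "ideal_chain P Q n N \<longleftrightarrow>
     (\<forall>i\<le>n. is_ideal (N i) \<and> P \<subseteq> N i \<and> N i \<subseteq> Q) \<and> (\<forall>i<n. N i \<subset> N (Suc i))"

definition len :: "'a::comm_ring_1 set \<Rightarrow> 'a set \<Rightarrow> enat" where
  "len P Q = Sup {enat n |n. \<exists>N. ideal_chain P Q n N}"

lemma len_ge: "ideal_chain P Q n N \<Longrightarrow> enat n \<le> len P Q"
  unfolding len_def by (rule Sup_upper) blast

lemma len_le:
  assumes "\<And>n N. ideal_chain P Q n N \<Longrightarrow> enat n \<le> c"
  shows "len P Q \<le> c"
  unfolding len_def by (rule Sup_least) (use assms in blast)

lemma ideal_chain_take: "ideal_chain P Q n N \<Longrightarrow> k \<le> n \<Longrightarrow> ideal_chain P Q k N"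
  unfolding ideal_chain_def by auto

lemma ideal_chain_0: "is_ideal P \<Longrightarrow> P \<subseteq> Q \<Longrightarrow> ideal_chain P Q 0 (\<lambda>_. P)"
  unfolding ideal_chain_def by auto

text \<open>Truncation makes the set of chain lengths an initial segment, so if no chain has length
  \<open>n\<close>, all lengths, and with them the supremum, are at most
  \<open>n - 1\<close>.\<close>

lemma enat_le_len_iff:
  assumes "is_ideal P" "P \<subseteq> Q"
  shows "enat n \<le> len P Q \<longleftrightarrow> (\<exists>N. ideal_chain P Q n N)"
proof
  assume n: "enat n \<le> len P Q"
  show "\<exists>N. ideal_chain P Q n N"
  proof (rule ccontr)
    assume no: "\<not> ?thesis"
    then have "n \<noteq> 0" using ideal_chain_0[OF assms] by metis
    have "len P Q \<le> enat (n - 1)"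
    proof (rule len_le)
      fix k N assume c: "ideal_chain P Q k N"
      then have "k < n" using no ideal_chain_take[OF c, of n] by force
      then show "enat k \<le> enat (n - 1)" by simp
    qed
    with n have "enat n \<le> enat (n - 1)" by (rule order_trans)
    then show False using \<open>n \<noteq> 0\<close> by simp
  qed
qed (auto intro: len_ge)

lemma ideal_chain_snoc:
  assumes "ideal_chain P Q n N" "N n \<subset> D" "is_ideal D" "D \<subseteq> Q"
  shows "ideal_chain P Q (Suc n) (N(Suc n := D))"
proof -
  have "P \<subseteq> N n" using assms(1) unfolding ideal_chain_def by auto
  then show ?thesis using assms unfolding ideal_chain_def by (auto simp: less_Suc_eq le_Suc_eq)
qed

text \<open>Repetitions are dropped. The use is for a chain intersected with a fixed ideal or added
  to it, which need no longer increase strictly.\<close>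

lemma card_strict_steps_le_len:
  assumes "\<And>i. i \<le> n \<Longrightarrow> is_ideal (D i) \<and> P \<subseteq> D i \<and> D i \<subseteq> Q"
    and "\<And>i. i < n \<Longrightarrow> D i \<subseteq> D (Suc i)"
  shows "enat (card {i. i < n \<and> D i \<noteq> D (Suc i)}) \<le> len P Q"
proof -
  \<comment> \<open>The end of the new chain is recorded so that the next strict step can be
    appended to it.\<close>
  have "\<exists>N. ideal_chain P Q (card {i. i < n \<and> D i \<noteq> D (Suc i)}) N
           \<and> N (card {i. i < n \<and> D i \<noteq> D (Suc i)}) = D n"
    using assms
  proof (induction n)
    case 0
    then show ?case by (intro exI[of _ "\<lambda>_. D 0"]) (auto simp: ideal_chain_def)
  next
    case (Suc n)
    let ?S = "{i. i < n \<and> D i \<noteq> D (Suc i)}"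
    obtain N where N: "ideal_chain P Q (card ?S) N" "N (card ?S) = D n"
      using Suc by (metis (no_types, lifting) le_SucI less_SucI)
    show ?case
    proof (cases "D n = D (Suc n)")
      case True
      then have "{i. i < Suc n \<and> D i \<noteq> D (Suc i)} = ?S" by (auto simp: less_Suc_eq)
      with N True show ?thesis by auto
    next
      case False
      then have "{i. i < Suc n \<and> D i \<noteq> D (Suc i)} = insert n ?S" by (auto simp: less_Suc_eq)
      then have c: "card {i. i < Suc n \<and> D i \<noteq> D (Suc i)} = Suc (card ?S)" by simp
      have "N (card ?S) \<subset> D (Suc n)" using N(2) False Suc.prems(2)[of n] by auto
      from ideal_chain_snoc[OF N(1) this] Suc.prems(1)[of "Suc n"]
      have "ideal_chain P Q (Suc (card ?S)) (N(Suc (card ?S) := D (Suc n)))" by auto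
      moreover have "(N(Suc (card ?S) := D (Suc n))) (Suc (card ?S)) = D (Suc n)" by simp
      ultimately show ?thesis unfolding c by blast
    qed
  qed
  then show ?thesis using len_ge by blast
qed

lemma len_mono:
  assumes "P \<subseteq> P'" "Q' \<subseteq> Q"
  shows "len P' Q' \<le> len P Q"
proof (rule len_le)
  fix n N assume "ideal_chain P' Q' n N"
  then have "ideal_chain P Q n N" using assms unfolding ideal_chain_def by blast
  then show "enat n \<le> len P Q" by (rule len_ge)
qed

lemma len_add_ge:
  assumes "is_ideal P" "is_ideal N" "P \<subseteq> N" "N \<subseteq> Q"
  shows "len P N + len N Q \<le> len P Q"
proof -
  have key: "enat (a + b) \<le> len P Q" if "enat a \<le> len P N" "enat b \<le> len N Q" for a b
  proof -
    obtain C where C: "ideal_chain P N a C"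
      using \<open>enat a \<le> len P N\<close> enat_le_len_iff[OF assms(1,3)] by metis
    obtain D where D: "ideal_chain N Q b D"
      using \<open>enat b \<le> len N Q\<close> enat_le_len_iff[OF assms(2,4)] by metis
    \<comment> \<open>\<open>D 0\<close> is left out because it may equal \<open>C a\<close>; the
      step at the joint is \<open>C a \<subset> D 1\<close>.\<close>
    define E where "E i = (if i \<le> a then C i else D (i - a))" for i
    have CN: "C a \<subseteq> D 0" and CN': "b > 0 \<Longrightarrow> C a \<subset> D 1"
    proof -
      have "C a \<subseteq> N" using C unfolding ideal_chain_def by blast
      moreover have "N \<subseteq> D 0" using D unfolding ideal_chain_def by blast
      moreover have "D 0 \<subset> D 1" if "b > 0" using D that unfolding ideal_chain_def by auto
      ultimately show "C a \<subseteq> D 0" "b > 0 \<Longrightarrow> C a \<subset> D 1" by blast+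
    qed
    have "ideal_chain P Q (a + b) E"
      unfolding ideal_chain_def
    proof (intro conjI allI impI)
      fix i assume "i \<le> a + b"
      then have "i \<le> a \<or> (\<not> i \<le> a \<and> i - a \<le> b)" by linarith
      then have "is_ideal (E i) \<and> P \<subseteq> E i \<and> E i \<subseteq> Q"
      proof (elim disjE conjE)
        assume "i \<le> a"
        then have "is_ideal (C i)" "P \<subseteq> C i" "C i \<subseteq> N" using C unfolding ideal_chain_def by blast+
        then show ?thesis using \<open>i \<le> a\<close> assms(4) by (simp add: E_def)
      next
        assume "\<not> i \<le> a" "i - a \<le> b"
        then have "is_ideal (D (i - a))" "N \<subseteq> D (i - a)" "D (i - a) \<subseteq> Q"
          using D unfolding ideal_chain_def by blast+
        then show ?thesis using \<open>\<not> i \<le> a\<close> assms(3) by (simp add: E_def)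
      qed
      then show "is_ideal (E i)" "P \<subseteq> E i" "E i \<subseteq> Q" by blast+
    next
      fix i assume i: "i < a + b"
      consider "i < a" | "i = a" | "i > a" by linarith
      then show "E i \<subset> E (Suc i)"
      proof cases
        case 1 then show ?thesis using C by (simp add: E_def ideal_chain_def)
      next
        case 2 then show ?thesis using CN' i by (simp add: E_def)
      next
        case 3
        then have "D (i - a) \<subset> D (Suc (i - a))" using D i unfolding ideal_chain_def by auto
        then show ?thesis using 3 by (simp add: E_def Suc_diff_le)
      qed
    qed
    then show ?thesis by (rule len_ge)
  qed
  show ?thesis
  proof (cases "len P N")
    case (enat a)
    show ?thesis
    proof (cases "len N Q")
      case (enat b)
      with key[of a b] \<open>len P N = enat a\<close> show ?thesis by simp
    next
      case infinity
      have "enat b \<le> len P Q" for b using key[of 0 b] infinity by (auto simp: zero_enat_def[symmetric])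
      then have "len P Q = \<infinity>" by (metis enat_ord_simps(1) not_infinity_eq Suc_n_not_le_n)
      then show ?thesis by simp
    qed
  next
    case infinity
    have "enat b \<le> len P Q" for b using key[of b 0] infinity by (auto simp: zero_enat_def[symmetric])
    then have "len P Q = \<infinity>" by (metis enat_ord_simps(1) not_infinity_eq Suc_n_not_le_n)
    then show ?thesis by simp
  qed
qed

text \<open>By the modular law every strict step of a chain stays strict after intersecting with \<open>N\<close>
  or after adding \<open>N\<close>.\<close>

lemma len_add_le:
  assumes "is_ideal P" "is_ideal N" "is_ideal Q" "P \<subseteq> N" "N \<subseteq> Q"
  shows "len P Q \<le> len P N + len N Q"
proof (rule len_le)
  fix n C assume C: "ideal_chain P Q n C"
  define D where "D i = C i \<inter> N" for i
  define E where "E i = {x + y |x y. x \<in> C i \<and> y \<in> N}" for i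
  let ?S = "{i. i < n \<and> D i \<noteq> D (Suc i)}" and ?T = "{i. i < n \<and> E i \<noteq> E (Suc i)}"
  have idC: "is_ideal (C i)" "P \<subseteq> C i" "C i \<subseteq> Q" if "i \<le> n" for i
    using C that unfolding ideal_chain_def by auto
  have st: "C i \<subset> C (Suc i)" if "i < n" for i using C that unfolding ideal_chain_def by auto
  have NE: "N \<subseteq> E i" if "i \<le> n" for i
    unfolding E_def using idC(1)[OF that] is_ideal_0 by force
  have EQ: "E i \<subseteq> Q" if "i \<le> n" for i
    unfolding E_def using idC(3)[OF that] assms is_ideal_add by blast
  have "{..<n} \<subseteq> ?S \<union> ?T"
  proof
    fix i assume i: "i \<in> {..<n}"
    show "i \<in> ?S \<union> ?T"
    proof (rule ccontr)
      assume "i \<notin> ?S \<union> ?T"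
      then have eq: "D i = D (Suc i)" "E i = E (Suc i)" using i by auto
      have "C (Suc i) \<subseteq> C i"
      proof
        fix x assume x: "x \<in> C (Suc i)"
        then have "x \<in> E (Suc i)" unfolding E_def using is_ideal_0[OF assms(2)] by force
        then obtain c d where cd: "x = c + d" "c \<in> C i" "d \<in> N" using eq(2) unfolding E_def by blast
        have "d = x - c" using cd by simp
        then have "d \<in> C (Suc i)" using is_ideal_diff[OF idC(1)[of "Suc i"], of x c] x cd(2) st[of i] i by auto
        then have "d \<in> C i" using cd eq(1) unfolding D_def by blast
        then show "x \<in> C i" using cd is_ideal_add[OF idC(1)[of i]] i by auto
      qed
      then show False using st[of i] i by auto
    qed
  qed
  from card_mono[OF _ this] have "n \<le> card (?S \<union> ?T)" by simp
  also have "\<dots> \<le> card ?S + card ?T" by (rule card_Un_le)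
  finally have "enat n \<le> enat (card ?S) + enat (card ?T)" by simp
  also have "\<dots> \<le> len P N + len N Q"
  proof (intro add_mono card_strict_steps_le_len)
    fix i assume i: "i \<le> n"
    show "is_ideal (D i) \<and> P \<subseteq> D i \<and> D i \<subseteq> N"
      unfolding D_def using idC[OF i] assms ring_module.subspace_inter[of "C i" N] by blast
    show "is_ideal (E i) \<and> N \<subseteq> E i \<and> E i \<subseteq> Q"
      using NE[OF i] EQ[OF i] is_ideal_sums[OF idC(1)[OF i] assms(2)] unfolding E_def by blast
  next
    fix i assume "i < n"
    then have "C i \<subseteq> C (Suc i)" using st by blast
    then show "D i \<subseteq> D (Suc i)" "E i \<subseteq> E (Suc i)" unfolding D_def E_def by blast+
  qed
  finally show "enat n \<le> len P N + len N Q" .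
qed

lemma len_add:
  assumes "is_ideal P" "is_ideal N" "is_ideal Q" "P \<subseteq> N" "N \<subseteq> Q"
  shows "len P Q = len P N + len N Q"
  using len_add_le[OF assms] len_add_ge[of P N Q] assms by (simp add: antisym)

lemma len_strict:
  assumes "is_ideal P" "is_ideal Q" "P \<subset> Q"
  shows "1 \<le> len P Q"
proof -
  have "ideal_chain P Q 1 (\<lambda>i. if i = 0 then P else Q)"
    using assms unfolding ideal_chain_def by auto
  then show ?thesis using len_ge by (simp add: one_enat_def)
qed

lemma len_self: "len P P = 0"
proof -
  have "len P P \<le> 0"
  proof (rule len_le)
    fix n N assume c: "ideal_chain P P n N"
    have "n = 0"
    proof (rule ccontr)
      assume "n \<noteq> 0"
      then show False using c unfolding ideal_chain_def
        by (metis Suc_leI gr0I le0 order_antisym psubsetE)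
    qed
    then show "enat n \<le> 0" by (simp add: zero_enat_def)
  qed
  then show ?thesis by simp
qed

text \<open>Multiplication by \<open>z\<close> induces a surjection \<open>Q/P \<rightarrow> Q'/P'\<close>.\<close>

lemma len_le_mult_surj:
  assumes "is_ideal P'" "is_ideal Q"
    and zP: "\<And>p. p \<in> P \<Longrightarrow> z * p \<in> P'" and PQ: "P \<subseteq> Q"
    and surj: "\<And>q'. q' \<in> Q' \<Longrightarrow> \<exists>q\<in>Q. q' - z * q \<in> P'"
  shows "len P' Q' \<le> len P Q"
proof (rule len_le)
  fix n N assume N: "ideal_chain P' Q' n N"
  define M where "M i = {q \<in> Q. z * q \<in> N i}" for i
  have "ideal_chain P Q n M"
    unfolding ideal_chain_def
  proof (intro conjI allI impI)
    fix i assume i: "i \<le> n"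
    then have Ni: "is_ideal (N i)" "P' \<subseteq> N i" using N unfolding ideal_chain_def by auto
    show "is_ideal (M i)"
    proof (rule ring_module.subspaceI)
      show "0 \<in> M i" using Ni assms is_ideal_0 by (auto simp: M_def)
      fix x y assume "x \<in> M i" "y \<in> M i"
      then show "x + y \<in> M i" using Ni assms is_ideal_add by (auto simp: M_def distrib_left)
    next
      fix c x assume "x \<in> M i"
      then show "c * x \<in> M i"
        using is_ideal_mult[OF Ni(1), of "z * x" c] is_ideal_mult[OF assms(2), of x c]
        by (auto simp: M_def ac_simps)
    qed
    show "P \<subseteq> M i" "M i \<subseteq> Q" using zP PQ Ni by (auto simp: M_def)
  next
    fix i assume i: "i < n"
    then have st: "N i \<subset> N (Suc i)" "P' \<subseteq> N i" "N (Suc i) \<subseteq> Q'" "is_ideal (N i)" "is_ideal (N (Suc i))"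
      using N unfolding ideal_chain_def by auto
    then obtain x where x: "x \<in> N (Suc i)" "x \<notin> N i" by blast
    then obtain q where q: "q \<in> Q" "x - z * q \<in> P'" using surj st by blast
    have "z * q \<in> N (Suc i)" using is_ideal_diff[OF st(5) x(1), of "x - z * q"] q st by auto
    moreover have "z * q \<notin> N i" using is_ideal_add[OF st(4), of "x - z * q" "z * q"] q st x by auto
    ultimately have "q \<in> M (Suc i)" "q \<notin> M i" using q(1) by (auto simp: M_def)
    moreover have "M i \<subseteq> M (Suc i)" using st(1) by (auto simp: M_def)
    ultimately show "M i \<subset> M (Suc i)" by auto
  qed
  then show "enat n \<le> len P Q" by (rule len_ge)
qed

text \<open>Multiplication by \<open>z\<close> induces an injection \<open>Q/P \<rightarrow> Q'/P'\<close>.\<close>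

lemma len_le_mult_inj:
  assumes "is_ideal P'" "is_ideal Q'" "P' \<subseteq> Q'"
    and zQ: "\<And>q. q \<in> Q \<Longrightarrow> z * q \<in> Q'"
    and inj: "\<And>q. q \<in> Q \<Longrightarrow> z * q \<in> P' \<Longrightarrow> q \<in> P"
  shows "len P Q \<le> len P' Q'"
proof (rule len_le)
  fix n N assume N: "ideal_chain P Q n N"
  define M where "M i = {x + y |x y. x \<in> (*) z ` N i \<and> y \<in> P'}" for i
  have "ideal_chain P' Q' n M"
    unfolding ideal_chain_def
  proof (intro conjI allI impI)
    fix i assume i: "i \<le> n"
    then have Ni: "is_ideal (N i)" "N i \<subseteq> Q" using N unfolding ideal_chain_def by auto
    have "is_ideal ((*) z ` N i)"
    proof (rule ring_module.subspaceI)
      show "0 \<in> (*) z ` N i" using is_ideal_0[OF Ni(1)] by force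
      fix x y assume "x \<in> (*) z ` N i" "y \<in> (*) z ` N i"
      then show "x + y \<in> (*) z ` N i"
        using is_ideal_add[OF Ni(1)] by (auto simp: distrib_left[symmetric])
    next
      fix c x assume "x \<in> (*) z ` N i"
      then obtain y where "x = z * y" "y \<in> N i" by blast
      then show "c * x \<in> (*) z ` N i"
        using is_ideal_mult[OF Ni(1), of y c] by (intro image_eqI[of _ _ "c * y"]) (auto simp: ac_simps)
    qed
    then show "is_ideal (M i)" unfolding M_def using is_ideal_sums assms(1) by blast
    show "P' \<subseteq> M i" unfolding M_def using is_ideal_0[OF Ni(1)] by force
    show "M i \<subseteq> Q'" unfolding M_def using Ni zQ assms is_ideal_add by blast
  next
    fix i assume i: "i < n"
    then have st: "N i \<subset> N (Suc i)" "P \<subseteq> N i" "N (Suc i) \<subseteq> Q" "is_ideal (N i)" "is_ideal (N (Suc i))"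
      using N unfolding ideal_chain_def by auto
    then obtain x where x: "x \<in> N (Suc i)" "x \<notin> N i" by blast
    have "z * x \<notin> M i"
    proof
      assume "z * x \<in> M i"
      then obtain y where y: "y \<in> N i" "z * x - z * y \<in> P'" unfolding M_def by force
      then have "z * (x - y) \<in> P'" by (simp add: algebra_simps)
      moreover have "x - y \<in> N (Suc i)" using is_ideal_diff[OF st(5)] x y st by blast
      ultimately have "x - y \<in> N i" using inj st by blast
      from is_ideal_add[OF st(4) this y(1)] show False using x by simp
    qed
    moreover have "z * x \<in> M (Suc i)" unfolding M_def using x is_ideal_0[OF assms(1)] by force
    moreover have "M i \<subseteq> M (Suc i)" using st(1) unfolding M_def by auto
    ultimately show "M i \<subset> M (Suc i)" by auto
  qed
  then show "enat n \<le> len P' Q'" by (rule len_ge)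
qed

text \<open>The top step of a longest chain is cut off; additivity of \<open>len\<close> then forces
  the two lengths. This is the induction step along a composition series.\<close>

lemma len_SucE:
  assumes "len P Q = enat (Suc n)" "is_ideal P" "is_ideal Q" "P \<subseteq> Q"
  obtains N where "is_ideal N" "P \<subseteq> N" "N \<subset> Q" "len P N = enat n" "len N Q = 1"
proof -
  obtain C where C: "ideal_chain P Q (Suc n) C" using assms enat_le_len_iff[of P Q "Suc n"] by auto
  then have N: "is_ideal (C n)" "P \<subseteq> C n" "C n \<subset> Q"
    unfolding ideal_chain_def by (auto dest: spec[of _ n] spec[of _ "Suc n"]) 
  have "ideal_chain P (C n) n C"
    unfolding ideal_chain_def
  proof (intro conjI allI impI)
    fix i assume "i \<le> n"
    then show "C i \<subseteq> C n"
    proof (induction rule: inc_induct)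
      case (step k)
      then have "C k \<subset> C (Suc k)" using C unfolding ideal_chain_def by auto
      then show ?case using step by blast
    qed simp
  qed (use C in \<open>auto simp: ideal_chain_def\<close>)
  then have a: "enat n \<le> len P (C n)" by (rule len_ge)
  have b: "1 \<le> len (C n) Q" using len_strict N assms by blast
  have s: "enat (Suc n) = len P (C n) + len (C n) Q" using len_add[of P "C n" Q] N assms by auto
  then obtain p q where pq: "len P (C n) = enat p" "len (C n) Q = enat q"
    by (metis enat.exhaust plus_enat_simps(2) plus_enat_simps(3) enat.distinct(1))
  then have "p = n" "q = 1" using a b s by (auto simp: one_enat_def)
  then show ?thesis using that[of "C n"] N pq by (simp add: one_enat_def)
qed


section \<open>Products and colon ideals relative to a fixed ideal\<close>

text \<open>Ideals of the quotient by \<open>J\<close> are represented by ideals containing \<open>J\<close>; so \<open>rel_prod J P Q\<close>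
  stands for \<open>PQ + J\<close> and \<open>rel_pow J I n\<close> for \<open>I\<^sup>n + J\<close>.\<close>

definition rel_prod :: "'a::comm_ring_1 set \<Rightarrow> 'a set \<Rightarrow> 'a set \<Rightarrow> 'a set" where
  "rel_prod J P Q = ideal_gen (J \<union> {p * q |p q. p \<in> P \<and> q \<in> Q})"

primrec rel_pow :: "'a::comm_ring_1 set \<Rightarrow> 'a set \<Rightarrow> nat \<Rightarrow> 'a set" where
  "rel_pow J I 0 = UNIV"
| "rel_pow J I (Suc n) = rel_prod J I (rel_pow J I n)"

text \<open>Represents the annihilator of the image of \<open>P\<close> in the quotient by
  \<open>J\<close>; for \<open>P = m\<close> it represents the socle.\<close>

definition colon :: "'a::comm_ring_1 set \<Rightarrow> 'a set \<Rightarrow> 'a set" where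
  "colon J P = {r. \<forall>p\<in>P. r * p \<in> J}"

lemma is_ideal_rel_prod [simp]: "is_ideal (rel_prod J P Q)"
  unfolding rel_prod_def by simp

lemma rel_prod_ge: "J \<subseteq> rel_prod J P Q"
  unfolding rel_prod_def by (rule order_trans[OF _ ring_module.span_superset]) blast

lemma rel_prod_mem: "p \<in> P \<Longrightarrow> q \<in> Q \<Longrightarrow> p * q \<in> rel_prod J P Q"
  unfolding rel_prod_def by (rule ring_module.span_base) blast

lemma rel_prod_least:
  assumes "is_ideal K" "J \<subseteq> K" "\<And>p q. p \<in> P \<Longrightarrow> q \<in> Q \<Longrightarrow> p * q \<in> K"
  shows "rel_prod J P Q \<subseteq> K"
  unfolding rel_prod_def by (rule ring_module.span_minimal) (use assms in auto)

lemma rel_prod_mono: "P \<subseteq> P' \<Longrightarrow> Q \<subseteq> Q' \<Longrightarrow> rel_prod J P Q \<subseteq> rel_prod J P' Q'"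
  by (rule rel_prod_least) (auto intro: subsetD[OF rel_prod_ge] rel_prod_mem)

lemma rel_prod_le: "is_ideal Q \<Longrightarrow> J \<subseteq> Q \<Longrightarrow> rel_prod J P Q \<subseteq> Q"
  by (rule rel_prod_least) (auto intro: is_ideal_mult)

lemma is_ideal_rel_pow [simp]: "is_ideal (rel_pow J I n)"
  by (cases n) auto

lemma rel_pow_ge: "J \<subseteq> rel_pow J I n"
  by (cases n) (simp_all add: rel_prod_ge)

lemma rel_pow_Suc_le: "rel_pow J I (Suc n) \<subseteq> rel_pow J I n"
  by (simp add: rel_prod_le rel_pow_ge)

lemma rel_pow_antimono: "n \<le> k \<Longrightarrow> rel_pow J I k \<subseteq> rel_pow J I n"
  by (induction rule: dec_induct) (use rel_pow_Suc_le in blast)+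

lemma rel_pow_1: "is_ideal I \<Longrightarrow> J \<subseteq> I \<Longrightarrow> rel_pow J I (Suc 0) = I"
  using rel_prod_least[of I J I UNIV] rel_prod_mem[of _ I 1 UNIV J]
  by (auto intro: is_ideal_mult_right)

lemma is_ideal_colon: "is_ideal J \<Longrightarrow> is_ideal (colon J P)"
  by (rule ring_module.subspaceI)
    (auto simp: colon_def is_ideal_0 distrib_right is_ideal_add mult.assoc is_ideal_mult)

lemma colon_ge: "is_ideal J \<Longrightarrow> J \<subseteq> colon J P"
  by (auto simp: colon_def is_ideal_mult_right)

lemma colon_antimono: "P \<subseteq> Q \<Longrightarrow> colon J Q \<subseteq> colon J P"
  by (auto simp: colon_def)

lemma colon_self: "is_ideal J \<Longrightarrow> colon J J = UNIV"
  by (auto simp: colon_def is_ideal_mult)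

lemma colon_UNIV: "is_ideal J \<Longrightarrow> colon J UNIV = J"
  using colon_ge[of J UNIV] by (auto simp: colon_def dest: spec[of _ 1])

text \<open>The elements that \<open>z\<close> multiplies into \<open>J\<close> form an ideal
  containing \<open>J\<close>, so testing products of two factors is enough.\<close>

lemma mult_colon_rel_prod:
  assumes "is_ideal J" "\<And>p q. p \<in> P \<Longrightarrow> q \<in> Q \<Longrightarrow> p * q * z \<in> J"
  shows "z \<in> colon J (rel_prod J P Q)"
proof -
  have "rel_prod J P Q \<subseteq> {r. r * z \<in> J}"
    by (rule rel_prod_least, rule ring_module.subspaceI)
      (use assms in \<open>auto simp: is_ideal_0 distrib_right is_ideal_add mult.assoc is_ideal_mult is_ideal_mult_right\<close>)
  then show ?thesis by (auto simp: colon_def mult.commute)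
qed


section \<open>Local rings with a two-generated maximal ideal\<close>

text \<open>The generators are parameters because they are later exchanged for a pair adapted to an
  ideal of colength two.\<close>

locale two_generated_local_ring =
  fixes m :: "'a::comm_ring_1 set" and \<xi> \<eta> :: 'a
  assumes m_nonunits: "m = {r. \<not> r dvd 1}"
    and m_gen: "m = {u * \<xi> + v * \<eta> |u v. True}"
begin

lemma is_ideal_m: "is_ideal m"
proof (rule ring_module.subspaceI)
  show "0 \<in> m" unfolding m_gen by (auto intro!: exI[of _ 0])
  show "x + y \<in> m" if "x \<in> m" "y \<in> m" for x y
  proof -
    from that obtain u v u' v' where "x = u * \<xi> + v * \<eta>" "y = u' * \<xi> + v' * \<eta>" unfolding m_gen by blast
    then have "x + y = (u + u') * \<xi> + (v + v') * \<eta>" by (simp add: algebra_simps)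
    then show ?thesis unfolding m_gen by blast
  qed
  show "c * x \<in> m" if "x \<in> m" for c x
  proof -
    from that obtain u v where "x = u * \<xi> + v * \<eta>" unfolding m_gen by blast
    then have "c * x = (c * u) * \<xi> + (c * v) * \<eta>" by (simp add: algebra_simps)
    then show ?thesis unfolding m_gen by blast
  qed
qed

lemma one_notin_m: "1 \<notin> m"
  by (simp add: m_nonunits)

lemma unit_inverse: assumes "r \<notin> m" obtains s where "s * r = 1"
  using assms unfolding m_nonunits by (auto simp: dvd_def mult.commute)

lemma proper_ideal_le_m:
  assumes "is_ideal P" "P \<noteq> UNIV" shows "P \<subseteq> m"
proof
  fix r assume r: "r \<in> P"
  show "r \<in> m"
  proof (rule ccontr)
    assume "r \<notin> m"
    then obtain s where "s * r = 1" by (rule unit_inverse)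
    then have "1 \<in> P" using is_ideal_mult[OF assms(1) r] by metis
    then have "P = UNIV" using is_ideal_mult[OF assms(1), of 1] by auto
    then show False using assms by simp
  qed
qed

text \<open>Nakayama for one element: \<open>1 - \<mu>\<close> is a unit.\<close>

lemma mem_of_cong_m_multiple:
  assumes "is_ideal P" "\<mu> \<in> m" "z - \<mu> * z \<in> P"
  shows "z \<in> P"
proof -
  have "1 - \<mu> \<notin> m" using is_ideal_add[OF is_ideal_m _ assms(2), of "1 - \<mu>"] one_notin_m by auto
  then obtain s where s: "s * (1 - \<mu>) = 1" by (rule unit_inverse)
  have "s * (z - \<mu> * z) = (s * (1 - \<mu>)) * z" by (simp add: algebra_simps)
  then have "z = s * (z - \<mu> * z)" using s by simp
  then show ?thesis using is_ideal_mult[OF assms(1,3)] by metis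
qed

lemma len_m_UNIV_le: "len m UNIV \<le> 1"
proof (rule len_le)
  fix n N assume N: "ideal_chain m UNIV n N"
  show "enat n \<le> 1"
  proof (rule ccontr)
    assume "\<not> enat n \<le> 1"
    then have n: "n \<ge> 2" by (simp add: one_enat_def)
    then have *: "m \<subseteq> N 0" "N 0 \<subset> N (Suc 0)" "N (Suc 0) \<subset> N (Suc (Suc 0))" "is_ideal (N (Suc 0))"
      using N unfolding ideal_chain_def by auto
    then have "N (Suc 0) \<subseteq> m" using proper_ideal_le_m by blast
    then show False using * by blast
  qed
qed

text \<open>Multiplication by \<open>z\<close> factors through the residue field and reaches all of
  \<open>Q\<close> modulo \<open>P\<close>.\<close>

lemma len_cyclic_le_1:
  assumes "is_ideal P" "\<And>r. r \<in> m \<Longrightarrow> r * z \<in> P"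
    and "\<And>q. q \<in> Q \<Longrightarrow> \<exists>r. q - r * z \<in> P"
  shows "len P Q \<le> 1"
proof -
  have "len P Q \<le> len m UNIV"
    by (rule len_le_mult_surj[where z = z]) (use assms in \<open>auto simp: mult.commute\<close>)
  then show ?thesis using len_m_UNIV_le order_trans by blast
qed

text \<open>Induction on the number of generators: a generator \<open>z\<close> is moved into the
  base ideal. The induction hypothesis gives \<open>N = (z) + J\<close>, and then \<open>z\<close>
  lies in m z + J, which is the case of one element.\<close>

lemma nakayama:
  assumes "finite F" "is_ideal J" "N = ideal_gen (F \<union> J)" "N \<subseteq> rel_prod J m N"
  shows "N = J"
  using assms
proof (induction F arbitrary: J)
  case empty
  then show ?case using ring_module.span_subspace[of J J] ring_module.span_superset[of J] by simp
next
  case (insert z F)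
  let ?J' = "ideal_gen (insert z J)"
  have "J \<subseteq> ?J'" using ring_module.span_superset[of "insert z J"] by blast
  have J': "?J' = {r * z + j |r j. j \<in> J}"
  proof -
    have "?J' = {x. \<exists>k. x - k * z \<in> J}"
      using ring_module.span_insert[of z J]
        ring_module.span_subspace[OF order_refl ring_module.span_superset insert.prems(1)] by simp
    also have "\<dots> = {r * z + j |r j. j \<in> J}"
      by (auto, metis add.commute diff_add_cancel, metis add_diff_cancel_left')
    finally show ?thesis .
  qed
  have "F \<union> ?J' \<subseteq> ideal_gen (insert z F \<union> J)"
    using ring_module.span_mono[of "insert z J" "insert z F \<union> J"] ring_module.span_superset[of "insert z F \<union> J"]
    by blast
  then have "ideal_gen (F \<union> ?J') \<subseteq> N" unfolding insert.prems(2) by (simp add: ring_module.span_minimal)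
  moreover have "N \<subseteq> ideal_gen (F \<union> ?J')"
    unfolding insert.prems(2)
    by (rule ring_module.span_mono) (use ring_module.span_superset[of "insert z J"] in blast)
  ultimately have N': "N = ideal_gen (F \<union> ?J')" by blast
  have "rel_prod J m N \<subseteq> rel_prod ?J' m N"
    by (rule rel_prod_least) (simp, use \<open>J \<subseteq> ?J'\<close> rel_prod_ge[of ?J' m N] in blast, rule rel_prod_mem)
  then have NJ': "N = ?J'" using insert.IH[OF _ N'] insert.prems by blast
  \<comment> \<open>Since \<open>N\<close> is (z) + J, the coefficient of \<open>z\<close> in an
    element of m N + J can be taken in \<open>m\<close>.\<close>
  have "rel_prod J m N \<subseteq> {r * z + j |r j. r \<in> m \<and> j \<in> J}"
  proof (rule rel_prod_least)
    have *: "{r * z + j |r j. r \<in> m \<and> j \<in> J} = {x + y |x y. x \<in> (\<lambda>r. r * z) ` m \<and> y \<in> J}" by blast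
    have "is_ideal ((\<lambda>r. r * z) ` m)"
    proof (rule ring_module.subspaceI)
      show "0 \<in> (\<lambda>r. r * z) ` m" using is_ideal_0[OF is_ideal_m] by force
      show "x + y \<in> (\<lambda>r. r * z) ` m" if "x \<in> (\<lambda>r. r * z) ` m" "y \<in> (\<lambda>r. r * z) ` m" for x y
        using that is_ideal_add[OF is_ideal_m] by (auto simp: distrib_right[symmetric])
      show "c * x \<in> (\<lambda>r. r * z) ` m" if "x \<in> (\<lambda>r. r * z) ` m" for c x
        using that is_ideal_mult[OF is_ideal_m, of _ c] by (auto simp: mult.assoc[symmetric])
    qed
    then show "is_ideal {r * z + j |r j. r \<in> m \<and> j \<in> J}"
      unfolding * using insert.prems(1) by (rule is_ideal_sums)
    show "J \<subseteq> {r * z + j |r j. r \<in> m \<and> j \<in> J}" using is_ideal_0[OF is_ideal_m] by force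
    fix p q assume p: "p \<in> m" and "q \<in> N"
    then obtain r j where q: "q = r * z + j" "j \<in> J" unfolding NJ' J' by blast
    then have "p * q = (p * r) * z + p * j" by (simp add: algebra_simps)
    then show "p * q \<in> {r * z + j |r j. r \<in> m \<and> j \<in> J}"
      using is_ideal_mult_right[OF is_ideal_m p, of r] is_ideal_mult[OF insert.prems(1) q(2), of p] by blast
  qed
  moreover have "z \<in> N" unfolding NJ' by (rule ring_module.span_base) simp
  ultimately obtain r j where "z = r * z + j" "r \<in> m" "j \<in> J" using insert.prems(3) by blast
  then have "z \<in> J" using mem_of_cong_m_multiple[OF insert.prems(1), of r z] by (metis add_diff_cancel_left')
  then have "?J' \<subseteq> J" using insert.prems(1) by (intro ring_module.span_minimal) auto
  then show ?case using NJ' \<open>J \<subseteq> ?J'\<close> by blast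
qed

text \<open>If \<open>N\<close> differs from \<open>J\<close>, the quotient is simple and generated
  by one element; by Nakayama m N + J is not all of \<open>N\<close>, so it is
  \<open>J\<close>.\<close>

lemma m_rel_prod_eq_self:
  assumes "is_ideal J" "len J N \<le> 1" "is_ideal N" "J \<subseteq> N"
  shows "rel_prod J m N = J"
proof (cases "N = J")
  case True
  then show ?thesis using rel_prod_le[of N J m] rel_prod_ge[of J m N] assms by auto
next
  case False
  then obtain z where z: "z \<in> N" "z \<notin> J" using assms by blast
  have simple: "K = J \<or> K = N" if "is_ideal K" "J \<subseteq> K" "K \<subseteq> N" for K
  proof (rule ccontr)
    assume "\<not> ?thesis"
    then have "1 \<le> len J K" "1 \<le> len K N" using that assms len_strict[of J K] len_strict[of K N] by blast+
    then have "1 + 1 \<le> len J N" using len_add[of J K N] that assms by (metis add_mono)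
    with assms(2) have "1 + 1 \<le> (1::enat)" by (rule order_trans[rotated])
    then show False by (simp add: one_enat_def)
  qed
  have "ideal_gen ({z} \<union> J) = N"
  proof -
    have "ideal_gen ({z} \<union> J) \<subseteq> N" using z assms by (intro ring_module.span_minimal) auto
    moreover have "z \<in> ideal_gen ({z} \<union> J)" "J \<subseteq> ideal_gen ({z} \<union> J)"
      using ring_module.span_superset[of "{z} \<union> J"] by auto
    ultimately show ?thesis using simple[of "ideal_gen ({z} \<union> J)"] z(2) by auto
  qed
  then have "\<not> N \<subseteq> rel_prod J m N" using nakayama[of "{z}" J N] assms False by auto
  then show ?thesis using simple[of "rel_prod J m N"] rel_prod_le[of N J m] rel_prod_ge[of J m N] assms by auto
qed

text \<open>The filtration K, K + P'a, N has two factors, and multiplication by \<open>a\<close> and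
  by \<open>b\<close> makes each of them an image of P'/P.\<close>

lemma len_two_generators_le:
  assumes "is_ideal P" "is_ideal K" "K \<subseteq> N" "is_ideal N" "is_ideal P'" 
    and gen: "\<And>q. q \<in> N \<Longrightarrow> \<exists>s\<in>P'. \<exists>t\<in>P'. q - (s * a + t * b) \<in> K"
    and ab: "a \<in> N" "b \<in> N" and PP': "P \<subseteq> P'"
    and Pa: "\<And>r. r \<in> P \<Longrightarrow> r * a \<in> K" and Pb: "\<And>r. r \<in> P \<Longrightarrow> r * b \<in> K"
  shows "len K N \<le> len P P' + len P P'"
proof -
  define K' where "K' = {x + y |x y. x \<in> (\<lambda>r. r * a) ` P' \<and> y \<in> K}"
  have "is_ideal ((\<lambda>r. r * a) ` P')"
  proof (rule ring_module.subspaceI)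
    show "0 \<in> (\<lambda>r. r * a) ` P'" using is_ideal_0[OF assms(5)] by force
    show "x + y \<in> (\<lambda>r. r * a) ` P'" if "x \<in> (\<lambda>r. r * a) ` P'" "y \<in> (\<lambda>r. r * a) ` P'" for x y
      using that is_ideal_add[OF assms(5)] by (auto simp: distrib_right[symmetric])
    show "c * x \<in> (\<lambda>r. r * a) ` P'" if "x \<in> (\<lambda>r. r * a) ` P'" for c x
      using that is_ideal_mult[OF assms(5), of _ c] by (auto simp: mult.assoc[symmetric])
  qed
  then have idK': "is_ideal K'" unfolding K'_def using assms(2) by (rule is_ideal_sums)
  have KK': "K \<subseteq> K'" unfolding K'_def using is_ideal_0[OF assms(5)] by force
  have K'N: "K' \<subseteq> N"
    unfolding K'_def using ab(1) assms(3,4) by (auto intro!: is_ideal_add is_ideal_mult)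
  have "len K K' \<le> len P P'"
  proof (rule len_le_mult_surj[where z = a])
    fix q' assume "q' \<in> K'"
    then obtain r k where "q' = r * a + k" "r \<in> P'" "k \<in> K" unfolding K'_def by blast
    then show "\<exists>q\<in>P'. q' - a * q \<in> K" by (intro bexI[of _ r]) (auto simp: mult.commute)
  qed (use assms in \<open>auto simp: mult.commute\<close>)
  moreover have "len K' N \<le> len P P'"
  proof (rule len_le_mult_surj[where z = b])
    fix q' assume "q' \<in> N"
    then obtain s t where st: "s \<in> P'" "t \<in> P'" "q' - (s * a + t * b) \<in> K" using gen by blast
    then have "s * a + (q' - (s * a + t * b)) \<in> K'" unfolding K'_def by blast
    then show "\<exists>q\<in>P'. q' - b * q \<in> K'" using st by (intro bexI[of _ t]) (auto simp: algebra_simps)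
  qed (use assms idK' KK' in \<open>auto simp: mult.commute\<close>)
  ultimately show ?thesis
    using len_add[OF assms(2) idK' assms(4) KK' K'N] by (simp add: add_mono)
qed

lemma len_m_rel_prod_le_2:
  assumes "is_ideal J" "is_ideal N" "J \<subseteq> N" "a \<in> N" "b \<in> N"
    and "\<And>q. q \<in> N \<Longrightarrow> \<exists>s t. q - (s * a + t * b) \<in> J"
  shows "len (rel_prod J m N) N \<le> 2"
proof -
  have "\<exists>s t. q - (s * a + t * b) \<in> rel_prod J m N" if "q \<in> N" for q
    using assms(6)[OF that] subsetD[OF rel_prod_ge] by metis
  then have "len (rel_prod J m N) N \<le> len m UNIV + len m UNIV"
    by (intro len_two_generators_le[where a = a and b = b and P = m and P' = UNIV])
      (use assms is_ideal_m rel_prod_le[OF assms(2,3), of m] rel_prod_mem[of _ m] in auto)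
  also have "\<dots> \<le> 1 + 1" using len_m_UNIV_le by (intro add_mono)
  finally show ?thesis by (simp add: one_add_one)
qed

end


section \<open>Duality in Gorenstein quotients\<close>

context two_generated_local_ring
begin

lemma m_mult_mem_of_len_le_1:
  assumes "is_ideal P" "is_ideal Q" "P \<subseteq> Q" "len P Q \<le> 1" "\<mu> \<in> m" "q \<in> Q"
  shows "\<mu> * q \<in> P"
  using m_rel_prod_eq_self[OF assms(1,4,2,3)] rel_prod_mem[OF assms(5,6), of P] by simp

lemma cyclic_of_len_le_1:
  assumes "is_ideal P" "is_ideal Q" "P \<subseteq> Q" "len P Q \<le> 1"
  obtains z where "z \<in> Q" "\<And>q. q \<in> Q \<Longrightarrow> \<exists>r. q - r * z \<in> P"
proof (cases "P = Q")
  case True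
  then show ?thesis using that[of 0] is_ideal_0[OF assms(2)] by auto
next
  case False
  then obtain z where z: "z \<in> Q" "z \<notin> P" using assms by blast
  let ?K = "ideal_gen (insert z P)"
  have K: "P \<subseteq> ?K" "z \<in> ?K" using ring_module.span_superset[of "insert z P"] by auto
  have KQ: "?K \<subseteq> Q" using z assms by (intro ring_module.span_minimal) auto
  have "?K = Q"
  proof (rule ccontr)
    assume "?K \<noteq> Q"
    then have "1 \<le> len P ?K" "1 \<le> len ?K Q"
      using K KQ z assms by (auto intro!: len_strict)
    then have "1 + 1 \<le> len P Q"
      using len_add[of P ?K Q] K KQ assms by (metis add_mono ring_module.subspace_span)
    with assms(4) have "1 + 1 \<le> (1::enat)" by (rule order_trans[rotated])
    then show False by (simp add: one_enat_def)
  qed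
  moreover have "?K = {x. \<exists>k. x - k * z \<in> P}"
    using ring_module.span_insert[of z P]
      ring_module.span_subspace[OF order_refl ring_module.span_superset assms(1)] by simp
  ultimately show ?thesis using that[of z] z by blast
qed

end

locale gorenstein_quotient = two_generated_local_ring m \<xi> \<eta>
  for m :: "'a::comm_ring_1 set" and \<xi> \<eta> +
  fixes J :: "'a set"
  assumes is_ideal_J: "is_ideal J"
    and finite_len: "len J UNIV \<noteq> \<infinity>"
    and socle_len: "len J (colon J m) \<le> 1"
begin

text \<open>Finite by \<open>finite_len\<close>, so that lengths become natural numbers and can be
  subtracted.\<close>

definition ell :: "'a set \<Rightarrow> nat" where
  "ell P = the_enat (len J P)"

lemma len_J: "len J P = enat (ell P)"
proof -
  have "len J P \<le> len J UNIV" by (rule len_mono) auto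
  moreover obtain l where "len J UNIV = enat l" using finite_len by auto
  ultimately obtain k where "len J P = enat k" using enat_ile by metis
  then show ?thesis unfolding ell_def by auto
qed

lemma ell_J: "ell J = 0"
  using len_J[of J] len_self[of J] by (simp add: zero_enat_def)

lemma ell_eq_add_len:
  assumes "is_ideal P" "is_ideal Q" "J \<subseteq> P" "P \<subseteq> Q"
  shows "enat (ell Q) = enat (ell P) + len P Q"
  using len_add[OF is_ideal_J assms(1,2,3,4)] by (simp add: len_J)

lemma ell_mono: "is_ideal P \<Longrightarrow> is_ideal Q \<Longrightarrow> J \<subseteq> P \<Longrightarrow> P \<subseteq> Q \<Longrightarrow> ell P \<le> ell Q"
  using ell_eq_add_len[of P Q] by (metis enat_ord_simps(1) le_iff_add)

lemma ell_le_add: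
  assumes "is_ideal P" "is_ideal Q" "J \<subseteq> P" "P \<subseteq> Q" "len P Q \<le> enat c"
  shows "ell Q \<le> ell P + c"
proof -
  have "enat (ell Q) \<le> enat (ell P) + enat c"
    unfolding ell_eq_add_len[OF assms(1-4)] using assms(5) by (rule add_left_mono)
  then show ?thesis by simp
qed

lemma len_eq_ell_diff:
  assumes "is_ideal P" "is_ideal Q" "J \<subseteq> P" "P \<subseteq> Q"
  shows "len P Q = enat (ell Q - ell P)"
proof -
  have "enat (ell P) + len P Q = enat (ell Q)" using ell_eq_add_len[OF assms] by simp
  then show ?thesis by (cases "len P Q") auto
qed

lemma ell_strict:
  assumes "is_ideal P" "is_ideal Q" "J \<subseteq> P" "P \<subset> Q" shows "ell P < ell Q"
proof -
  have "1 \<le> len P Q" using len_strict assms by blast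
  then have "1 \<le> enat (ell Q - ell P)" using len_eq_ell_diff[of P Q] assms by auto
  then show ?thesis by (simp add: one_enat_def)
qed

text \<open>Induction along a composition series from \<open>P\<close> to \<open>Q\<close>. On its
  top step \<open>Q\<close> is N + (z) with m z inside \<open>N\<close>, so multiplication by
  \<open>z\<close> maps \<open>colon J N\<close> into the socle with kernel
  \<open>colon J Q\<close>; the socle has length at most one.\<close>

lemma len_colon_le:
  assumes "is_ideal P" "is_ideal Q" "J \<subseteq> P" "P \<subseteq> Q" "len P Q = enat d"
  shows "len (colon J Q) (colon J P) \<le> enat d"
  using assms
proof (induction d arbitrary: Q)
  case 0
  then have "P = Q" using len_strict[of P Q] by (auto simp: one_enat_def)
  then show ?case by (simp add: len_self)
next
  case (Suc d)
  obtain N where N: "is_ideal N" "P \<subseteq> N" "N \<subset> Q" "len P N = enat d" "len N Q = 1"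
    by (rule len_SucE[OF Suc.prems(5)]) (use Suc.prems in auto)
  obtain z where z: "z \<in> Q" "\<And>q. q \<in> Q \<Longrightarrow> \<exists>r. q - r * z \<in> N"
    by (rule cyclic_of_len_le_1[OF N(1) Suc.prems(2)]) (use N in auto)
  have "len (colon J Q) (colon J N) \<le> len J (colon J m)"
  proof (rule len_le_mult_inj[where z = z])
    show "z * q \<in> colon J m" if "q \<in> colon J N" for q
      unfolding colon_def
    proof safe
      fix \<mu> assume "\<mu> \<in> m"
      then have "\<mu> * z \<in> N" using m_mult_mem_of_len_le_1[of N Q \<mu> z] N z Suc.prems by auto
      then have "q * (\<mu> * z) \<in> J" using that by (auto simp: colon_def)
      then show "z * q * \<mu> \<in> J" by (simp add: ac_simps)
    qed
    show "q \<in> colon J Q" if q: "q \<in> colon J N" "z * q \<in> J" for q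
      unfolding colon_def
    proof safe
      fix t assume "t \<in> Q"
      then obtain r where "t - r * z \<in> N" using z by blast
      then have "q * (t - r * z) \<in> J" using q by (auto simp: colon_def)
      from is_ideal_add[OF is_ideal_J this is_ideal_mult[OF is_ideal_J q(2), of r]]
      show "q * t \<in> J" by (simp add: algebra_simps)
    qed
  qed (simp_all add: is_ideal_J is_ideal_colon colon_ge)
  also have "\<dots> \<le> 1" by (rule socle_len)
  finally have 1: "len (colon J Q) (colon J N) \<le> 1" .
  have 2: "len (colon J N) (colon J P) \<le> enat d" using Suc.IH[of N] N Suc.prems by auto
  have "len (colon J Q) (colon J P) = len (colon J Q) (colon J N) + len (colon J N) (colon J P)"
    using N by (intro len_add is_ideal_colon is_ideal_J colon_antimono) auto
  also have "\<dots> \<le> 1 + enat d" using 1 2 by (rule add_mono)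
  finally show ?case by (simp add: one_enat_def)
qed

text \<open>Two applications of \<open>len_colon_le\<close>: from \<open>P\<close> up to the whole
  ring, whose colon is \<open>J\<close>, and from \<open>J\<close> up to \<open>P\<close>, where the
  colon of \<open>J\<close> is the whole ring.\<close>

lemma ell_colon:
  assumes "is_ideal P" "J \<subseteq> P"
  shows "ell (colon J P) + ell P = ell UNIV"
proof -
  have C: "is_ideal (colon J P)" "J \<subseteq> colon J P"
    using is_ideal_J by (simp_all add: is_ideal_colon colon_ge)
  have "len (colon J UNIV) (colon J P) \<le> enat (ell UNIV - ell P)"
    using assms by (intro len_colon_le len_eq_ell_diff) auto
  then have "ell (colon J P) \<le> ell UNIV - ell P" by (simp add: colon_UNIV is_ideal_J len_J)
  moreover have "len (colon J P) (colon J J) \<le> enat (ell P)"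
    using assms is_ideal_J by (intro len_colon_le len_J) auto
  then have "ell UNIV \<le> ell (colon J P) + ell P"
    using C by (intro ell_le_add) (auto simp: colon_self is_ideal_J)
  moreover have "ell P \<le> ell UNIV" using assms by (intro ell_mono) auto
  ultimately show ?thesis by simp
qed

text \<open>The form in which a vanishing product of two ideals of A becomes a numerical
  bound.\<close>

lemma ell_add_le_of_annihilates:
  assumes "is_ideal P" "J \<subseteq> P" "is_ideal N" "J \<subseteq> N" "\<And>z. z \<in> P \<Longrightarrow> z \<in> colon J N"
  shows "ell P + ell N \<le> ell UNIV"
proof -
  have "ell P \<le> ell (colon J N)" using assms is_ideal_J by (intro ell_mono is_ideal_colon) auto
  then show ?thesis using ell_colon[of N] assms by simp
qed

end

section \<open>Ideals of colength two\<close>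

text \<open>One pair \<open>a\<close>, \<open>y\<close> serves both ideals: it generates
  \<open>m\<close>, and \<open>a\<close>, \<open>y^2\<close> generate \<open>I\<close>. Such a pair
  is supplied by \<open>colength_two_generators\<close>.\<close>

locale colength_two_quotient = gorenstein_quotient m a y J
  for m :: "'a::comm_ring_1 set" and a y J +
  fixes I :: "'a set"
  assumes I_gen: "I = {u * a + v * y^2 |u v. True}"
    and J_le_I: "J \<subseteq> I"
    and is_ideal_I: "is_ideal I"
    and len_I: "len I UNIV = 2"
begin

text \<open>The Hilbert function is h_n = l(\<open>B n\<close>) - l(\<open>B (Suc n)\<close>), so
  l(\<open>B n\<close>) is the tail sum h_n + h_(n+1) + ...\<close>

abbreviation B :: "nat \<Rightarrow> 'a set" where "B \<equiv> rel_pow J I"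

lemma B1: "B (Suc 0) = I"
  using rel_pow_1 is_ideal_I J_le_I by blast

lemma a_I: "a \<in> I" and y2_I: "y^2 \<in> I"
proof -
  have "a = 1 * a + 0 * y^2" "y^2 = 0 * a + 1 * y^2" by simp_all
  then show "a \<in> I" "y^2 \<in> I" unfolding I_gen by blast+
qed

lemma I_le_m: "I \<subseteq> m"
proof -
  have "I \<noteq> UNIV" using len_I len_self[of UNIV] by (metis zero_neq_numeral)
  then show ?thesis by (rule proper_ideal_le_m[OF is_ideal_I])
qed

lemma J_le_m: "J \<subseteq> m"
  using J_le_I I_le_m by blast

lemma ell_I: "ell UNIV = ell I + 2"
  using ell_eq_add_len[OF is_ideal_I ring_module.subspace_UNIV J_le_I] len_I by (simp add: numeral_eq_enat)

lemma ell_m: "ell UNIV \<le> ell m + 1"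
  using is_ideal_m J_le_m len_m_UNIV_le by (intro ell_le_add) (auto simp: one_enat_def)

lemma I_mult_B: "p \<in> I \<Longrightarrow> q \<in> B n \<Longrightarrow> p * q \<in> B (Suc n)"
  by (simp add: rel_prod_mem)

lemma I_mult_I: "p \<in> I \<Longrightarrow> q \<in> I \<Longrightarrow> p * q \<in> B (Suc (Suc 0))"
  using I_mult_B[of p q "Suc 0"] B1 by simp

lemma I_mult_B2: "p \<in> I \<Longrightarrow> q \<in> B (Suc (Suc 0)) \<Longrightarrow> p * q \<in> B (Suc (Suc (Suc 0)))"
  by (rule I_mult_B)

lemma B_Suc_le: "B (Suc n) \<subseteq> B n" by (rule rel_pow_Suc_le)

lemma ell_B_mono: "ell (B (Suc n)) \<le> ell (B n)"
  by (intro ell_mono B_Suc_le rel_pow_ge is_ideal_rel_pow)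

lemma B_Suc_least:
  assumes "is_ideal K" "J \<subseteq> K" "\<And>p q. p \<in> I \<Longrightarrow> q \<in> B n \<Longrightarrow> p * q \<in> K" "z \<in> B (Suc n)"
  shows "z \<in> K"
  using rel_prod_least[OF assms(1,2), of I "B n"] assms(3,4) by auto

lemma B2_least:
  assumes "is_ideal K" "J \<subseteq> K" "\<And>p q. p \<in> I \<Longrightarrow> q \<in> I \<Longrightarrow> p * q \<in> K" "z \<in> B (Suc (Suc 0))"
  shows "z \<in> K"
  by (rule B_Suc_least[OF assms(1,2) _ assms(4)]) (use assms(3) B1 in auto)

lemma len_B: "len (B (Suc n)) (B n) = enat (ell (B n) - ell (B (Suc n)))"
  by (rule len_eq_ell_diff) (simp_all add: rel_pow_ge B_Suc_le del: rel_pow.simps)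

lemma m_mult_B:
  assumes "ell (B n) \<le> ell (B (Suc n)) + 1" "\<mu> \<in> m" "z \<in> B n"
  shows "\<mu> * z \<in> B (Suc n)"
proof (rule m_mult_mem_of_len_le_1[OF _ _ B_Suc_le _ assms(2,3)])
  show "len (B (Suc n)) (B n) \<le> 1" unfolding len_B using assms(1) by (simp add: one_enat_def)
qed (simp_all del: rel_pow.simps)

abbreviation mI :: "'a set" where "mI \<equiv> rel_prod J m I"

lemma mI_le: "mI \<subseteq> I" by (rule rel_prod_le[OF is_ideal_I J_le_I])

lemma ell_mI: "ell I \<le> ell mI + 2"
proof -
  have "len mI I \<le> 2"
  proof (rule len_m_rel_prod_le_2[OF is_ideal_J is_ideal_I J_le_I a_I y2_I])
    fix q assume "q \<in> I"
    then obtain u v where "q = u * a + v * y^2" unfolding I_gen by blast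
    then show "\<exists>s t. q - (s * a + t * y^2) \<in> J"
      using is_ideal_0[OF is_ideal_J] by (intro exI[of _ u] exI[of _ v]) simp
  qed
  then show ?thesis
    using is_ideal_I mI_le rel_prod_ge by (intro ell_le_add) (simp_all add: numeral_eq_enat)
qed

text \<open>This is h_1 <= 4: I/I^2 has two generators over R/I, a ring of length 2.\<close>

lemma ell_B1_le: "ell I \<le> ell (B 2) + 4"
proof -
  have "len (B 2) I \<le> len I UNIV + len I UNIV"
  proof (rule len_two_generators_le[where a = a and b = "y^2"])
    show "\<exists>s\<in>UNIV. \<exists>t\<in>UNIV. q - (s * a + t * y^2) \<in> B 2" if "q \<in> I" for q
    proof -
      from that obtain u v where "q = u * a + v * y^2" unfolding I_gen by blast
      then show ?thesis using is_ideal_0[of "B 2"] by (intro bexI[of _ u] bexI[of _ v]) auto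
    qed
    show "B 2 \<subseteq> I" using rel_pow_antimono[of "Suc 0" 2 J I] B1 by simp
  qed (use is_ideal_I a_I y2_I I_mult_I in \<open>auto simp: numeral_2_eq_2 simp del: rel_pow.simps\<close>)
  then have "len (B 2) I \<le> enat 4" by (simp add: len_I numeral_eq_enat)
  then show ?thesis
    using is_ideal_I rel_pow_ge rel_pow_antimono[of "Suc 0" 2 J I] B1
    by (intro ell_le_add) (simp_all del: rel_pow.simps)
qed

text \<open>I annihilates I^u and has colength 2.\<close>

lemma ell_last_le_2:
  assumes "B (Suc u) = J"
  shows "ell (B u) \<le> 2"
proof -
  have "ell I + ell (B u) \<le> ell UNIV"
  proof (rule ell_add_le_of_annihilates)
    show "z \<in> colon J (B u)" if "z \<in> I" for z
      using I_mult_B[OF that, of _ u] assms by (auto simp: colon_def simp del: rel_pow.simps)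
  qed (simp_all add: is_ideal_I J_le_I rel_pow_ge)
  then show ?thesis using ell_I by simp
qed

text \<open>A value h_i <= 1 makes m I^i part of I^(i+1). Multiplying by I^(u-i) gives m I^u = 0,
  and m has colength at most 1.\<close>

lemma ell_last_le_1:
  assumes "B (Suc u) = J" "i \<le> u" "ell (B i) \<le> ell (B (Suc i)) + 1"
  shows "ell (B u) \<le> 1"
proof -
  have *: "\<forall>\<mu>\<in>m. \<forall>z\<in>B u. \<mu> * z \<in> B (Suc u)" using assms(2)
  proof (induction rule: dec_induct)
    case base
    then show ?case using m_mult_B assms(3) by blast
  next
    case (step n)
    show ?case
    proof (intro ballI)
      fix \<mu> z assume \<mu>: "\<mu> \<in> m" and z: "z \<in> B (Suc n)"
      \<comment> \<open>Being multiplied by \<open>\<mu>\<close> into I^(n+2) defines an ideal, so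
        only products p q with q in I^n have to be tested.\<close>
      have "z \<in> colon (B (Suc (Suc n))) {\<mu>}"
      proof (rule B_Suc_least[OF _ _ _ z])
        show "is_ideal (colon (B (Suc (Suc n))) {\<mu>})"
          by (intro is_ideal_colon is_ideal_rel_pow)
        show "J \<subseteq> colon (B (Suc (Suc n))) {\<mu>}"
          by (rule order_trans[OF rel_pow_ge colon_ge[OF is_ideal_rel_pow]])
        fix p q assume p: "p \<in> I" and q: "q \<in> B n"
        have "p * (\<mu> * q) \<in> B (Suc (Suc n))" using I_mult_B[OF p] step.IH \<mu> q by blast
        then show "p * q \<in> colon (B (Suc (Suc n))) {\<mu>}"
          by (simp add: colon_def ac_simps del: rel_pow.simps)
      qed
      then show "\<mu> * z \<in> B (Suc (Suc n))" by (simp add: colon_def mult.commute del: rel_pow.simps)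
    qed
  qed
  have "ell m + ell (B u) \<le> ell UNIV"
  proof (rule ell_add_le_of_annihilates)
    show "z \<in> colon J (B u)" if "z \<in> m" for z
      using * that assms(1) by (auto simp: colon_def simp del: rel_pow.simps)
  qed (simp_all add: is_ideal_m J_le_m rel_pow_ge)
  then show ?thesis using ell_m by simp
qed

text \<open>Equal lengths of nested ideals mean equality, and I^n = I^(n+1) persists under
  multiplication by I.\<close>

lemma ell_B_stable:
  assumes "ell (B n) = ell (B (Suc n))" shows "ell (B (Suc n)) = ell (B (Suc (Suc n)))"
proof -
  have "B (Suc n) = B n"
    using ell_strict[of "B (Suc n)" "B n"] assms rel_pow_ge B_Suc_le
    by (metis is_ideal_rel_pow less_irrefl psubsetI)
  then have "B (Suc (Suc n)) = B (Suc n)" by simp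
  then show ?thesis by simp
qed

text \<open>The case u = 2 with h_2 <= 1. Then m I^2 = 0, so I and mI annihilate each other; as I
  has colength 2, l(mI) <= 2 and h_1 + h_2 = l(I) <= 4.\<close>

lemma ell_I_le_4:
  assumes "B 3 = J" "ell (B 2) \<le> 1"
  shows "ell I \<le> 4"
proof -
  have mB2: "\<mu> * z \<in> J" if "\<mu> \<in> m" "z \<in> B 2" for \<mu> z
    using m_mult_B[of 2 \<mu> z] assms that by (simp add: numeral_3_eq_3 numeral_2_eq_2 ell_J del: rel_pow.simps)
  have "ell I + ell mI \<le> ell UNIV"
  proof (rule ell_add_le_of_annihilates)
    fix z assume z: "z \<in> I"
    show "z \<in> colon J mI"
    proof (rule mult_colon_rel_prod[OF is_ideal_J])
      fix \<mu> i assume "\<mu> \<in> m" "i \<in> I"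
      then show "\<mu> * i * z \<in> J"
        using mB2[of \<mu> "i * z"] I_mult_I[of i z] z
        by (simp add: mult.assoc numeral_2_eq_2 del: rel_pow.simps)
    qed
  qed (simp_all add: is_ideal_I J_le_I rel_prod_ge)
  then show ?thesis using ell_mI ell_I by simp
qed

text \<open>For u = 3 the ideal I^2 annihilates itself. In terms of h this reads h_2 + h_3 <= 2 +
  h_1.\<close>

lemma two_ell_B2_le:
  assumes "B 4 = J"
  shows "2 * ell (B 2) \<le> ell UNIV"
proof -
  have "ell (B 2) + ell (B 2) \<le> ell UNIV"
  proof (rule ell_add_le_of_annihilates)
    fix z assume z: "z \<in> B 2"
    have "z \<in> colon J (rel_prod J I (B (Suc 0)))"
    proof (rule mult_colon_rel_prod[OF is_ideal_J])
      fix p q assume "p \<in> I" "q \<in> B (Suc 0)"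
      then have "p * (q * z) \<in> B 4"
        using I_mult_B[of p "q * z" 3] I_mult_B[of q z 2] z B1
        by (simp add: numeral_eq_Suc del: rel_pow.simps)
      then show "p * q * z \<in> J" using assms by (simp add: mult.assoc)
    qed
    then show "z \<in> colon J (B 2)" by (simp add: numeral_2_eq_2)
  qed (simp_all add: rel_pow_ge)
  then show ?thesis by simp
qed

text \<open>The case u = 3 with h_3 <= 1: m I^3 = 0, so I^2 annihilates mI. Together with l(A) =
  l(I) + 2 it says h_2 + h_3 <= 4.\<close>

lemma ell_I_add_ell_B2_le:
  assumes "B 4 = J" "ell (B 3) \<le> 1"
  shows "ell I + ell (B 2) \<le> ell UNIV + 2"
proof -
  have mB3: "\<mu> * z \<in> J" if "\<mu> \<in> m" "z \<in> B 3" for \<mu> z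
    using m_mult_B[of 3 \<mu> z] assms that by (simp add: numeral_eq_Suc ell_J del: rel_pow.simps)
  have "ell (B 2) + ell mI \<le> ell UNIV"
  proof (rule ell_add_le_of_annihilates)
    fix z assume z: "z \<in> B 2"
    show "z \<in> colon J mI"
    proof (rule mult_colon_rel_prod[OF is_ideal_J])
      fix \<mu> i assume "\<mu> \<in> m" "i \<in> I"
      then show "\<mu> * i * z \<in> J"
        using mB3[of \<mu> "i * z"] I_mult_B[of i z 2] z
        by (simp add: mult.assoc numeral_eq_Suc del: rel_pow.simps)
    qed
  qed (simp_all add: rel_pow_ge rel_prod_ge)
  then show ?thesis using ell_mI by simp
qed


text \<open>Modulo I^3 the ideal I^2 is generated by one element that \<open>m\<close> kills. Both
  growth bounds below use this, with different choices of \<open>z\<close>.\<close>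

lemma len_B_le_1_of_square:
  assumes "\<And>\<mu>. \<mu> \<in> m \<Longrightarrow> \<mu> * z^2 \<in> B 3"
    and "\<And>p q. p \<in> I \<Longrightarrow> q \<in> I \<Longrightarrow> \<exists>r. p * q - r * z^2 \<in> B 3"
  shows "ell (B 2) \<le> ell (B 3) + 1"
proof -
  have "len (B 3) (B 2) \<le> 1"
  proof (rule len_cyclic_le_1[OF _ assms(1)])
    fix t assume t: "t \<in> B 2"
    have "t \<in> {t. \<exists>r. t - r * z^2 \<in> B 3}"
    proof (rule B2_least)
      show "is_ideal {t. \<exists>r. t - r * z^2 \<in> B 3}"
        using ring_module.span_insert[of "z^2" "B 3"] ring_module.subspace_span[of "insert (z^2) (B 3)"]
          ring_module.span_subspace[OF order_refl ring_module.span_superset is_ideal_rel_pow[of J I 3]]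
        by simp
      show "J \<subseteq> {t. \<exists>r. t - r * z^2 \<in> B 3}"
        using rel_pow_ge[of J I 3] by (auto intro!: exI[of _ 0] simp del: rel_pow.simps)
      show "t \<in> B (Suc (Suc 0))" using t by (simp add: numeral_2_eq_2)
    qed (use assms(2) in blast)
    then show "\<exists>r. t - r * z^2 \<in> B 3" by blast
  qed simp
  then have "len (B 3) (B 2) \<le> enat 1" by (simp add: one_enat_def)
  moreover have "B 3 \<subseteq> B 2" by (rule rel_pow_antimono) simp
  ultimately show ?thesis by (intro ell_le_add rel_pow_ge) simp_all
qed

text \<open>I is generated by one \<open>z\<close> modulo I^2, hence I^2 by \<open>z^2\<close>
  modulo I^3; and since m z lies in I^2, m \<open>z^2\<close> lies in I^3.\<close>

lemma h2_le_1_if_h1_le_1: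
  assumes "ell I \<le> ell (B 2) + 1"
  shows "ell (B 2) \<le> ell (B 3) + 1"
proof -
  have len1: "len (B 2) I \<le> 1"
    using len_B[of 1] assms B1 by (simp add: one_enat_def numeral_2_eq_2 del: rel_pow.simps)
  have le: "B 2 \<subseteq> I" using B_Suc_le[of 1] B1 by (simp add: numeral_2_eq_2 del: rel_pow.simps)
  obtain z where z: "z \<in> I" "\<And>q. q \<in> I \<Longrightarrow> \<exists>r. q - r * z \<in> B 2"
    by (rule cyclic_of_len_le_1[OF _ is_ideal_I le len1]) auto
  have IB: "p * q \<in> B 3" if "p \<in> I" "q \<in> B 2" for p q
    using I_mult_B2[of p q] that by (simp add: numeral_eq_Suc del: rel_pow.simps)
  show ?thesis
  proof (rule len_B_le_1_of_square[where z = z])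
    fix \<mu> assume "\<mu> \<in> m"
    then have "\<mu> * z \<in> B 2" using m_mult_mem_of_len_le_1[OF _ is_ideal_I le len1] z by auto
    from IB[OF z(1) this] show "\<mu> * z^2 \<in> B 3" by (simp add: power2_eq_square ac_simps)
  next
    fix p q assume p: "p \<in> I" and q: "q \<in> I"
    obtain r s where r: "p - r * z \<in> B 2" and s: "q - s * z \<in> B 2" using z(2)[OF p] z(2)[OF q] by blast
    have "p * q - (r * s) * z^2 = p * (q - s * z) + (s * z) * (p - r * z)"
      by (simp add: algebra_simps power2_eq_square)
    also have "\<dots> \<in> B 3"
      using IB[OF p s] IB[OF is_ideal_mult[OF is_ideal_I z(1), of s] r]
      by (intro is_ideal_add is_ideal_rel_pow)
    finally show "\<exists>r. p * q - r * z^2 \<in> B 3" by blast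
  qed
qed

text \<open>The cases are the possible dimensions of I/mI. If it is at most 1, I is principal modulo
  \<open>J\<close> and its generator maps I/I^2 onto I^2/I^3. Otherwise mI and I^2 have the same
  colength in I, so mI = I^2; then y^2 I lies in m I^2, inside I^3, and of the generators of I^2
  only \<open>a^2\<close> survives.\<close>

lemma h2_le_2_if_h1_le_2:
  assumes "ell I \<le> ell (B 2) + 2"
  shows "ell (B 2) \<le> ell (B 3) + 2"
proof (cases "ell I \<le> ell mI + 1")
  case True
  have "len mI I \<le> 1"
    using True len_eq_ell_diff[of mI I] is_ideal_I mI_le by (simp add: rel_prod_ge one_enat_def)
  then obtain z where z: "z \<in> I" "\<And>q. q \<in> I \<Longrightarrow> \<exists>r. q - r * z \<in> mI"
    by (rule cyclic_of_len_le_1[OF _ is_ideal_I mI_le, rotated]) auto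
  define K where "K = ideal_gen (insert z J)"
  have K: "K = {x. \<exists>k. x - k * z \<in> J}"
    unfolding K_def using ring_module.span_insert[of z J]
      ring_module.span_subspace[OF order_refl ring_module.span_superset is_ideal_J] by simp
  have "J \<subseteq> K" "z \<in> K" unfolding K_def using ring_module.span_superset[of "insert z J"] by auto
  have idK: "is_ideal K" unfolding K_def by simp
  have KI: "K \<subseteq> I" unfolding K_def using z(1) is_ideal_I J_le_I by (intro ring_module.span_minimal) auto
  \<comment> \<open>\<open>z\<close> generates I modulo mI; Nakayama over the base \<open>K\<close>
    lifts this to I = (z) + J.\<close>
  have "I = K"
  proof (rule nakayama[of "{a, y^2}"])
    show "I = ideal_gen ({a, y^2} \<union> K)"
    proof
      show "ideal_gen ({a, y^2} \<union> K) \<subseteq> I"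
        using KI a_I y2_I is_ideal_I by (intro ring_module.span_minimal) auto
      have "a \<in> ideal_gen ({a, y^2} \<union> K)" "y^2 \<in> ideal_gen ({a, y^2} \<union> K)"
        by (rule ring_module.span_base, simp)+
      then show "I \<subseteq> ideal_gen ({a, y^2} \<union> K)"
        unfolding I_gen by (auto intro!: ring_module.span_add ring_module.span_scale)
    qed
    show "I \<subseteq> rel_prod K m I"
    proof
      fix q assume "q \<in> I"
      then obtain r where r: "q - r * z \<in> mI" using z by blast
      have "mI \<subseteq> rel_prod K m I"
        by (rule rel_prod_least[OF is_ideal_rel_prod _ rel_prod_mem])
          (use \<open>J \<subseteq> K\<close> rel_prod_ge[of K m I] in auto)
      then have "q - r * z \<in> rel_prod K m I" using r by blast
      moreover have "r * z \<in> rel_prod K m I"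
        using is_ideal_mult[OF idK \<open>z \<in> K\<close>, of r] rel_prod_ge[of K m I] by blast
      ultimately have "(q - r * z) + r * z \<in> rel_prod K m I" by (rule is_ideal_add[OF is_ideal_rel_prod])
      then show "q \<in> rel_prod K m I" by simp
    qed
  qed (use idK in auto)
  have "len (B 3) (B 2) \<le> len (B 2) I"
  proof (rule len_le_mult_surj[where z = z])
    show "z * p \<in> B 3" if "p \<in> B 2" for p
      using I_mult_B2[OF z(1), of p] that by (simp add: numeral_eq_Suc del: rel_pow.simps)
    show "B 2 \<subseteq> I" using B_Suc_le[of 1] B1 by (simp add: numeral_2_eq_2 del: rel_pow.simps)
    fix t assume "t \<in> B 2"
    then have t: "t \<in> B (Suc (Suc 0))" by (simp add: numeral_2_eq_2)
    have "t \<in> {x + y |x y. x \<in> (*) z ` I \<and> y \<in> B 3}"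
    proof (rule B2_least[OF _ _ _ t])
      have "is_ideal ((*) z ` I)"
      proof (rule ring_module.subspaceI)
        show "0 \<in> (*) z ` I" using is_ideal_0[OF is_ideal_I] by force
        show "x + y \<in> (*) z ` I" if "x \<in> (*) z ` I" "y \<in> (*) z ` I" for x y
          using that is_ideal_add[OF is_ideal_I] by (auto simp: distrib_left[symmetric])
        show "c * x \<in> (*) z ` I" if xI: "x \<in> (*) z ` I" for c x
        proof -
          obtain w where "x = z * w" "w \<in> I" using xI by blast
          then show ?thesis
            using is_ideal_mult[OF is_ideal_I, of w c] by (intro image_eqI[of _ _ "c * w"]) (auto simp: ac_simps)
        qed
      qed
      then show "is_ideal {x + y |x y. x \<in> (*) z ` I \<and> y \<in> B 3}"
        by (intro is_ideal_sums is_ideal_rel_pow)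
      have 0: "0 \<in> (*) z ` I" using is_ideal_0[OF is_ideal_I] by force
      then show "J \<subseteq> {x + y |x y. x \<in> (*) z ` I \<and> y \<in> B 3}"
        using rel_pow_ge[of J I 3] by force
      fix p q assume "p \<in> I" and q: "q \<in> I"
      then obtain r where r: "p - r * z \<in> J" using \<open>I = K\<close> K by blast
      have "p * q = z * (r * q) + q * (p - r * z)" by (simp add: algebra_simps)
      moreover have "r * q \<in> I" by (rule is_ideal_mult[OF is_ideal_I q])
      moreover have "q * (p - r * z) \<in> B 3"
        using is_ideal_mult[OF is_ideal_J r, of q] rel_pow_ge[of J I 3] by blast
      ultimately show "p * q \<in> {x + y |x y. x \<in> (*) z ` I \<and> y \<in> B 3}" by blast
    qed
    then obtain q b where "q \<in> I" "b \<in> B 3" "t = z * q + b" by blast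
    then show "\<exists>q\<in>I. t - z * q \<in> B 3" by (intro bexI[of _ q]) auto
  qed (simp_all add: is_ideal_I)
  moreover have "len (B 2) I = enat (ell I - ell (B 2))"
    using len_B[of 1] B1 by (simp add: numeral_2_eq_2 del: rel_pow.simps)
  ultimately have "len (B 3) (B 2) \<le> enat (ell I - ell (B 2))" by simp
  also have "\<dots> \<le> enat 2" using assms by simp
  finally have "len (B 3) (B 2) \<le> enat 2" .
  moreover have "B 3 \<subseteq> B 2" by (rule rel_pow_antimono) simp
  ultimately show ?thesis by (intro ell_le_add rel_pow_ge) simp_all
next
  case False
  have B2mI: "B 2 \<subseteq> mI"
    using rel_prod_mono[of I m I I J] I_le_m B1 by (simp add: numeral_2_eq_2)
  \<comment> \<open>I^2 is always inside mI. A strict inclusion would leave l(I) - l(mI) at most 1,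
    the case already treated.\<close>
  have "mI = B 2"
  proof (rule ccontr)
    assume "mI \<noteq> B 2"
    then have "ell (B 2) < ell mI" using B2mI by (intro ell_strict) (auto simp: rel_pow_ge simp del: rel_pow.simps)
    then show False using False assms by simp
  qed
  then have mB: "\<mu> * q \<in> B 2" if "\<mu> \<in> m" "q \<in> I" for \<mu> q
    using rel_prod_mem[OF that, of J] by simp
  have mB3: "\<mu> * t \<in> B 3" if \<mu>: "\<mu> \<in> m" and t: "t \<in> B 2" for \<mu> t
  proof -
    have "t \<in> colon (B 3) {\<mu>}"
    proof (rule B2_least)
      show "is_ideal (colon (B 3) {\<mu>})" by (intro is_ideal_colon is_ideal_rel_pow)
      show "J \<subseteq> colon (B 3) {\<mu>}" by (rule order_trans[OF rel_pow_ge colon_ge[OF is_ideal_rel_pow]])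
      show "t \<in> B (Suc (Suc 0))" using t by (simp add: numeral_2_eq_2)
      fix p q assume p: "p \<in> I" and q: "q \<in> I"
      have "p * (\<mu> * q) \<in> B 3"
        using I_mult_B2[OF p] mB[OF \<mu> q] by (simp add: numeral_eq_Suc del: rel_pow.simps)
      then show "p * q \<in> colon (B 3) {\<mu>}" by (simp add: colon_def ac_simps del: rel_pow.simps)
    qed
    then show ?thesis by (simp add: colon_def mult.commute del: rel_pow.simps)
  qed
  have y: "y \<in> m"
  proof -
    have "y = 0 * a + 1 * y" by simp
    then show ?thesis unfolding m_gen by blast
  qed
  have "ell (B 2) \<le> ell (B 3) + 1"
  proof (rule len_B_le_1_of_square[where z = a])
    fix \<mu> assume "\<mu> \<in> m"
    then have "\<mu> * a^2 \<in> B 3"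
      using I_mult_B2[OF a_I, of "\<mu> * a"] mB[of \<mu> a] a_I
      by (simp add: numeral_eq_Suc ac_simps del: rel_pow.simps)
    then show "\<mu> * a^2 \<in> B 3" .
  next
    fix p q assume "p \<in> I" "q \<in> I"
    then obtain u v u' v' where pq: "p = u * a + v * y^2" "q = u' * a + v' * y^2" unfolding I_gen by blast
    have y2: "y^2 * t \<in> B 3" if "t \<in> I" for t
      using mB3[OF y mB[OF y that]] by (simp add: power2_eq_square ac_simps)
    have "p * q - (u * u') * a^2 = v * (y^2 * q) + (u * v') * (y^2 * a)"
      unfolding pq by (simp add: algebra_simps power2_eq_square)
    also have "\<dots> \<in> B 3"
      by (intro is_ideal_add is_ideal_rel_pow is_ideal_mult[OF is_ideal_rel_pow y2] \<open>q \<in> I\<close> a_I)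
    finally show "\<exists>r. p * q - r * a^2 \<in> B 3" by blast
  qed
  then show ?thesis by simp
qed

text \<open>Were the Hilbert function \<open>(2,4,1,1)\<close>, then \<open>m\<^sup>3I = 0\<close> and so \<open>mI\<close>, of length at least \<open>4\<close>,
  would embed in the dual of the quotient by \<open>m\<^sup>2\<close>, of length at most \<open>3\<close>.\<close>

lemma not_2411:
  assumes "B 4 = J" "ell (B 3) = 1" "ell (B 2) = 2"
  shows "ell I \<noteq> 6"
proof
  assume I6: "ell I = 6"
  have mB2: "\<mu> * z \<in> B 3" if "\<mu> \<in> m" "z \<in> B 2" for \<mu> z
    using m_mult_B[of 2 \<mu> z] assms that by (simp add: numeral_eq_Suc del: rel_pow.simps)
  have mB3: "\<mu> * z \<in> J" if "\<mu> \<in> m" "z \<in> B 3" for \<mu> z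
    using m_mult_B[of 3 \<mu> z] assms that by (simp add: numeral_eq_Suc ell_J del: rel_pow.simps)
  have IB2: "p * q \<in> B 2" if "p \<in> I" "q \<in> I" for p q
    using I_mult_I[OF that] by (simp add: numeral_2_eq_2)
  have y: "y \<in> m"
  proof -
    have "y = 0 * a + 1 * y" by simp
    then show ?thesis unfolding m_gen by blast
  qed
  \<comment> \<open>The part of I^2 annihilated by I. It is a proper part because I^3 is not zero in
    A, so it has length at most 1 and \<open>m\<close> kills it.\<close>
  define W where "W = B 2 \<inter> colon J I"
  have idW: "is_ideal W" unfolding W_def
    by (intro ring_module.subspace_inter is_ideal_rel_pow is_ideal_colon is_ideal_J)
  have JW: "J \<subseteq> W" unfolding W_def using rel_pow_ge colon_ge[OF is_ideal_J] by blast
  have "W \<noteq> B 2"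
  proof
    assume "W = B 2"
    have "p * q \<in> J" if "p \<in> I" "q \<in> B 2" for p q
    proof -
      have "q \<in> colon J I" using \<open>W = B 2\<close> that(2) unfolding W_def by blast
      then show ?thesis using that(1) by (simp add: colon_def mult.commute)
    qed
    then have "B (Suc 2) \<subseteq> J" using B_Suc_least[OF is_ideal_J, of 2] by blast
    then have "B 3 = J" using rel_pow_ge[of J I 3] by (simp add: numeral_3_eq_3 numeral_2_eq_2 del: rel_pow.simps) 
    then show False using assms ell_J by simp
  qed
  then have "W \<subset> B 2" unfolding W_def by blast
  then have "ell W < 2" using ell_strict[OF idW _ JW, of "B 2"] assms by simp
  then have "len J W \<le> 1" by (simp add: len_J one_enat_def)
  then have mW: "\<mu> * w \<in> J" if "\<mu> \<in> m" "w \<in> W" for \<mu> w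
    using m_mult_mem_of_len_le_1[OF is_ideal_J idW JW] that by blast
  \<comment> \<open>y^2 I is annihilated by I because m^2 I^2 lies in m I^3, which is zero in
    A.\<close>
  have y2W: "y^2 * q \<in> W" if q: "q \<in> I" for q
    unfolding W_def colon_def
  proof safe
    show "y^2 * q \<in> B 2" using IB2[OF y2_I q] .
    fix p assume "p \<in> I"
    then have "y * (y * (q * p)) \<in> J" using mB3[OF y mB2[OF y IB2[OF q]]] by blast
    then show "y^2 * q * p \<in> J" by (simp add: power2_eq_square ac_simps)
  qed
  have "ell mI + ell (rel_prod J m m) \<le> ell UNIV"
  proof (rule ell_add_le_of_annihilates)
    fix t assume t: "t \<in> mI"
    show "t \<in> colon J (rel_prod J m m)"
    proof (rule mult_colon_rel_prod[OF is_ideal_J])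
      fix \<mu> \<nu> assume \<mu>: "\<mu> \<in> m" and \<nu>: "\<nu> \<in> m"
      have "t \<in> colon J {\<mu> * \<nu>}"
      proof (rule subsetD[OF rel_prod_least t])
        fix \<rho> q assume \<rho>: "\<rho> \<in> m" and q: "q \<in> I"
        obtain u v u' v' where uv: "\<mu> = u * a + v * y" "\<nu> = u' * a + v' * y"
          using \<mu> \<nu> unfolding m_gen by blast
        \<comment> \<open>Terms containing \<open>a\<close> vanish because \<open>a * q\<close> lies
          in I^2 and two further factors from \<open>m\<close> kill I^2; the remaining term lies in
          m W.\<close>
        have e: "\<rho> * q * (\<mu> * \<nu>)
            = u * (\<rho> * (\<nu> * (a * q))) + (v * u') * (\<rho> * (y * (a * q))) + (v * v') * (\<rho> * (y^2 * q))"
          unfolding uv by (simp add: algebra_simps power2_eq_square)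
        have "\<rho> * q * (\<mu> * \<nu>) \<in> J"
          unfolding e
          by (intro is_ideal_add is_ideal_J is_ideal_mult[OF is_ideal_J mB3] is_ideal_mult[OF is_ideal_J mW]
              mB2 IB2 y2W a_I \<rho> \<nu> y q)
        then show "\<rho> * q \<in> colon J {\<mu> * \<nu>}" by (simp add: colon_def)
      qed (simp_all add: is_ideal_colon is_ideal_J colon_ge)
      then show "\<mu> * \<nu> * t \<in> J" by (simp add: colon_def mult.commute)
    qed
  qed (simp_all add: rel_prod_ge)
  moreover have "ell m \<le> ell (rel_prod J m m) + 2"
  proof (rule ell_le_add)
    have "a \<in> m" using a_I I_le_m by blast
    have "len (rel_prod J m m) m \<le> 2"
    proof (rule len_m_rel_prod_le_2[OF is_ideal_J is_ideal_m J_le_m \<open>a \<in> m\<close> y])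
      fix q assume "q \<in> m"
      then obtain u v where "q = u * a + v * y" unfolding m_gen by blast
      then show "\<exists>s t. q - (s * a + t * y) \<in> J"
        using is_ideal_0[OF is_ideal_J] by (intro exI[of _ u] exI[of _ v]) simp
    qed
    then show "len (rel_prod J m m) m \<le> enat 2" by (simp add: numeral_eq_enat)
  qed (simp_all add: rel_prod_ge is_ideal_m J_le_m rel_prod_le)
  \<comment> \<open>Here l(A) = 8, l(mI) >= 6 - 2 and l(m^2) >= 7 - 2, so the sum 9 is too
    large.\<close>
  ultimately show False using ell_mI ell_I ell_m I6 by simp
qed

end


section \<open>Normal form of an ideal of colength two, and the resulting constraints on the Hilbert
  function\<close>

lemma len_filtration:
  assumes "\<And>i. is_ideal (C i)" "\<And>i. C (Suc i) \<subseteq> C i"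
  shows "len (C k) (C 0) = (\<Sum>i<k. len (C (Suc i)) (C i))"
proof (induction k)
  case 0
  then show ?case by (simp add: len_self)
next
  case (Suc k)
  have "C k \<subseteq> C 0" by (induction k) (use assms(2) in auto)
  from len_add[OF assms(1,1,1) assms(2) this]
  show ?case unfolding Suc.IH sum.lessThan_Suc by (simp only: add.commute)
qed

context two_generated_local_ring
begin

lemma len_m_UNIV: "len m UNIV = 1"
proof -
  have "m \<subset> UNIV" using one_notin_m by blast
  then have "1 \<le> len m UNIV" by (intro len_strict is_ideal_m) auto
  then show ?thesis using len_m_UNIV_le by (rule antisym[rotated])
qed

text \<open>m/I has length one and is generated by \<open>\<eta>\<close>; a suitable multiple of
  \<open>\<eta>\<close> subtracted from \<open>\<xi>\<close> gives a generator \<open>a\<close>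
  inside I. As \<open>m\<close> kills m/I, \<open>\<eta>^2\<close> is in I, and u a + v \<eta> can
  lie in I only if v is a nonunit.\<close>

lemma colength_two_generators_aux:
  assumes "is_ideal I" "len I UNIV = 2" "\<eta> \<notin> I"
  shows "\<exists>a y. I = {u * a + v * y^2 |u v. True} \<and> m = {u * a + v * y |u v. True}"
proof -
  have "I \<noteq> UNIV" using assms(2) len_self[of UNIV] by (metis zero_neq_numeral)
  then have Im: "I \<subseteq> m" by (rule proper_ideal_le_m[OF assms(1)])
  have "len I m + 1 = 2"
    using len_add[OF assms(1) is_ideal_m ring_module.subspace_UNIV Im] assms(2) len_m_UNIV by simp
  then have len1: "len I m \<le> 1" by (cases "len I m") (auto simp: one_enat_def numeral_eq_enat)
  note mm = m_mult_mem_of_len_le_1[OF assms(1) is_ideal_m Im len1]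
  have \<eta>: "\<eta> \<in> m"
  proof -
    have "\<eta> = 0 * \<xi> + 1 * \<eta>" by simp
    then show ?thesis unfolding m_gen by blast
  qed
  have \<xi>: "\<xi> \<in> m"
  proof -
    have "\<xi> = 1 * \<xi> + 0 * \<eta>" by simp
    then show ?thesis unfolding m_gen by blast
  qed
  obtain z where z: "z \<in> m" "\<And>q. q \<in> m \<Longrightarrow> \<exists>r. q - r * z \<in> I"
    using cyclic_of_len_le_1[OF assms(1) is_ideal_m Im len1] by blast
  obtain r r' where r: "\<eta> - r * z \<in> I" and r': "\<xi> - r' * z \<in> I" using z(2) \<eta> \<xi> by blast
  have "r \<notin> m"
  proof
    assume "r \<in> m"
    then have "r * z \<in> I" using mm z(1) by blast
    then show False using is_ideal_add[OF assms(1) r] assms(3) by force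
  qed
  then obtain s where s: "s * r = 1" by (rule unit_inverse)
  \<comment> \<open>Modulo I, \<open>\<xi>\<close> is r' z and \<open>\<eta>\<close> is r z with r a
    unit, so t = r'/r puts \<open>\<xi> - t * \<eta>\<close> into I.\<close>
  define t where "t = r' * s"
  define a where "a = \<xi> - t * \<eta>"
  have "a = (\<xi> - r' * z) + (r' * z - t * \<eta>)" by (simp add: a_def)
  also have "r' * z - t * \<eta> = - t * (\<eta> - r * z)"
  proof -
    have "t * r = r'" using s by (simp add: t_def mult.assoc)
    then have "t * (r * z) = r' * z" by (metis mult.assoc)
    then show ?thesis by (simp add: algebra_simps)
  qed
  finally have aI: "a \<in> I" using r' is_ideal_mult[OF assms(1) r, of "- t"] is_ideal_add[OF assms(1)] by metis
  have m: "m = {u * a + v * \<eta> |u v. True}"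
  proof -
    have "u * \<xi> + v * \<eta> = u * a + (v + u * t) * \<eta>" for u v by (simp add: a_def algebra_simps)
    moreover have "u * a + v * \<eta> = u * \<xi> + (v - u * t) * \<eta>" for u v by (simp add: a_def algebra_simps)
    ultimately show ?thesis unfolding m_gen by blast
  qed
  have "I = {u * a + v * \<eta>^2 |u v. True}"
  proof
    have "\<eta>^2 \<in> I" using mm[OF \<eta> \<eta>] by (simp add: power2_eq_square)
    then show "{u * a + v * \<eta>^2 |u v. True} \<subseteq> I"
      using aI assms(1) by (auto intro!: is_ideal_add is_ideal_mult)
    show "I \<subseteq> {u * a + v * \<eta>^2 |u v. True}"
    proof
      fix q assume q: "q \<in> I"
      then obtain u v where uv: "q = u * a + v * \<eta>" using Im m by blast
      then have v\<eta>: "v * \<eta> \<in> I" using is_ideal_diff[OF assms(1) q is_ideal_mult[OF assms(1) aI, of u]] by simp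
      have "v \<in> m"
      proof (rule ccontr)
        assume "v \<notin> m"
        then obtain w where "w * v = 1" by (rule unit_inverse)
        then have "w * (v * \<eta>) = \<eta>" by (simp add: mult.assoc[symmetric])
        then show False using is_ideal_mult[OF assms(1) v\<eta>, of w] assms(3) by simp
      qed
      then obtain u' v' where "v = u' * a + v' * \<eta>" using m by blast
      then have "q = (u + u' * \<eta>) * a + v' * \<eta>^2" using uv by (simp add: algebra_simps power2_eq_square)
      then show "q \<in> {u * a + v * \<eta>^2 |u v. True}" by blast
    qed
  qed
  then show ?thesis using m by blast
qed

text \<open>I is not \<open>m\<close>, so at least one generator of \<open>m\<close> lies outside I;
  the generators are swapped if it is \<open>\<xi>\<close>.\<close>

lemma colength_two_generators:
  assumes "is_ideal I" "len I UNIV = 2"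
  obtains a y where "I = {u * a + v * y^2 |u v. True}" "m = {u * a + v * y |u v. True}"
proof (cases "\<eta> \<in> I")
  case True
  have "I \<noteq> m"
  proof
    assume "I = m"
    then have "(2::enat) = 1" using assms(2) len_m_UNIV by simp
    then show False by (simp add: one_enat_def numeral_eq_enat)
  qed
  moreover have "I \<noteq> UNIV" using assms(2) len_self[of UNIV] by (metis zero_neq_numeral)
  then have "I \<subseteq> m" by (rule proper_ideal_le_m[OF assms(1)])
  ultimately have "\<xi> \<notin> I" using True assms(1) unfolding m_gen by (auto intro: is_ideal_add is_ideal_mult)
  interpret swapped: two_generated_local_ring m \<eta> \<xi>
  proof
    show "m = {r. \<not> r dvd 1}" by (rule m_nonunits)
    show "m = {u * \<eta> + v * \<xi> |u v. True}" unfolding m_gen by (metis add.commute)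
  qed
  show ?thesis using swapped.colength_two_generators_aux[OF assms \<open>\<xi> \<notin> I\<close>] that by blast
next
  case False
  then show ?thesis using colength_two_generators_aux[OF assms] that by blast
qed

text \<open>Supplies the finite generating sets that \<open>nakayama\<close> asks for; those of the
  next power are the products with \<open>a\<close> and with \<open>b\<close>.\<close>

lemma rel_pow_finitely_generated:
  assumes "is_ideal J" "I = {u * a + v * b |u v. True}"
  shows "\<exists>F. finite F \<and> rel_pow J I n = ideal_gen (F \<union> J)"
proof (induction n)
  case 0
  have "x \<in> ideal_gen ({1} \<union> J)" for x
    using ring_module.span_scale[OF ring_module.span_base[of 1 "{1} \<union> J"], of x] by simp
  then show ?case by (intro exI[of _ "{1}"]) auto
next
  case (Suc n)
  then obtain F where F: "finite F" "rel_pow J I n = ideal_gen (F \<union> J)" by blast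
  let ?F' = "(*) a ` F \<union> (*) b ` F"
  let ?K = "ideal_gen (?F' \<union> J)"
  have ab: "a = 1 * a + 0 * b" "b = 0 * a + 1 * b" by simp_all
  have "J \<subseteq> ?K" using ring_module.span_superset[of "?F' \<union> J"] by blast
  have mul: "c * q \<in> ?K" if c: "c = a \<or> c = b" and q: "q \<in> ideal_gen (F \<union> J)" for c q
  proof -
    have "ideal_gen (F \<union> J) \<subseteq> colon ?K {c}"
    proof (rule ring_module.span_minimal)
      have "f * c \<in> ?K" if "f \<in> F" for f
        using that c by (intro ring_module.span_base) (auto simp: mult.commute)
      moreover have "j * c \<in> ?K" if "j \<in> J" for j
        using \<open>J \<subseteq> ?K\<close> is_ideal_mult_right[OF assms(1) that] by blast
      ultimately show "F \<union> J \<subseteq> colon ?K {c}" by (auto simp: colon_def)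
    qed (simp add: is_ideal_colon)
    then show ?thesis using q by (auto simp: colon_def mult.commute)
  qed
  have "rel_pow J I (Suc n) = ?K"
  proof
    show "rel_pow J I (Suc n) \<subseteq> ?K"
      unfolding rel_pow.simps
    proof (rule rel_prod_least)
      fix p q assume "p \<in> I" and "q \<in> rel_pow J I n"
      then obtain u v where p: "p = u * a + v * b" and q: "q \<in> ideal_gen (F \<union> J)"
        using assms(2) F(2) by blast
      have "p * q = u * (a * q) + v * (b * q)" unfolding p by (simp add: algebra_simps)
      also have "\<dots> \<in> ?K" by (intro ring_module.span_add ring_module.span_scale mul q) auto
      finally show "p * q \<in> ?K" .
    qed (use \<open>J \<subseteq> ?K\<close> in auto)
    have "a \<in> I" "b \<in> I" unfolding assms(2) using ab by blast+
    moreover have "F \<subseteq> rel_pow J I n" unfolding F(2) using ring_module.span_superset[of "F \<union> J"] by blast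
    ultimately have "?F' \<subseteq> rel_pow J I (Suc n)" by (auto intro: rel_prod_mem)
    then show "?K \<subseteq> rel_pow J I (Suc n)"
      using rel_pow_ge[of J I "Suc n"] by (intro ring_module.span_minimal is_ideal_rel_pow) simp
  qed
  then show ?case using F(1) by (intro exI[of _ ?F']) auto
qed

text \<open>I^n = I I^n lies in m I^n, so Nakayama makes I^n vanish modulo \<open>J\<close>: a
  single zero of the Hilbert function bounds the filtration.\<close>

lemma rel_pow_stable_imp_eq:
  assumes "is_ideal J" "I = {u * a + v * b |u v. True}" "I \<subseteq> m"
    and "rel_pow J I (Suc n) = rel_pow J I n"
  shows "rel_pow J I n = J"
proof -
  obtain F where F: "finite F" "rel_pow J I n = ideal_gen (F \<union> J)"
    using rel_pow_finitely_generated[OF assms(1,2)] by blast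
  show ?thesis
  proof (rule nakayama[OF F(1) assms(1) F(2)])
    show "rel_pow J I n \<subseteq> rel_prod J m (rel_pow J I n)"
      using rel_prod_mono[OF assms(3) order_refl, of J "rel_pow J I n"] assms(4) by simp
  qed
qed

text \<open>Finite length comes out of \<open>h\<close> itself: \<open>h\<close> vanishes beyond
  \<open>u\<close>, hence I^(u+1) is zero in A, and l(A) is the sum of the values of
  \<open>h\<close>.\<close>

theorem hilbert_function_constraints:
  assumes J: "is_ideal J" and socle: "len J (colon J m) \<le> 1"
    and I: "is_ideal I" "J \<subseteq> I"
    and h: "\<And>n. len (rel_pow J I (Suc n)) (rel_pow J I n) = enat (h n)"
    and h0: "h 0 = 2" and hu: "h u \<noteq> 0" and h_zero: "\<And>n. n > u \<Longrightarrow> h n = 0"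
    and u: "1 \<le> u"
  shows "h u \<le> 2" "h 1 \<le> 4"
    and "i \<le> u \<Longrightarrow> h i \<noteq> 0"
    and "i \<le> u \<Longrightarrow> h i = 1 \<Longrightarrow> h u = 1"
    and "u = 2 \<Longrightarrow> h 2 = 1 \<Longrightarrow> h 1 \<le> 3"
    and "u = 3 \<Longrightarrow> h 2 + h 3 \<le> 2 + h 1"
    and "u = 3 \<Longrightarrow> h 3 = 1 \<Longrightarrow> h 2 \<le> 3"
    and "h 1 \<le> 1 \<Longrightarrow> h 2 \<le> 1"
    and "h 1 \<le> 2 \<Longrightarrow> h 2 \<le> 2"
    and "u = 3 \<Longrightarrow> h 3 = 1 \<Longrightarrow> h 2 = 1 \<Longrightarrow> h 1 \<noteq> 4"
proof -
  have len_I: "len I UNIV = 2"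
    using h[of 0] rel_pow_1[OF I] h0 by (simp add: numeral_eq_enat)
  obtain a y where ay: "I = {u * a + v * y^2 |u v. True}" "m = {u * a + v * y |u v. True}"
    using colength_two_generators[OF I(1) len_I] by blast
  have "I \<noteq> UNIV" using len_I len_self[of UNIV] by (metis zero_neq_numeral)
  then have Im: "I \<subseteq> m" by (rule proper_ideal_le_m[OF I(1)])
  have eq: "rel_pow J I (Suc n) = rel_pow J I n" if "h n = 0" for n
  proof (rule ccontr)
    assume "\<not> ?thesis"
    then have "rel_pow J I (Suc n) \<subset> rel_pow J I n" using rel_pow_Suc_le by blast
    then have "1 \<le> len (rel_pow J I (Suc n)) (rel_pow J I n)" by (intro len_strict is_ideal_rel_pow)
    then show False using that h[of n] by (simp add: one_enat_def)
  qed
  have Bu: "rel_pow J I (Suc u) = J"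
    using rel_pow_stable_imp_eq[OF J ay(1) Im eq[OF h_zero]] by blast
  have "len J UNIV = (\<Sum>i<Suc u. enat (h i))"
    using len_filtration[of "rel_pow J I" "Suc u", OF is_ideal_rel_pow rel_pow_Suc_le]
    by (simp only: h Bu rel_pow.simps(1))
  also have "\<dots> = enat (\<Sum>i<Suc u. h i)"
    by (induction u) (simp_all add: zero_enat_def)
  finally have fin: "len J UNIV \<noteq> \<infinity>" by simp
  interpret Q: colength_two_quotient m a y J I
    by unfold_locales (use m_nonunits ay J socle I len_I fin in auto)
  \<comment> \<open>\<open>e i\<close> is the tail sum of \<open>h\<close> from \<open>i\<close> on;
    the length bounds are read off in these terms.\<close>
  define e where "e i = Q.ell (rel_pow J I i)" for i
  have mono: "e (Suc i) \<le> e i" for i unfolding e_def by (rule Q.ell_B_mono)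
  have hd: "h i = e i - e (Suc i)" for i
    using Q.len_B[of i] h[of i] unfolding e_def by (simp del: rel_pow.simps)
  have eu: "e (Suc u) = 0" unfolding e_def Bu by (rule Q.ell_J)
  have e1: "Q.ell I = e 1" unfolding e_def using Q.B1 by (simp del: rel_pow.simps)
  have e0: "Q.ell UNIV = e 0" unfolding e_def by simp
  have hu': "h u = e u" using hd[of u] eu by simp
  show "h u \<le> 2" using Q.ell_last_le_2[OF Bu] unfolding hu' e_def .
  show "h 1 \<le> 4" using Q.ell_B1_le hd[of 1] e1 unfolding e_def[of 2, symmetric] by (simp add: numeral_2_eq_2)
  show "h i \<noteq> 0" if "i \<le> u" for i
  proof
    assume "h i = 0"
    have "h u = 0" using that
    proof (induction rule: dec_induct)
      case base
      show ?case by (rule \<open>h i = 0\<close>)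
    next
      case (step n)
      then have "e n = e (Suc n)" using hd[of n] mono[of n] by simp
      then have "e (Suc n) = e (Suc (Suc n))" unfolding e_def by (rule Q.ell_B_stable)
      then show ?case using hd by simp
    qed
    then show False using hu by simp
  qed
  show "h u = 1" if "i \<le> u" "h i = 1" for i
  proof -
    have "e i \<le> e (Suc i) + 1" using that(2) hd[of i] mono[of i] by simp
    then have "h u \<le> 1" unfolding hu' e_def using Q.ell_last_le_1[OF Bu that(1)] by blast
    then show ?thesis using hu by simp
  qed
  have s: "Suc 1 = 2" "Suc 2 = 3" "Suc 3 = 4" by simp_all
  have hd1: "h 1 = e 1 - e 2" and hd2: "h 2 = e 2 - e 3" and hd3: "h 3 = e 3 - e 4"
    and mono1: "e 2 \<le> e 1" and mono2: "e 3 \<le> e 2"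
    using hd[of 1] hd[of 2] hd[of 3] mono[of 1] mono[of 2] by (simp_all add: numeral_eq_Suc)
  show "h 1 \<le> 3" if "u = 2" "h 2 = 1"
    using Q.ell_I_le_4 Bu that hd1 hd2 eu e1 unfolding e_def[of 2, symmetric] s by (simp add: s del: rel_pow.simps)
  have e0': "e 0 = e 1 + 2" using hd[of 0] h0 mono[of 0] by simp
  show "h 2 + h 3 \<le> 2 + h 1" if "u = 3"
    using Q.two_ell_B2_le Bu that hd1 hd2 hd3 mono1 mono2 eu e0 e0'
    unfolding e_def[of 2, symmetric] by (simp add: s del: rel_pow.simps)
  show "h 2 \<le> 3" if "u = 3" "h 3 = 1"
    using Q.ell_I_add_ell_B2_le Bu that hd1 hd2 hd3 mono1 mono2 eu e0 e0' e1
    unfolding e_def[of 2, symmetric] e_def[of 3, symmetric] by (simp add: s del: rel_pow.simps)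
  show "h 2 \<le> 1" if "h 1 \<le> 1"
  proof -
    have "Q.ell I \<le> e 2 + 1" using that hd1 e1 by linarith
    then have "e 2 \<le> e 3 + 1" unfolding e_def by (rule Q.h2_le_1_if_h1_le_1)
    then show ?thesis using hd2 by linarith
  qed
  show "h 2 \<le> 2" if "h 1 \<le> 2"
  proof -
    have "Q.ell I \<le> e 2 + 2" using that hd1 e1 by linarith
    then have "e 2 \<le> e 3 + 2" unfolding e_def by (rule Q.h2_le_2_if_h1_le_2)
    then show ?thesis using hd2 by linarith
  qed
  show "h 1 \<noteq> 4" if "u = 3" "h 3 = 1" "h 2 = 1"
  proof -
    have B4: "rel_pow J I 4 = J" using Bu \<open>u = 3\<close> by (simp add: s del: rel_pow.simps)
    have e3: "e 3 = 1" "e 2 = 2" using that hd2 hd3 eu mono2 by (simp_all add: s)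
    from Q.not_2411[OF B4 e3[unfolded e_def]] show ?thesis using hd1 e1 e3 mono1 by linarith
  qed
qed

end


section \<open>Quotient rings of a type-class ring\<close>

lemma ring_of_type_algebra_simps [simp]:
  "carrier (ring_of_type_algebra :: 'a::comm_ring_1 ring) = UNIV"
  "x \<otimes>\<^bsub>ring_of_type_algebra\<^esub> y = x * (y :: 'a)"
  "x \<oplus>\<^bsub>ring_of_type_algebra\<^esub> y = x + (y :: 'a)"
  "\<zero>\<^bsub>ring_of_type_algebra\<^esub> = (0 :: 'a)"
  "\<one>\<^bsub>ring_of_type_algebra\<^esub> = (1 :: 'a)"
  by (simp_all add: ring_of_type_algebra_def)

lemma ideal_ring_of_type_algebra_iff:
  "ideal P (ring_of_type_algebra :: 'a::comm_ring_1 ring) \<longleftrightarrow> is_ideal P"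
proof
  assume P: "ideal P (ring_of_type_algebra :: 'a ring)"
  show "is_ideal P"
  proof (rule ring_module.subspaceI)
    show "0 \<in> P" using additive_subgroup.zero_closed[OF ideal.axioms(1)[OF P]] by simp
    show "x + y \<in> P" if "x \<in> P" "y \<in> P" for x y
      using additive_subgroup.a_closed[OF ideal.axioms(1)[OF P] that] by simp
    show "c * x \<in> P" if "x \<in> P" for c x
      using ideal.I_l_closed[OF P that, of c] by simp
  qed
next
  assume P: "is_ideal P"
  interpret R: cring "ring_of_type_algebra :: 'a ring" by (rule cring_from_type_algebra)
  show "ideal P (ring_of_type_algebra :: 'a ring)"
  proof (rule idealI)
    show "ring (ring_of_type_algebra :: 'a ring)" by (rule R.ring_axioms)
    show "subgroup P (add_monoid (ring_of_type_algebra :: 'a ring))"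
    proof (rule R.add.subgroupI)
      show "P \<noteq> {}" using is_ideal_0[OF P] by auto
      show "\<ominus>\<^bsub>ring_of_type_algebra\<^esub> a \<in> P" if "a \<in> P" for a
      proof -
        have "\<ominus>\<^bsub>ring_of_type_algebra\<^esub> a = - a"
          by (rule R.minus_equality) simp_all
        then show ?thesis using ring_module.subspace_neg[OF P that] by simp
      qed
    qed (use is_ideal_add[OF P] in auto)
  qed (use is_ideal_mult[OF P] is_ideal_mult_right[OF P] in auto)
qed

text \<open>\<open>\<pi>\<close> presents \<open>M\<close> as Q/P, so submodules correspond to
  ideals between \<open>P\<close> and \<open>Q\<close>. The hypotheses on scalars ask only that
  \<open>A\<close> and the ring induce the same operators on \<open>M\<close>; thus one lemma serves
  the graded pieces over A/I as well as the socle over A.\<close>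

lemma module_length_eq_len:
  fixes A :: "('r, 'm) ring_scheme" and M :: "('r, 'b, 'n) module_scheme"
    and \<pi> :: "'a::comm_ring_1 \<Rightarrow> 'b"
  assumes P: "is_ideal P" and Q: "is_ideal Q" and PQ: "P \<subseteq> Q"
    and carr: "carrier M = \<pi> ` Q"
    and add: "\<And>a b. a \<in> Q \<Longrightarrow> b \<in> Q \<Longrightarrow> \<pi> a \<oplus>\<^bsub>M\<^esub> \<pi> b = \<pi> (a + b)"
    and zero: "\<zero>\<^bsub>M\<^esub> = \<pi> 0"
    and ker: "\<And>a b. a \<in> Q \<Longrightarrow> b \<in> Q \<Longrightarrow> \<pi> a = \<pi> b \<longleftrightarrow> a - b \<in> P"
    and smult: "\<And>r. r \<in> carrier A \<Longrightarrow> \<exists>s. \<forall>q\<in>Q. r \<odot>\<^bsub>M\<^esub> \<pi> q = \<pi> (s * q)"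
    and smult': "\<And>s. \<exists>r\<in>carrier A. \<forall>q\<in>Q. r \<odot>\<^bsub>M\<^esub> \<pi> q = \<pi> (s * q)"
  shows "module_length A M = len P Q"
proof -
  \<comment> \<open>\<open>M\<close> is merely a record here, so the additive inverse is computed
    from its definition, uniqueness included.\<close>
  have inv: "inv\<^bsub>add_monoid M\<^esub> (\<pi> q) = \<pi> (- q)" if q: "q \<in> Q" for q
    unfolding m_inv_def
  proof (rule the_equality)
    have q': "- q \<in> Q" using ring_module.subspace_neg[OF Q q] .
    show "\<pi> (- q) \<in> carrier (add_monoid M) \<and> \<pi> q \<otimes>\<^bsub>add_monoid M\<^esub> \<pi> (- q) = \<one>\<^bsub>add_monoid M\<^esub> \<and>
      \<pi> (- q) \<otimes>\<^bsub>add_monoid M\<^esub> \<pi> q = \<one>\<^bsub>add_monoid M\<^esub>"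
      using carr add[OF q q'] add[OF q' q] q' zero by auto
    fix z assume z: "z \<in> carrier (add_monoid M) \<and> \<pi> q \<otimes>\<^bsub>add_monoid M\<^esub> z = \<one>\<^bsub>add_monoid M\<^esub> \<and>
      z \<otimes>\<^bsub>add_monoid M\<^esub> \<pi> q = \<one>\<^bsub>add_monoid M\<^esub>"
    then obtain s where s: "s \<in> Q" "z = \<pi> s" using carr by auto
    then have "\<pi> (q + s) = \<pi> 0" using z add[OF q s(1)] zero by simp
    then have "q + s \<in> P" using ker[OF is_ideal_add[OF Q q s(1)] is_ideal_0[OF Q]] by simp
    then show "z = \<pi> (- q)" unfolding s(2) using ker[OF s(1) q'] by (simp add: add.commute)
  qed
  have sub_imp: "is_ideal {q \<in> Q. \<pi> q \<in> S} \<and> P \<subseteq> {q \<in> Q. \<pi> q \<in> S}"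
    if S: "submodule S A M" for S
  proof
    interpret S: submodule S A M by (rule S)
    show id: "is_ideal {q \<in> Q. \<pi> q \<in> S}"
    proof (rule ring_module.subspaceI)
      show "0 \<in> {q \<in> Q. \<pi> q \<in> S}" using S.one_closed zero is_ideal_0[OF Q] by simp
      show "x + y \<in> {q \<in> Q. \<pi> q \<in> S}" if "x \<in> {q \<in> Q. \<pi> q \<in> S}" "y \<in> {q \<in> Q. \<pi> q \<in> S}" for x y
        using that S.m_closed[of "\<pi> x" "\<pi> y"] add[of x y] is_ideal_add[OF Q] by simp
      show "c * x \<in> {q \<in> Q. \<pi> q \<in> S}" if x: "x \<in> {q \<in> Q. \<pi> q \<in> S}" for c x
      proof -
        obtain r where "r \<in> carrier A" "\<forall>q\<in>Q. r \<odot>\<^bsub>M\<^esub> \<pi> q = \<pi> (c * q)" using smult' by blast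
        then show ?thesis using x S.smult_closed[of r "\<pi> x"] is_ideal_mult[OF Q] by simp
      qed
    qed
    show "P \<subseteq> {q \<in> Q. \<pi> q \<in> S}"
    proof
      fix p assume p: "p \<in> P"
      then have "\<pi> p = \<pi> 0" using ker[of p 0] PQ is_ideal_0[OF Q] by auto
      then show "p \<in> {q \<in> Q. \<pi> q \<in> S}" using p PQ S.one_closed zero by auto
    qed
  qed
  have imp_sub: "submodule (\<pi> ` N) A M" if N: "is_ideal N" "N \<subseteq> Q" for N
  proof (intro submodule.intro subgroup.intro submodule_axioms.intro)
    show "\<pi> ` N \<subseteq> carrier (add_monoid M)" using N carr by auto
    show "x \<otimes>\<^bsub>add_monoid M\<^esub> y \<in> \<pi> ` N" if xy: "x \<in> \<pi> ` N" "y \<in> \<pi> ` N" for x y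
    proof -
      obtain a b where "x = \<pi> a" "y = \<pi> b" "a \<in> N" "b \<in> N" using xy by blast
      then show ?thesis using add[of a b] N is_ideal_add[OF N(1), of a b] by auto
    qed
    show "\<one>\<^bsub>add_monoid M\<^esub> \<in> \<pi> ` N" using zero is_ideal_0[OF N(1)] by auto
    show "inv\<^bsub>add_monoid M\<^esub> x \<in> \<pi> ` N" if "x \<in> \<pi> ` N" for x
      using that inv N ring_module.subspace_neg[OF N(1)] by auto
    show "r \<odot>\<^bsub>M\<^esub> x \<in> \<pi> ` N" if r: "r \<in> carrier A" and x: "x \<in> \<pi> ` N" for r x
    proof -
      obtain s where "\<forall>q\<in>Q. r \<odot>\<^bsub>M\<^esub> \<pi> q = \<pi> (s * q)" using smult[OF r] by blast
      then show ?thesis using x N is_ideal_mult[OF N(1), of _ s] by auto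
    qed
  qed

  have fwd: "\<exists>N. ideal_chain P Q n N"
    if S: "\<forall>i\<le>n. submodule (S i) A M" "\<forall>i<n. S i \<subset> S (Suc i)" for n and S :: "nat \<Rightarrow> 'b set"
  proof (intro exI[of _ "\<lambda>i. {q \<in> Q. \<pi> q \<in> S i}"], unfold ideal_chain_def, intro conjI allI impI)
    fix i assume "i \<le> n"
    then have "submodule (S i) A M" using S(1) by blast
    from sub_imp[OF this]
    show "is_ideal {q \<in> Q. \<pi> q \<in> S i}" "P \<subseteq> {q \<in> Q. \<pi> q \<in> S i}" by blast+
    show "{q \<in> Q. \<pi> q \<in> S i} \<subseteq> Q" by blast
  next
    fix i assume i: "i < n"
    have "submodule (S (Suc i)) A M" using S(1) i by simp
    then have "S (Suc i) \<subseteq> carrier M" using submodule.axioms(1) subgroup.subset by fastforce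
    moreover have "S i \<subset> S (Suc i)" using S(2) i by blast
    moreover from \<open>S i \<subset> S (Suc i)\<close> obtain s where "s \<in> S (Suc i)" "s \<notin> S i" by blast
    ultimately obtain q where q: "q \<in> Q" "\<pi> q \<in> S (Suc i)" "\<pi> q \<notin> S i"
      unfolding carr by (metis imageE subsetD)
    then have "q \<in> {q \<in> Q. \<pi> q \<in> S (Suc i)} - {q \<in> Q. \<pi> q \<in> S i}" by blast
    moreover have "{q \<in> Q. \<pi> q \<in> S i} \<subseteq> {q \<in> Q. \<pi> q \<in> S (Suc i)}" using \<open>S i \<subset> S (Suc i)\<close> by blast
    ultimately show "{q \<in> Q. \<pi> q \<in> S i} \<subset> {q \<in> Q. \<pi> q \<in> S (Suc i)}" by blast
  qed
  have bwd: "\<exists>S. (\<forall>i\<le>n. submodule (S i) A M) \<and> (\<forall>i<n. S i \<subset> S (Suc i))"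
    if N: "ideal_chain P Q n N" for n N
  proof (intro exI[of _ "\<lambda>i. \<pi> ` N i"] conjI allI impI)
    show "submodule (\<pi> ` N i) A M" if "i \<le> n" for i
      using N that unfolding ideal_chain_def by (intro imp_sub) auto
    fix i assume i: "i < n"
    then have st: "N i \<subset> N (Suc i)" "P \<subseteq> N i" "N (Suc i) \<subseteq> Q" "is_ideal (N i)"
      using N unfolding ideal_chain_def by auto
    then obtain x where x: "x \<in> N (Suc i)" "x \<notin> N i" by blast
    have "\<pi> x \<notin> \<pi> ` N i"
    proof
      assume "\<pi> x \<in> \<pi> ` N i"
      then obtain w where w: "w \<in> N i" "\<pi> x = \<pi> w" by blast
      then have "x - w \<in> N i" using ker[of x w] x st by blast
      then show False using is_ideal_add[OF st(4) _ w(1)] x by force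
    qed
    then show "\<pi> ` N i \<subset> \<pi> ` N (Suc i)" using x st(1) by blast
  qed
  have "{enat n |n. \<exists>N. ideal_chain P Q n N} =
    {enat n |n. \<exists>N :: nat \<Rightarrow> 'b set. (\<forall>i\<le>n. submodule (N i) A M) \<and> (\<forall>i<n. N i \<subset> N (Suc i))}"
    using fwd bwd by (intro Collect_cong) metis
  then show ?thesis unfolding module_length_def len_def by simp
qed


section \<open>Dictionary between the quotient ring by \<open>J\<close> and the ideals containing
  \<open>J\<close>\<close>

locale quotient_by =
  fixes J :: "'a::comm_ring_1 set"
  assumes is_ideal_J: "is_ideal J"
begin

abbreviation \<A> :: "'a set ring" where "\<A> \<equiv> ring_of_type_algebra Quot J"

abbreviation qm :: "'a \<Rightarrow> 'a set" where "qm r \<equiv> J +>\<^bsub>ring_of_type_algebra\<^esub> r"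

sublocale R: cring "ring_of_type_algebra :: 'a ring"
  by (rule cring_from_type_algebra)

sublocale J: ideal J "ring_of_type_algebra :: 'a ring"
  using is_ideal_J ideal_ring_of_type_algebra_iff by blast

sublocale A: cring \<A>
  by (rule J.quotient_is_cring[OF cring_from_type_algebra])

lemma qm_def: "qm r = {j + r |j. j \<in> J}"
  by (auto simp: a_r_coset_def r_coset_def)

lemma qm_eq_iff: "qm r = qm s \<longleftrightarrow> r - s \<in> J"
proof
  assume "qm r = qm s"
  moreover have "r \<in> qm r" unfolding qm_def using is_ideal_0[OF is_ideal_J] by force
  ultimately obtain j where "r = j + s" "j \<in> J" unfolding qm_def by blast
  then show "r - s \<in> J" by simp
next
  have *: "qm r \<subseteq> qm s" if "r - s \<in> J" for r s
  proof
    fix x assume "x \<in> qm r"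
    then obtain j where "j \<in> J" "x = j + r" unfolding qm_def by blast
    then have "x = (j + (r - s)) + s" "j + (r - s) \<in> J" using is_ideal_add[OF is_ideal_J _ that] by auto
    then show "x \<in> qm s" unfolding qm_def by blast
  qed
  assume rs: "r - s \<in> J"
  then have "s - r \<in> J" using ring_module.subspace_neg[OF is_ideal_J rs] by simp
  then show "qm r = qm s" using * rs by blast
qed

lemma carrier_A: "carrier \<A> = range qm"
  unfolding FactRing_simps by (auto simp: A_RCOSETS_def')

lemma qm_hom: "qm \<in> ring_hom ring_of_type_algebra \<A>"
  by (rule J.rcos_ring_hom)

lemma qm_mult: "qm r \<otimes>\<^bsub>\<A>\<^esub> qm s = qm (r * s)"
  using ring_hom_mult[OF qm_hom, of r s] by simp

lemma qm_add: "qm r \<oplus>\<^bsub>\<A>\<^esub> qm s = qm (r + s)"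
  using ring_hom_add[OF qm_hom, of r s] by simp

lemma qm_one: "\<one>\<^bsub>\<A>\<^esub> = qm 1"
  using ring_hom_one[OF qm_hom] by simp

lemma qm_zero: "\<zero>\<^bsub>\<A>\<^esub> = qm 0"
  using ring_hom_zero[OF qm_hom R.ring_axioms A.ring_axioms] by simp

definition pre :: "'a set set \<Rightarrow> 'a set" where "pre K = {r. qm r \<in> K}"

lemma ideal_pre:
  assumes "ideal K \<A>"
  shows "is_ideal (pre K)" "J \<subseteq> pre K" "qm ` pre K = K"
proof -
  interpret K: ideal K \<A> by (rule assms)
  show id: "is_ideal (pre K)"
  proof (rule ring_module.subspaceI)
    show "0 \<in> pre K" using K.zero_closed qm_zero by (simp add: pre_def)
    show "x + y \<in> pre K" if "x \<in> pre K" "y \<in> pre K" for x y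
      using that K.a_closed[of "qm x" "qm y"] qm_add by (simp add: pre_def)
    show "c * x \<in> pre K" if "x \<in> pre K" for c x
      using that K.I_l_closed[of "qm x" "qm c"] qm_mult carrier_A by (simp add: pre_def)
  qed
  show "J \<subseteq> pre K"
  proof
    fix j assume "j \<in> J"
    then have "qm j = qm 0" using qm_eq_iff by simp
    then show "j \<in> pre K" using K.zero_closed qm_zero by (simp add: pre_def)
  qed
  show "qm ` pre K = K" using K.a_subset unfolding carrier_A pre_def by auto
qed

lemma ideal_qm_image:
  assumes "is_ideal P"
  shows "ideal (qm ` P) \<A>"
proof (rule idealI[OF A.ring_axioms])
  show "subgroup (qm ` P) (add_monoid \<A>)"
  proof (rule A.add.subgroupI)
    show "qm ` P \<noteq> {}" using is_ideal_0[OF assms] by auto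
    show "qm ` P \<subseteq> carrier \<A>" using carrier_A by auto
    show "\<ominus>\<^bsub>\<A>\<^esub> a \<in> qm ` P" if a: "a \<in> qm ` P" for a
    proof -
      obtain p where p: "a = qm p" "p \<in> P" using a by blast
      have "\<ominus>\<^bsub>\<A>\<^esub> a = qm (- p)"
        unfolding p(1)
        by (rule A.minus_equality) (simp_all add: qm_add qm_zero carrier_A)
      then show ?thesis using ring_module.subspace_neg[OF assms p(2)] by blast
    qed
    show "a \<oplus>\<^bsub>\<A>\<^esub> b \<in> qm ` P" if "a \<in> qm ` P" "b \<in> qm ` P" for a b
      using that is_ideal_add[OF assms] by (auto simp: qm_add)
  qed
  show "x \<otimes>\<^bsub>\<A>\<^esub> a \<in> qm ` P" if "a \<in> qm ` P" "x \<in> carrier \<A>" for a x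
    using that is_ideal_mult[OF assms] by (auto simp: qm_mult carrier_A)
  show "a \<otimes>\<^bsub>\<A>\<^esub> x \<in> qm ` P" if "a \<in> qm ` P" "x \<in> carrier \<A>" for a x
    using that is_ideal_mult_right[OF assms] by (auto simp: qm_mult carrier_A)
qed

lemma qm_mem_image_iff:
  assumes "is_ideal P" "J \<subseteq> P"
  shows "qm r \<in> qm ` P \<longleftrightarrow> r \<in> P"
proof
  assume "qm r \<in> qm ` P"
  then obtain p where "p \<in> P" "r - p \<in> J" using qm_eq_iff by auto
  then show "r \<in> P" using is_ideal_add[OF assms(1), of "r - p" p] assms(2) by auto
qed auto

lemma pre_qm_image: "is_ideal P \<Longrightarrow> J \<subseteq> P \<Longrightarrow> pre (qm ` P) = P"
  by (simp add: pre_def qm_mem_image_iff)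

lemma ideal_prod_eq:
  assumes "ideal K \<A>" "is_ideal P" "J \<subseteq> P"
  shows "ideal_prod \<A> K (qm ` P) = qm ` rel_prod J (pre K) P"
proof
  note K = ideal_pre[OF assms(1)]
  show "ideal_prod \<A> K (qm ` P) \<subseteq> qm ` rel_prod J (pre K) P"
  proof
    fix s assume "s \<in> ideal_prod \<A> K (qm ` P)"
    then show "s \<in> qm ` rel_prod J (pre K) P"
    proof (induction rule: ideal_prod.induct)
      case (prod i j)
      then obtain a b where "i = qm a" "a \<in> pre K" "j = qm b" "b \<in> P" using K(3) by blast
      then show ?case using qm_mult rel_prod_mem[of a "pre K" b P J] by auto
    next
      case (sum s1 s2)
      then obtain a b where ab: "s1 = qm a" "s2 = qm b" "a \<in> rel_prod J (pre K) P" "b \<in> rel_prod J (pre K) P"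
        by blast
      show ?case
        unfolding ab(1,2) qm_add by (rule imageI, rule is_ideal_add[OF is_ideal_rel_prod ab(3,4)])
    qed
  qed
  have id: "ideal (ideal_prod \<A> K (qm ` P)) \<A>"
    by (rule A.ideal_prod_is_ideal[OF assms(1) ideal_qm_image[OF assms(2)]])
  have "rel_prod J (pre K) P \<subseteq> pre (ideal_prod \<A> K (qm ` P))"
  proof (rule rel_prod_least[OF ideal_pre(1,2)[OF id]])
    fix p q assume "p \<in> pre K" "q \<in> P"
    then have "qm p \<otimes>\<^bsub>\<A>\<^esub> qm q \<in> ideal_prod \<A> K (qm ` P)"
      by (intro ideal_prod.prod) (auto simp: pre_def)
    then show "p * q \<in> pre (ideal_prod \<A> K (qm ` P))" by (simp add: pre_def qm_mult)
  qed
  then show "qm ` rel_prod J (pre K) P \<subseteq> ideal_prod \<A> K (qm ` P)" by (auto simp: pre_def)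
qed

lemma ideal_pow_eq:
  assumes "ideal K \<A>"
  shows "ideal_pow \<A> K n = qm ` rel_pow J (pre K) n"
  by (induction n) (simp_all add: carrier_A ideal_prod_eq[OF assms] rel_pow_ge)

lemma coset_image_eq:
  assumes "is_ideal P" "J \<subseteq> P"
  shows "(qm ` P) +>\<^bsub>\<A>\<^esub> qm r = qm ` {p + r |p. p \<in> P}"
proof -
  have "(qm ` P) +>\<^bsub>\<A>\<^esub> qm r = (\<Union>h\<in>qm ` P. {h \<oplus>\<^bsub>\<A>\<^esub> qm r})"
    unfolding a_r_coset_def[of \<A>] r_coset_def by simp
  also have "\<dots> = qm ` {p + r |p. p \<in> P}" using qm_add by auto
  finally show ?thesis .
qed

text \<open>The third isomorphism theorem for cosets: classes of R/J modulo P/J are classes of R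
  modulo P.\<close>

lemma coset_image_eq_iff:
  assumes "is_ideal P" "J \<subseteq> P"
  shows "(qm ` P) +>\<^bsub>\<A>\<^esub> qm r = (qm ` P) +>\<^bsub>\<A>\<^esub> qm s \<longleftrightarrow> r - s \<in> P"
proof
  assume "(qm ` P) +>\<^bsub>\<A>\<^esub> qm r = (qm ` P) +>\<^bsub>\<A>\<^esub> qm s"
  then have eq: "qm ` {p + r |p. p \<in> P} = qm ` {p + s |p. p \<in> P}" by (simp add: coset_image_eq[OF assms])
  have "r \<in> {p + r |p. p \<in> P}" using is_ideal_0[OF assms(1)] by force
  then have "qm r \<in> qm ` {p + s |p. p \<in> P}" unfolding eq[symmetric] by blast
  then obtain p where p: "p \<in> P" "qm r = qm (p + s)" by blast
  then have "r - (p + s) \<in> P" using qm_eq_iff assms(2) by blast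
  then have "p + (r - (p + s)) \<in> P" by (rule is_ideal_add[OF assms(1) p(1)])
  then show "r - s \<in> P" by (simp add: algebra_simps)
next
  assume rs: "r - s \<in> P"
  have "{p + r |p. p \<in> P} = {p + s |p. p \<in> P}"
  proof (intro equalityI subsetI)
    fix x assume "x \<in> {p + r |p. p \<in> P}"
    then obtain p where "p \<in> P" "x = p + r" by blast
    then have "x = (p + (r - s)) + s" "p + (r - s) \<in> P" using is_ideal_add[OF assms(1) _ rs] by auto
    then show "x \<in> {p + s |p. p \<in> P}" by blast
  next
    fix x assume "x \<in> {p + s |p. p \<in> P}"
    then obtain p where "p \<in> P" "x = p + s" by blast
    then have "x = (p - (r - s)) + r" "p - (r - s) \<in> P" using is_ideal_diff[OF assms(1) _ rs] by auto
    then show "x \<in> {p + r |p. p \<in> P}" by blast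
  qed
  then show "(qm ` P) +>\<^bsub>\<A>\<^esub> qm r = (qm ` P) +>\<^bsub>\<A>\<^esub> qm s" by (simp add: coset_image_eq[OF assms])
qed

lemma carrier_A_Quot: "carrier (\<A> Quot K) = range (\<lambda>r. K +>\<^bsub>\<A>\<^esub> qm r)"
proof -
  have "carrier (\<A> Quot K) = a_rcosets\<^bsub>\<A>\<^esub> K" unfolding FactRing_def[of \<A> K] by simp
  also have "\<dots> = (\<lambda>x. K +>\<^bsub>\<A>\<^esub> x) ` carrier \<A>"
    unfolding A_RCOSETS_def RCOSETS_def a_r_coset_def[of \<A>] by auto
  finally show ?thesis unfolding carrier_A by auto
qed

text \<open>The elements of I^n/I^(n+1) are represented by ring elements through
  \<open>\<pi>\<close>, and scalars of A/I act like any of their representatives because I kills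
  this quotient.\<close>

lemma gr_HF_eq_len:
  assumes K: "ideal K \<A>"
  shows "gr_HF \<A> K n = len (rel_pow J (pre K) (Suc n)) (rel_pow J (pre K) n)"
proof -
  let ?P = "rel_pow J (pre K) (Suc n)" and ?Q = "rel_pow J (pre K) n"
  let ?L = "qm ` ?P"
  define \<pi> where "\<pi> q = ?L +>\<^bsub>\<A>\<^esub> qm q" for q
  have PJ: "is_ideal ?P" "J \<subseteq> ?P" by (rule is_ideal_rel_pow, rule rel_pow_ge)
  have \<pi>_iff: "\<pi> a = \<pi> b \<longleftrightarrow> a - b \<in> ?P" for a b
    unfolding \<pi>_def by (rule coset_image_eq_iff[OF PJ])
  interpret K: ideal K \<A> by (rule K)
  interpret L: ideal ?L \<A> by (rule ideal_qm_image[OF PJ(1)])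
  note preK = ideal_pre[OF K]
  \<comment> \<open>All cosets in the double union coincide: (k + r)(p + q) - r q lies in I^(n+1)
    for k in I and p in I^(n+1).\<close>
  have smult: "(\<Union>a\<in>K +>\<^bsub>\<A>\<^esub> qm r. \<Union>x\<in>\<pi> q. ?L +>\<^bsub>\<A>\<^esub> (a \<otimes>\<^bsub>\<A>\<^esub> x)) = \<pi> (r * q)" if q: "q \<in> ?Q" for r q
  proof -
    have Kr: "K +>\<^bsub>\<A>\<^esub> qm r = qm ` {p + r |p. p \<in> pre K}"
      using coset_image_eq[OF preK(1,2), of r] preK(3) by simp
    have eq: "?L +>\<^bsub>\<A>\<^esub> (a \<otimes>\<^bsub>\<A>\<^esub> x) = \<pi> (r * q)" if a: "a \<in> K +>\<^bsub>\<A>\<^esub> qm r" and x: "x \<in> \<pi> q" for a x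
    proof -
      obtain k where k: "k \<in> pre K" "a = qm (k + r)" using a unfolding Kr by blast
      obtain p where p: "p \<in> ?P" "x = qm (p + q)"
        using x unfolding \<pi>_def coset_image_eq[OF PJ] by blast
      have "(k + r) * (p + q) - r * q = (k + r) * p + k * q" by (simp add: algebra_simps)
      also have "\<dots> \<in> ?P"
        using is_ideal_add[OF PJ(1) is_ideal_mult[OF PJ(1) p(1), of "k + r"]] rel_prod_mem[OF k(1) q, of J] by simp
      finally show ?thesis using \<pi>_iff unfolding k p qm_mult \<pi>_def by blast
    qed
    have "qm r \<in> K +>\<^bsub>\<A>\<^esub> qm r" unfolding Kr using is_ideal_0[OF preK(1)] by force
    moreover have "qm q \<in> \<pi> q" unfolding \<pi>_def coset_image_eq[OF PJ] using is_ideal_0[OF PJ(1)] by force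
    ultimately show ?thesis using eq by blast
  qed
  have "module_length (\<A> Quot K) (gr_piece \<A> K n) = len ?P ?Q"
  proof (rule module_length_eq_len[where \<pi> = \<pi>])
    show "?P \<subseteq> ?Q" by (rule rel_pow_Suc_le)
    show "carrier (gr_piece \<A> K n) = \<pi> ` ?Q"
      unfolding gr_piece_def \<pi>_def ideal_pow_eq[OF K] by auto
    show "\<pi> a \<oplus>\<^bsub>gr_piece \<A> K n\<^esub> \<pi> b = \<pi> (a + b)" for a b
      unfolding gr_piece_def \<pi>_def using L.a_rcos_sum[of "qm a" "qm b"] carrier_A qm_add by simp
    show "\<zero>\<^bsub>gr_piece \<A> K n\<^esub> = \<pi> 0"
      unfolding gr_piece_def \<pi>_def ideal_pow_eq[OF K] coset_image_eq[OF PJ] by simp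
    show "\<exists>s. \<forall>q\<in>?Q. r \<odot>\<^bsub>gr_piece \<A> K n\<^esub> \<pi> q = \<pi> (s * q)" if r: "r \<in> carrier (\<A> Quot K)" for r
    proof -
      obtain s where "r = K +>\<^bsub>\<A>\<^esub> qm s"
        using r unfolding carrier_A_Quot by blast
      then show ?thesis
        using smult[of _ s] unfolding gr_piece_def ideal_pow_eq[OF K] by (intro exI[of _ s]) simp
    qed
    show "\<exists>r\<in>carrier (\<A> Quot K). \<forall>q\<in>?Q. r \<odot>\<^bsub>gr_piece \<A> K n\<^esub> \<pi> q = \<pi> (s * q)" for s
    proof (rule bexI[of _ "K +>\<^bsub>\<A>\<^esub> qm s"])
      show "K +>\<^bsub>\<A>\<^esub> qm s \<in> carrier (\<A> Quot K)"
        unfolding carrier_A_Quot by blast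
      show "\<forall>q\<in>?Q. (K +>\<^bsub>\<A>\<^esub> qm s) \<odot>\<^bsub>gr_piece \<A> K n\<^esub> \<pi> q = \<pi> (s * q)"
        using smult[of _ s] unfolding gr_piece_def ideal_pow_eq[OF K] by simp
    qed
  qed (simp_all add: \<pi>_iff del: rel_pow.simps)
  then show ?thesis unfolding gr_HF_def .
qed


lemma socle_length:
  assumes "max_ideal \<A> = qm ` M"
  shows "module_length \<A> (ideal_module \<A> (socle \<A>)) = len J (colon J M)"
proof (rule module_length_eq_len[where \<pi> = qm])
  have "socle \<A> = qm ` colon J M"
  proof (intro equalityI subsetI)
    fix x assume x: "x \<in> socle \<A>"
    then obtain r where r: "x = qm r" unfolding socle_def carrier_A by blast
    have "r * \<mu> \<in> J" if "\<mu> \<in> M" for \<mu>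
    proof -
      have "qm \<mu> \<otimes>\<^bsub>\<A>\<^esub> x = \<zero>\<^bsub>\<A>\<^esub>" using x that unfolding socle_def assms by blast
      then show ?thesis unfolding r qm_mult qm_zero qm_eq_iff by (simp add: mult.commute)
    qed
    then show "x \<in> qm ` colon J M" unfolding r colon_def by blast
  next
    fix x assume "x \<in> qm ` colon J M"
    then obtain r where r: "x = qm r" "\<And>\<mu>. \<mu> \<in> M \<Longrightarrow> r * \<mu> \<in> J" unfolding colon_def by blast
    have "a \<otimes>\<^bsub>\<A>\<^esub> x = \<zero>\<^bsub>\<A>\<^esub>" if "a \<in> qm ` M" for a
    proof -
      obtain \<mu> where "a = qm \<mu>" "\<mu> \<in> M" using \<open>a \<in> qm ` M\<close> by blast
      then show ?thesis using r(2)[of \<mu>] unfolding r(1) by (simp add: qm_mult qm_zero qm_eq_iff mult.commute)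
    qed
    then show "x \<in> socle \<A>" unfolding socle_def assms carrier_A r(1) by blast
  qed
  then show "carrier (ideal_module \<A> (socle \<A>)) = qm ` colon J M" unfolding ideal_module_def by simp
  show "\<exists>s. \<forall>q\<in>colon J M. r \<odot>\<^bsub>ideal_module \<A> (socle \<A>)\<^esub> qm q = qm (s * q)" if r: "r \<in> carrier \<A>" for r
  proof -
    obtain s where "r = qm s" using r unfolding carrier_A by blast
    then show ?thesis unfolding ideal_module_def by (intro exI[of _ s]) (simp add: qm_mult)
  qed
  show "\<exists>r\<in>carrier \<A>. \<forall>q\<in>colon J M. r \<odot>\<^bsub>ideal_module \<A> (socle \<A>)\<^esub> qm q = qm (s * q)" for s
    unfolding ideal_module_def carrier_A by (auto simp: qm_mult)
qed (simp_all add: is_ideal_J is_ideal_colon colon_ge qm_eq_iff qm_add qm_zero ideal_module_def)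

lemma exists_maximal_imp_proper:
  assumes "maximalideal K \<A>" shows "J \<noteq> UNIV"
proof
  assume "J = UNIV"
  then have "qm r = qm s" for r s using qm_eq_iff by simp
  then have "carrier \<A> = {qm 0}" unfolding carrier_A by auto
  moreover have "qm 0 \<in> K"
    using additive_subgroup.zero_closed[OF ideal.axioms(1)[OF maximalideal.axioms(1)[OF assms]]] qm_zero by simp
  moreover have "K \<subseteq> carrier \<A>" using ideal_pre(3)[OF maximalideal.axioms(1)[OF assms]] carrier_A by (metis image_mono subset_UNIV)
  ultimately show False using maximalideal.I_notcarr[OF assms] by auto
qed

lemma maximalideal_iff:
  assumes m: "is_ideal m" "m \<noteq> UNIV" "\<And>P. is_ideal P \<Longrightarrow> P \<noteq> UNIV \<Longrightarrow> P \<subseteq> m" and "J \<noteq> UNIV"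
  shows "maximalideal K \<A> \<longleftrightarrow> K = qm ` m"
proof -
  have Jm: "J \<subseteq> m" using m(3)[OF is_ideal_J \<open>J \<noteq> UNIV\<close>] .
  have proper: "qm ` P \<noteq> carrier \<A>" if "is_ideal P" "J \<subseteq> P" "P \<noteq> UNIV" for P
  proof
    assume "qm ` P = carrier \<A>"
    then have "pre (qm ` P) = UNIV" unfolding pre_def carrier_A by auto
    then show False using pre_qm_image[OF that(1,2)] that(3) by simp
  qed
  have max: "maximalideal (qm ` m) \<A>"
  proof (rule maximalidealI[OF ideal_qm_image[OF m(1)]])
    show "carrier \<A> \<noteq> qm ` m" using proper[OF m(1) Jm m(2)] by simp
    fix N assume N: "ideal N \<A>" "qm ` m \<subseteq> N" "N \<subseteq> carrier \<A>"
    note N' = ideal_pre[OF N(1)]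
    have "m \<subseteq> pre N" using N(2) unfolding pre_def by blast
    then have "pre N = UNIV \<or> pre N = m" using m(3)[OF N'(1)] by blast
    then show "N = qm ` m \<or> N = carrier \<A>" using N'(3) carrier_A by metis
  qed
  show ?thesis
  proof
    assume K: "maximalideal K \<A>"
    note K' = ideal_pre[OF maximalideal.axioms(1)[OF K]]
    have "pre K \<noteq> UNIV" using maximalideal.I_notcarr[OF K] K'(3) carrier_A by metis
    then have "pre K \<subseteq> m" using m(3)[OF K'(1)] by blast
    then have "K \<subseteq> qm ` m" using K'(3) by blast
    then have "qm ` m = K \<or> qm ` m = carrier \<A>"
      using maximalideal.I_maximal[OF K ideal_qm_image[OF m(1)]] carrier_A by blast
    then show "K = qm ` m" using proper[OF m(1) Jm m(2)] by blast
  qed (use max in simp)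
qed

text \<open>The lengths modulo \<open>J\<close> along a descending chain are natural numbers; from
  an index with minimal length on, no inclusion is strict.\<close>

lemma artinian_of_finite_len:
  assumes "len J UNIV \<noteq> \<infinity>"
  shows "artinian_ring \<A>"
  unfolding artinian_ring_def
proof (intro conjI allI impI)
  show "cring \<A>" by (rule A.is_cring)
  fix C assume C: "(\<forall>n. ideal (C n) \<A>) \<and> (\<forall>n. C (Suc n) \<subseteq> C n)"
  define D where "D n = pre (C n)" for n
  have D: "is_ideal (D n)" "J \<subseteq> D n" "qm ` D n = C n" "D (Suc n) \<subseteq> D n" for n
    using ideal_pre[of "C n"] C unfolding D_def pre_def by auto
  have fin: "len J (D n) \<noteq> \<infinity>" for n
  proof -
    have "len J (D n) \<le> len J UNIV" by (rule len_mono) auto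
    then show ?thesis using assms by (metis enat_ile not_infinity_eq)
  qed
  define f where "f n = the_enat (len J (D n))" for n
  have f: "len J (D n) = enat (f n)" for n using fin[of n] unfolding f_def by auto
  have add: "enat (f n) = enat (f (Suc n)) + len (D (Suc n)) (D n)" for n
    using len_add[OF is_ideal_J D(1)[of "Suc n"] D(1)[of n] D(2) D(4)] by (simp add: f)
  obtain N where N: "\<And>k. f N \<le> f k" using ex_has_least_nat[of "\<lambda>_. True" 0 f] by auto
  have "C n = C N" if "N \<le> n" for n
    using that
  proof (induction rule: dec_induct)
    case (step n)
    have "f n = f N" using step.IH D(3) unfolding f_def D_def by simp
    then have le: "f n \<le> f (Suc n)" using N by simp
    have "D (Suc n) = D n"
    proof (rule ccontr)
      assume "D (Suc n) \<noteq> D n"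
      then have "1 \<le> len (D (Suc n)) (D n)" using D(4)[of n] by (intro len_strict D(1)) auto
      then have "enat (f (Suc n)) + 1 \<le> enat (f n)" unfolding add[of n] by (rule add_left_mono)
      then show False using le by (simp add: one_enat_def)
    qed
    then show ?case using step.IH D(3) by metis
  qed simp
  then show "\<exists>N. \<forall>n\<ge>N. C n = C N" by blast
qed

lemma AG_algebraD:
  assumes "AG_algebra K \<A> \<phi>"
    and m: "is_ideal m" "m \<noteq> UNIV" "\<And>P. is_ideal P \<Longrightarrow> P \<noteq> UNIV \<Longrightarrow> P \<subseteq> m"
  shows "J \<noteq> UNIV" "len J (colon J m) = 1"
proof -
  obtain M where "maximalideal M \<A>"
    using assms(1) unfolding AG_algebra_def artinian_gorenstein_local_def local_ring_def by blast
  then show J: "J \<noteq> UNIV" by (rule exists_maximal_imp_proper)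
  have iff: "maximalideal N \<A> \<longleftrightarrow> N = qm ` m" for N
    by (rule maximalideal_iff[OF m(1,2) _ J]) (rule m(3))
  have "max_ideal \<A> = qm ` m" unfolding max_ideal_def iff by simp
  from socle_length[OF this] show "len J (colon J m) = 1"
    using assms(1) unfolding AG_algebra_def artinian_gorenstein_local_def by simp
qed

text \<open>Distinct constants differ by a unit, so the constants embed into the residue field;
  \<open>res\<close> makes the embedding onto.\<close>

lemma AG_algebraI:
  fixes \<iota> :: "'k::field \<Rightarrow> 'a"
  assumes m: "is_ideal m" "m \<noteq> UNIV" "\<And>P. is_ideal P \<Longrightarrow> P \<noteq> UNIV \<Longrightarrow> P \<subseteq> m"
    and J: "J \<noteq> UNIV" and len: "len J UNIV \<noteq> \<infinity>" "len J (colon J m) = 1"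
    and hom: "\<And>a b. \<iota> (a + b) = \<iota> a + \<iota> b" "\<And>a b. \<iota> (a * b) = \<iota> a * \<iota> b" "\<iota> 1 = 1"
    and res: "\<And>r. \<exists>c. r - \<iota> c \<in> m"
  shows "AG_algebra (ring_of_type_algebra :: 'k ring) \<A> (\<lambda>c. qm (\<iota> c))"
proof -
  have iff: "maximalideal N \<A> \<longleftrightarrow> N = qm ` m" for N
    by (rule maximalideal_iff[OF m(1,2) _ J]) (rule m(3))
  have max: "max_ideal \<A> = qm ` m" unfolding max_ideal_def iff by simp
  have Jm: "J \<subseteq> m" using m(3)[OF is_ideal_J J] .
  have "local_ring \<A>"
    unfolding local_ring_def iff using A.is_cring by blast
  moreover have "module_length \<A> (ideal_module \<A> (socle \<A>)) = 1"
    using socle_length[OF max] len(2) by simp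
  ultimately have ag: "artinian_gorenstein_local \<A>"
    unfolding artinian_gorenstein_local_def using artinian_of_finite_len[OF len(1)] by blast
  have hom': "(\<lambda>c. qm (\<iota> c)) \<in> ring_hom ring_of_type_algebra \<A>"
    by (rule ring_hom_memI) (simp_all add: hom qm_mult qm_add qm_one carrier_A)
  interpret M: ideal "qm ` m" \<A> by (rule ideal_qm_image[OF m(1)])
  have comp: "(\<lambda>c. (qm ` m) +>\<^bsub>\<A>\<^esub> qm (\<iota> c)) \<in> ring_hom ring_of_type_algebra (\<A> Quot (qm ` m))"
    using ring_hom_trans[OF hom' M.rcos_ring_hom] by (simp add: comp_def)
  have "bij_betw (\<lambda>c. (qm ` m) +>\<^bsub>\<A>\<^esub> qm (\<iota> c)) UNIV (range (\<lambda>r. (qm ` m) +>\<^bsub>\<A>\<^esub> qm r))"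
    unfolding bij_betw_def
  proof
    show "inj (\<lambda>c. (qm ` m) +>\<^bsub>\<A>\<^esub> qm (\<iota> c))"
    proof (rule injI)
      fix c d assume "(qm ` m) +>\<^bsub>\<A>\<^esub> qm (\<iota> c) = (qm ` m) +>\<^bsub>\<A>\<^esub> qm (\<iota> d)"
      then have cd: "\<iota> c - \<iota> d \<in> m" using coset_image_eq_iff[OF m(1) Jm] by blast
      show "c = d"
      proof (rule ccontr)
        assume "c \<noteq> d"
        have "\<iota> (c - d) + \<iota> d = \<iota> c" by (simp add: hom(1)[symmetric])
        then have "\<iota> (c - d) \<in> m" using cd by (metis add_diff_cancel_right')
        then have "\<iota> (1 / (c - d)) * \<iota> (c - d) \<in> m" by (rule is_ideal_mult[OF m(1)])
        then have "1 \<in> m" using \<open>c \<noteq> d\<close> by (simp add: hom(2)[symmetric] hom(3))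
        then have "m = UNIV" using is_ideal_mult[OF m(1), of 1] by auto
        then show False using m(2) by simp
      qed
    qed
    have "(qm ` m) +>\<^bsub>\<A>\<^esub> qm r \<in> range (\<lambda>c. (qm ` m) +>\<^bsub>\<A>\<^esub> qm (\<iota> c))" for r
      using res[of r] coset_image_eq_iff[OF m(1) Jm] by blast
    then show "range (\<lambda>c. (qm ` m) +>\<^bsub>\<A>\<^esub> qm (\<iota> c)) = range (\<lambda>r. (qm ` m) +>\<^bsub>\<A>\<^esub> qm r)"
      by blast
  qed
  then have "(\<lambda>c. max_ideal \<A> +>\<^bsub>\<A>\<^esub> qm (\<iota> c)) \<in> ring_iso ring_of_type_algebra (\<A> Quot max_ideal \<A>)"
    unfolding ring_iso_def max carrier_A_Quot using comp by simp
  then show ?thesis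
    unfolding AG_algebra_def using ag hom' field_from_type_algebra by blast
qed

end


section \<open>Power series in two variables\<close>

text \<open>From here on x is the outer variable \<open>fps_X\<close> and y the inner one
  \<open>fps_const fps_X\<close>, so \<open>f $ i $ j\<close> is the coefficient of x^i y^j.\<close>

definition monom2 :: "nat \<Rightarrow> nat \<Rightarrow> 'k::field fps fps" where
  "monom2 i j = fps_X ^ i * fps_const (fps_X ^ j)"

lemma monom2_mult_nth:
  "(monom2 i j * f) $ a $ b = (if i \<le> a \<and> j \<le> b then f $ (a - i) $ (b - j) else 0)"
  by (auto simp: monom2_def mult.assoc fps_X_power_mult_nth)

lemma monom2_nth: "monom2 i j $ a $ b = (if a = i \<and> b = j then 1 else 0)"
  using monom2_mult_nth[of i j 1 a b] by (auto simp: fps_one_nth)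

lemma fps2_mult_nth:
  fixes f g :: "'k::field fps fps"
  shows "(f * g) $ i $ j = (\<Sum>a\<le>i. \<Sum>b\<le>j. f $ a $ b * g $ (i - a) $ (j - b))"
  by (simp add: fps_mult_nth fps_sum_nth atLeast0AtMost)

lemma fps2_const_mult_nth: "(fps2_const c * f) $ i $ j = c * f $ i $ j"
  by (simp add: fps2_const_def)

lemma fps2_const_nth: "fps2_const c $ i $ j = (if i = 0 \<and> j = 0 then c else 0)"
  by (simp add: fps2_const_def)

definition fps2_max :: "'k::field fps fps set" where
  "fps2_max = {f. f $ 0 $ 0 = 0}"

lemma fps2_dvd_one_iff: "(f :: 'k::field fps fps) dvd 1 \<longleftrightarrow> f $ 0 $ 0 \<noteq> 0"
proof
  assume "f dvd 1"
  then obtain g where "1 = f * g" by (rule dvdE)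
  then have "f $ 0 $ 0 * g $ 0 $ 0 = 1" by (metis fps_mult_nth_0 fps_one_nth)
  then show "f $ 0 $ 0 \<noteq> 0" by auto
next
  assume "f $ 0 $ 0 \<noteq> 0"
  then have "f $ 0 * inverse (f $ 0) = 1" by (rule inverse_mult_eq_1')
  then have "f * fps_right_inverse f (inverse (f $ 0)) = 1" by (rule fps_right_inverse)
  then show "f dvd 1" by (metis dvdI)
qed

lemma fps2_decompose:
  fixes f :: "'k::field fps fps"
  shows "f = fps_shift 1 f * fps_X + fps_const (f $ 0)"
  by (rule fps_ext) (auto simp: fps_mult_fps_X_commute[symmetric] gr0_conv_Suc)

interpretation fps2: two_generated_local_ring fps2_max "fps_X :: 'k::field fps fps" "fps_const fps_X"
proof
  show "fps2_max = {r :: 'k fps fps. \<not> r dvd 1}" by (simp add: fps2_max_def fps2_dvd_one_iff)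
  show "fps2_max = {u * fps_X + v * fps_const fps_X |u v :: 'k fps fps. True}"
  proof (intro equalityI subsetI)
    fix f :: "'k fps fps" assume "f \<in> fps2_max"
    then have "f $ 0 = fps_shift 1 (f $ 0) * fps_X"
      by (intro fps_ext) (auto simp: fps2_max_def fps_mult_fps_X_commute[symmetric] gr0_conv_Suc)
    then have "f = fps_shift 1 f * fps_X + fps_const (fps_shift 1 (f $ 0)) * fps_const fps_X"
      using fps2_decompose[of f] by simp
    then show "f \<in> {u * fps_X + v * fps_const fps_X |u v. True}" by blast
  next
    fix f :: "'k fps fps" assume "f \<in> {u * fps_X + v * fps_const fps_X |u v. True}"
    then show "f \<in> fps2_max" by (auto simp: fps2_max_def)
  qed
qed

lemma fps2_residue: "r - fps2_const (r $ 0 $ 0) \<in> fps2_max"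
  by (simp add: fps2_max_def fps2_const_nth)

text \<open>The functionals kill m Q, so their common kernel is an ideal; each new one, having a
  dual vector \<open>e t\<close>, lowers the length by exactly one. The index type is free: pairs of
  exponents for the weight filtration, a single point for the socle.\<close>

lemma len_eq_card_functionals:
  fixes L :: "'t \<Rightarrow> 'k::field fps fps \<Rightarrow> 'k" and e :: "'t \<Rightarrow> 'k fps fps"
  assumes S: "finite S" and Q: "is_ideal Q"
    and add: "\<And>t f g. L t (f + g) = L t f + L t g"
    and scale: "\<And>t c f. L t (fps2_const c * f) = c * L t f"
    and m: "\<And>r f t. r \<in> fps2_max \<Longrightarrow> f \<in> Q \<Longrightarrow> t \<in> S \<Longrightarrow> L t (r * f) = 0"
    and e: "\<And>t. t \<in> S \<Longrightarrow> e t \<in> Q"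
    and dual: "\<And>t u. t \<in> S \<Longrightarrow> u \<in> S \<Longrightarrow> L t (e u) = (if t = u then 1 else 0)"
  shows "is_ideal {f \<in> Q. \<forall>t\<in>S. L t f = 0} \<and> len {f \<in> Q. \<forall>t\<in>S. L t f = 0} Q = enat (card S)"
  using S m e dual
proof (induction S)
  case empty
  then show ?case using Q by (simp add: len_self zero_enat_def)
next
  case (insert t S)
  let ?P' = "{f \<in> Q. \<forall>t\<in>S. L t f = 0}" and ?P = "{f \<in> Q. \<forall>u\<in>insert t S. L u f = 0}"
  have IH: "is_ideal ?P'" "len ?P' Q = enat (card S)" using insert by auto
  have zero: "L u 0 = 0" for u
    using add[of u 0 0] by (simp only: add_0_left add_cancel_right_right)
  have diff: "L u (f - g) = L u f - L u g" for u f g using add[of u "f - g" g] by simp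
  have id: "is_ideal ?P"
  proof (rule ring_module.subspaceI)
    show "0 \<in> ?P" using zero is_ideal_0[OF Q] by simp
    show "x + y \<in> ?P" if "x \<in> ?P" "y \<in> ?P" for x y using that add is_ideal_add[OF Q] by simp
    show "c * x \<in> ?P" if x: "x \<in> ?P" for c x
    proof -
      \<comment> \<open>The functionals are linear over k only, so the multiplier is split into its
        constant term and an element of the maximal ideal.\<close>
      define r where "r = c - fps2_const (c $ 0 $ 0)"
      have r: "r \<in> fps2_max" unfolding r_def by (rule fps2_residue)
      have c: "c * x = fps2_const (c $ 0 $ 0) * x + r * x" by (simp add: r_def algebra_simps)
      have "L u (c * x) = 0" if "u \<in> insert t S" for u
        unfolding c add scale using x that insert.prems(1)[OF r, of x u] by auto
      then show ?thesis using x is_ideal_mult[OF Q] by blast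
    qed
  qed
  have "len ?P ?P' \<le> 1"
  proof (rule fps2.len_cyclic_le_1[OF id, of "e t"])
    show "r * e t \<in> ?P" if "r \<in> fps2_max" for r
      using insert.prems(1)[OF that, of "e t"] insert.prems(2)[of t] is_ideal_mult[OF Q] by auto
    show "\<exists>r. f - r * e t \<in> ?P" if f: "f \<in> ?P'" for f
    proof (rule exI[of _ "fps2_const (L t f)"])
      have "L u (f - fps2_const (L t f) * e t) = 0" if "u \<in> insert t S" for u
        unfolding diff scale using that f insert.prems(3)[of u t] insert.hyps by auto
      moreover have "f - fps2_const (L t f) * e t \<in> Q"
        using f insert.prems(2)[of t] by (intro is_ideal_diff[OF Q] is_ideal_mult[OF Q]) auto
      ultimately show "f - fps2_const (L t f) * e t \<in> ?P" by blast
    qed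
  qed
  moreover have "1 \<le> len ?P ?P'"
  proof (rule len_strict[OF id IH(1)])
    have "e t \<in> ?P'" using insert.prems(2)[of t] insert.prems(3)[of _ t] insert.hyps by auto
    moreover have "e t \<notin> ?P" using insert.prems(3)[of t t] by auto
    ultimately show "?P \<subset> ?P'" by blast
  qed
  ultimately have "len ?P ?P' = 1" by (rule antisym)
  moreover have "len ?P Q = len ?P ?P' + len ?P' Q"
    by (rule len_add[OF id IH(1) Q]) auto
  ultimately show ?case using id IH(2) insert.hyps by (simp add: one_enat_def)
qed


section \<open>A family of complete intersections\<close>

text \<open>The weight of the monomial \<open>x\<^sup>iy\<^sup>j\<close> is \<open>2i + j\<close>, so that \<open>(x, y\<^sup>2)\<^sup>n\<close> is spanned by the monomials
  of weight at least \<open>2n\<close>.\<close>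

definition weight_ideal :: "nat \<Rightarrow> 'k::field fps fps set" where
  "weight_ideal n = {f. \<forall>i j. 2 * i + j < n \<longrightarrow> f $ i $ j = 0}"

lemma weight_ideal_mult:
  assumes "f \<in> weight_ideal a" "g \<in> weight_ideal b"
  shows "f * g \<in> weight_ideal (a + b)"
  unfolding weight_ideal_def
proof (safe)
  fix i j assume ij: "2 * i + j < a + b"
  have "f $ k $ l * g $ (i - k) $ (j - l) = 0" if "k \<le> i" "l \<le> j" for k l
  proof -
    have "2 * k + l < a \<or> 2 * (i - k) + (j - l) < b" using ij that by linarith
    then show ?thesis using assms unfolding weight_ideal_def by auto
  qed
  then show "(f * g) $ i $ j = 0" unfolding fps2_mult_nth by (intro sum.neutral ballI) auto
qed

lemma weight_ideal_0: "weight_ideal 0 = UNIV"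
  by (simp add: weight_ideal_def)

lemma is_ideal_weight_ideal: "is_ideal (weight_ideal n)"
proof (rule ring_module.subspaceI)
  show "c * x \<in> weight_ideal n" if "x \<in> weight_ideal n" for c x :: "'a fps fps"
    using weight_ideal_mult[of c 0 x n] that by (simp add: weight_ideal_0)
qed (auto simp: weight_ideal_def)

lemma fps2_max_le_weight_ideal: "fps2_max \<subseteq> weight_ideal 1"
  by (auto simp: fps2_max_def weight_ideal_def)

lemma monom2_weight_ideal: "n \<le> 2 * i + j \<Longrightarrow> monom2 i j \<in> weight_ideal n"
  by (auto simp: weight_ideal_def monom2_nth)

text \<open>The ideal \<open>ann\<close> below is \<open>(xy\<^sup>s, x\<^sup>p - y\<^sup>q)\<close>, given by its Macaulay dual generator \<open>\<phi>\<close>, which makes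
  the quotient Gorenstein by construction. The functionals \<open>coord t\<close> with \<open>t\<close> in \<open>expo\<close> are coordinates
  on the quotient for the basis \<open>x\<^sup>iy\<^sup>j\<close>; there \<open>x\<^sup>py\<^sup>j = y\<^sup>q\<^sup>+\<^sup>j\<close> takes the larger of both weights.\<close>

definition expo :: "nat \<Rightarrow> nat \<Rightarrow> nat \<Rightarrow> (nat \<times> nat) list" where
  "expo p s q = map (Pair 0) [0..<q] @ List.product [1..<Suc p] [0..<s]"

definition expo_weight :: "nat \<Rightarrow> nat \<Rightarrow> nat \<times> nat \<Rightarrow> nat" where
  "expo_weight p q = (\<lambda>(i, j). if i = p then j + max (2 * p) q else 2 * i + j)"

text \<open>As (x, y^2)^n is cut out by weight at least 2n, the n-th graded piece collects the basis
  monomials of weights 2n and 2n + 1. Lists keep the count executable.\<close>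

definition hilb :: "nat \<Rightarrow> nat \<Rightarrow> nat \<Rightarrow> nat \<Rightarrow> nat" where
  "hilb p s q n = length (filter (\<lambda>t. expo_weight p q t div 2 = n) (expo p s q))"

locale xy_quotient =
  fixes ty :: "'k::field itself" and p s q :: nat
  assumes p: "1 \<le> p" and s: "1 \<le> s" and sq: "s \<le> q"
begin

text \<open>Evaluation against the dual polynomial Y^(q+s-1) + X^p Y^(s-1); both terms match the
  socle element x^p y^(s-1) = y^(q+s-1).\<close>

definition \<phi> :: "'k fps fps \<Rightarrow> 'k" where
  "\<phi> f = f $ 0 $ (q + s - 1) + f $ p $ (s - 1)"

definition ann :: "'k fps fps set" where
  "ann = {f. \<forall>g. \<phi> (f * g) = 0}"

text \<open>In the quotient y^(q+j) equals x^p y^j, so its coefficient is added to that of x^p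
  y^j.\<close>

definition coord :: "nat \<times> nat \<Rightarrow> 'k fps fps \<Rightarrow> 'k" where
  "coord = (\<lambda>(i, j) f. f $ i $ j + (if i = p then f $ 0 $ (q + j) else 0))"

text \<open>Of the two representatives x^p y^j and y^(q+j) the one of larger weight is taken, so
  that the basis vector lies as deep in the filtration as \<open>wt\<close> says.\<close>

definition basis :: "nat \<times> nat \<Rightarrow> 'k fps fps" where
  "basis = (\<lambda>(i, j). if i = p \<and> 2 * p < q then monom2 0 (q + j) else monom2 i j)"

abbreviation T :: "(nat \<times> nat) set" where "T \<equiv> set (expo p s q)"

abbreviation wt :: "nat \<times> nat \<Rightarrow> nat" where "wt \<equiv> expo_weight p q"

lemma T_iff: "(i, j) \<in> T \<longleftrightarrow> (i = 0 \<and> j < q) \<or> (1 \<le> i \<and> i \<le> p \<and> j < s)"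
  by (auto simp: expo_def)

lemma \<phi>_add: "\<phi> (f + g) = \<phi> f + \<phi> g" by (simp add: \<phi>_def)

lemma \<phi>_scale: "\<phi> (fps2_const c * f) = c * \<phi> f"
  by (simp only: \<phi>_def fps2_const_mult_nth distrib_left)

lemma is_ideal_ann: "is_ideal ann"
proof (rule ring_module.subspaceI)
  show "0 \<in> ann" by (simp add: ann_def \<phi>_def)
  show "x + y \<in> ann" if "x \<in> ann" "y \<in> ann" for x y
    using that by (simp add: ann_def distrib_right \<phi>_add)
  show "c * x \<in> ann" if "x \<in> ann" for c x
    unfolding ann_def
  proof safe
    fix g
    have eq: "c * x * g = x * (c * g)" by (simp add: ac_simps)
    show "\<phi> (c * x * g) = 0" unfolding eq using that unfolding ann_def by blast
  qed
qed

text \<open>Multiplying f by the monomial that complements x^i y^j to a socle monomial lets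
  \<open>\<phi>\<close> read off the coordinate. Conversely, if all coordinates vanish, the two
  coefficients in \<phi>(f g) involve only the entries \<open>f $ 0 $ (q + j)\<close> and
  \<open>f $ p $ j\<close>, which are opposite to each other.\<close>

lemma ann_iff: "f \<in> ann \<longleftrightarrow> (\<forall>t\<in>T. coord t f = 0)"
proof
  assume f: "f \<in> ann"
  show "\<forall>t\<in>T. coord t f = 0"
  proof safe
    fix i j assume "(i, j) \<in> T"
    then consider "i = 0" "j < q" | "1 \<le> i" "i \<le> p" "j < s" unfolding T_iff by blast
    then show "coord (i, j) f = 0"
    proof cases
      case 1
      have "\<phi> (monom2 0 (q + s - 1 - j) * f) = 0"
        using f unfolding ann_def mult.commute[of "monom2 0 (q + s - 1 - j)"] by blast
      moreover have "\<phi> (monom2 0 (q + s - 1 - j) * f) = f $ 0 $ j"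
        unfolding \<phi>_def monom2_mult_nth using 1 s by auto
      ultimately show ?thesis using 1 p by (simp add: coord_def)
    next
      case 2
      have "\<phi> (monom2 (p - i) (s - 1 - j) * f) = 0"
        using f unfolding ann_def mult.commute[of "monom2 (p - i) (s - 1 - j)"] by blast
      moreover have "\<phi> (monom2 (p - i) (s - 1 - j) * f) = coord (i, j) f"
        unfolding \<phi>_def monom2_mult_nth coord_def using 2 s by (auto simp: algebra_simps)
      ultimately show ?thesis by simp
    qed
  qed
next
  assume c: "\<forall>t\<in>T. coord t f = 0"
  have c0: "f $ 0 $ j = 0" if "j < q" for j
    using c[rule_format, of "(0, j)"] that p by (simp add: T_iff coord_def)
  have c1: "f $ i $ j = 0" if "1 \<le> i" "i < p" "j < s" for i j
    using c[rule_format, of "(i, j)"] that by (simp add: T_iff coord_def)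
  have c2: "f $ p $ j = - f $ 0 $ (q + j)" if "j < s" for j
    using c[rule_format, of "(p, j)"] that p by (simp add: T_iff coord_def eq_neg_iff_add_eq_0)
  have "\<phi> (f * g) = 0" for g
  proof -
    have "(f * g) $ 0 $ (q + s - 1) = (\<Sum>b\<le>q + s - 1. f $ 0 $ b * g $ 0 $ (q + s - 1 - b))"
      by (simp add: fps2_mult_nth del: fps_mult_nth_0)
    also have "\<dots> = (\<Sum>b\<in>(\<lambda>b. q + b) ` {..s - 1}. f $ 0 $ b * g $ 0 $ (q + s - 1 - b))"
    proof (rule sum.mono_neutral_right)
      show "\<forall>b\<in>{..q + s - 1} - (\<lambda>b. q + b) ` {..s - 1}. f $ 0 $ b * g $ 0 $ (q + s - 1 - b) = 0"
      proof
        fix b assume b: "b \<in> {..q + s - 1} - (\<lambda>b. q + b) ` {..s - 1}"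
        have "b < q"
        proof (rule ccontr)
          assume "\<not> b < q"
          then have "b = q + (b - q)" "b - q \<le> s - 1" using b s by auto
          then show False using b by blast
        qed
        then show "f $ 0 $ b * g $ 0 $ (q + s - 1 - b) = 0" using c0 by simp
      qed
    qed (use s in auto)
    also have "\<dots> = (\<Sum>b\<le>s - 1. f $ 0 $ (q + b) * g $ 0 $ (s - 1 - b))"
      by (subst sum.reindex) (use s in \<open>auto intro!: sum.cong simp: inj_on_def\<close>)
    finally have 1: "(f * g) $ 0 $ (q + s - 1) = (\<Sum>b\<le>s - 1. f $ 0 $ (q + b) * g $ 0 $ (s - 1 - b))" .
    have "(f * g) $ p $ (s - 1) = (\<Sum>a\<in>{p}. \<Sum>b\<le>s - 1. f $ a $ b * g $ (p - a) $ (s - 1 - b))"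
      unfolding fps2_mult_nth
    proof (rule sum.mono_neutral_right)
      show "\<forall>a\<in>{..p} - {p}. (\<Sum>b\<le>s - 1. f $ a $ b * g $ (p - a) $ (s - 1 - b)) = 0"
      proof (intro ballI sum.neutral)
        fix a b assume a: "a \<in> {..p} - {p}" and b: "b \<in> {..s - 1}"
        have "f $ a $ b = 0"
        proof (cases "a = 0")
          case True
          then show ?thesis using c0[of b] b s sq by auto
        next
          case False
          then show ?thesis using c1[of a b] a b s by auto
        qed
        then show "f $ a $ b * g $ (p - a) $ (s - 1 - b) = 0" by simp
      qed
    qed auto
    also have "\<dots> = - (\<Sum>b\<le>s - 1. f $ 0 $ (q + b) * g $ 0 $ (s - 1 - b))"
      using s by (auto simp: sum_negf[symmetric] c2 intro!: sum.cong)
    finally show ?thesis unfolding \<phi>_def 1 by simp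
  qed
  then show "f \<in> ann" unfolding ann_def by blast
qed

section \<open>Coordinates and the weight filtration on the quotient\<close>

lemma coord_add: "coord t (f + g) = coord t f + coord t g"
  by (cases t) (simp add: coord_def)

lemma coord_scale: "coord t (fps2_const c * f) = c * coord t f"
  by (cases t) (simp add: coord_def fps2_const_mult_nth distrib_left del: fps_mult_nth_0)

lemma coord_0: "coord t 0 = 0"
  by (cases t) (simp add: coord_def)

lemma coord_diff: "coord t (f - g) = coord t f - coord t g"
  using coord_add[of t "f - g" g] by simp

lemma coord_sum: "finite U \<Longrightarrow> coord t (sum F U) = (\<Sum>u\<in>U. coord t (F u))"
  by (induction U rule: finite_induct) (simp_all add: coord_0 coord_add)

lemma coord_basis: "t \<in> T \<Longrightarrow> u \<in> T \<Longrightarrow> coord t (basis u) = (if t = u then 1 else 0)"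
  using p sq by (cases t; cases u) (auto simp: T_iff coord_def basis_def monom2_nth)

lemma basis_weight: "n \<le> wt t \<Longrightarrow> basis t \<in> weight_ideal n"
  by (cases t) (auto simp: basis_def expo_weight_def max_def intro!: monom2_weight_ideal split: if_splits)

lemma coord_weight_ideal: "f \<in> weight_ideal n \<Longrightarrow> wt t < n \<Longrightarrow> coord t f = 0"
  by (cases t) (auto simp: coord_def expo_weight_def weight_ideal_def split: if_splits)

definition D :: "nat \<Rightarrow> 'k fps fps set" where
  "D n = {f. \<forall>t\<in>T. wt t < n \<longrightarrow> coord t f = 0}"

text \<open>Subtracting the basis expansion of f, whose terms have weight at least n, leaves an
  element with all coordinates zero, that is, an element of \<open>ann\<close>.\<close>

lemma D_eq: "D n = {x + y |x y. x \<in> weight_ideal n \<and> y \<in> ann}"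
proof (intro equalityI subsetI)
  fix f assume f: "f \<in> D n"
  define U where "U = {t \<in> T. n \<le> wt t}"
  define x where "x = (\<Sum>u\<in>U. fps2_const (coord u f) * basis u)"
  have U: "finite U" "U \<subseteq> T" unfolding U_def by auto
  have "x \<in> weight_ideal n"
    unfolding x_def
    by (intro ring_module.subspace_sum is_ideal_weight_ideal is_ideal_mult basis_weight) (simp add: U_def)
  moreover have "f - x \<in> ann"
    unfolding ann_iff
  proof
    fix t assume t: "t \<in> T"
    have "coord t x = (\<Sum>u\<in>U. if t = u then coord u f else 0)"
      unfolding x_def coord_sum[OF U(1)] coord_scale using U(2) t by (intro sum.cong) (auto simp: coord_basis)
    also have "\<dots> = (if t \<in> U then coord t f else 0)" using U(1) by simp
    also have "\<dots> = coord t f" using f t unfolding U_def D_def by auto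
    finally show "coord t (f - x) = 0" by (simp add: coord_diff)
  qed
  moreover have "f = x + (f - x)" by simp
  ultimately show "f \<in> {x + y |x y. x \<in> weight_ideal n \<and> y \<in> ann}" by blast
next
  fix f assume "f \<in> {x + y |x y. x \<in> weight_ideal n \<and> y \<in> ann}"
  then obtain x y where "f = x + y" "x \<in> weight_ideal n" "y \<in> ann" by blast
  then show "f \<in> D n" unfolding D_def using coord_weight_ideal ann_iff by (auto simp: coord_add)
qed

lemma is_ideal_D: "is_ideal (D n)"
  unfolding D_eq by (intro is_ideal_sums is_ideal_weight_ideal is_ideal_ann)

lemma ann_le_D: "ann \<subseteq> D n"
  unfolding D_def using ann_iff by blast

lemma weight_ideal_le_D: "weight_ideal n \<subseteq> D n"
  unfolding D_eq using is_ideal_0[OF is_ideal_ann] by force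

lemma D_0: "D 0 = UNIV"
  by (simp add: D_def)

lemma D_mult:
  assumes "f \<in> D a" "g \<in> D b" shows "f * g \<in> D (a + b)"
proof -
  obtain x y where f: "f = x + y" "x \<in> weight_ideal a" "y \<in> ann" using assms(1) unfolding D_eq by blast
  obtain x' y' where g: "g = x' + y'" "x' \<in> weight_ideal b" "y' \<in> ann" using assms(2) unfolding D_eq by blast
  have "f * g = x * x' + (x * y' + g * y)" unfolding f g by (simp add: algebra_simps)
  moreover have "x * x' \<in> weight_ideal (a + b)" using f g by (intro weight_ideal_mult)
  moreover have "x * y' + g * y \<in> ann" using f g by (intro is_ideal_add is_ideal_mult is_ideal_ann)
  ultimately show ?thesis unfolding D_eq by blast
qed

lemma D_Suc_le: "D (Suc n) \<subseteq> D n"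
  unfolding D_def by auto

lemma D_Suc_eq: "D (Suc n) = {f \<in> D n. \<forall>t\<in>{t \<in> T. wt t = n}. coord t f = 0}"
  unfolding D_def by (auto simp: less_Suc_eq)

text \<open>Multiplication by an element of the maximal ideal raises the weight by at least one, so
  the coordinates of weight n are functionals of the kind that
  \<open>len_eq_card_functionals\<close> counts.\<close>

lemma len_D: "len (D (Suc n)) (D n) = enat (card {t \<in> T. wt t = n})"
proof -
  have "len {f \<in> D n. \<forall>t\<in>{t \<in> T. wt t = n}. coord t f = 0} (D n) = enat (card {t \<in> T. wt t = n})"
  proof (rule len_eq_card_functionals[where e = basis, THEN conjunct2])
    show "coord t (r * f) = 0" if "r \<in> fps2_max" "f \<in> D n" "t \<in> {t \<in> T. wt t = n}" for r f t
    proof -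
      have "r \<in> D 1" using that(1) fps2_max_le_weight_ideal weight_ideal_le_D by blast
      then have "r * f \<in> D (Suc n)" using D_mult[of r 1 f n] that(2) by simp
      then show ?thesis using that(3) unfolding D_def by simp
    qed
    show "basis t \<in> D n" if "t \<in> {t \<in> T. wt t = n}" for t
      using that basis_weight[of n t] weight_ideal_le_D by auto
  qed (auto simp: is_ideal_D coord_add coord_scale coord_basis)
  then show ?thesis unfolding D_Suc_eq .
qed

lemma distinct_expo: "distinct (expo p s q)"
  unfolding expo_def by (auto simp: distinct_map inj_on_def intro!: distinct_product)

lemma len_D_double: "len (D (2 * Suc n)) (D (2 * n)) = enat (hilb p s q n)"
proof -
  have "len (D (2 * Suc n)) (D (2 * n)) = len (D (Suc (Suc (2 * n)))) (D (Suc (2 * n))) + len (D (Suc (2 * n))) (D (2 * n))"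
    using len_add[OF is_ideal_D is_ideal_D is_ideal_D D_Suc_le D_Suc_le] by simp
  also have "\<dots> = enat (card {t \<in> T. wt t = Suc (2 * n)} + card {t \<in> T. wt t = 2 * n})"
    unfolding len_D by simp
  also have "card {t \<in> T. wt t = Suc (2 * n)} + card {t \<in> T. wt t = 2 * n}
      = card ({t \<in> T. wt t = Suc (2 * n)} \<union> {t \<in> T. wt t = 2 * n})"
    by (rule card_Un_disjoint[symmetric]) auto
  also have "{t \<in> T. wt t = Suc (2 * n)} \<union> {t \<in> T. wt t = 2 * n} = {t \<in> T. wt t div 2 = n}"
    by auto
  also have "card \<dots> = hilb p s q n"
    unfolding hilb_def distinct_card[OF distinct_filter[OF distinct_expo], symmetric] set_filter ..
  finally show ?thesis .
qed

text \<open>\<open>D 2\<close> represents the ideal (x, y^2). A series of weight at least 2n + 2 is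
  x times one of weight at least 2n, plus y^2 times a series in y alone of weight at least
  2n.\<close>

lemma rel_pow_D: "rel_pow ann (D 2) n = D (2 * n)"
proof (induction n)
  case 0
  show ?case by (simp add: D_0)
next
  case (Suc n)
  have "rel_prod ann (D 2) (D (2 * n)) = D (2 * Suc n)"
  proof
    show "rel_prod ann (D 2) (D (2 * n)) \<subseteq> D (2 * Suc n)"
    proof (rule rel_prod_least[OF is_ideal_D ann_le_D])
      show "f * g \<in> D (2 * Suc n)" if "f \<in> D 2" "g \<in> D (2 * n)" for f g
        using D_mult[OF that] by simp
    qed
    show "D (2 * Suc n) \<subseteq> rel_prod ann (D 2) (D (2 * n))"
    proof
      fix f assume "f \<in> D (2 * Suc n)"
      then obtain x y where f: "f = x + y" "x \<in> weight_ideal (2 * Suc n)" "y \<in> ann" unfolding D_eq by blast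
      have x0: "x $ 0 $ j = 0" if "j < 2 * Suc n" for j
        using f(2)[unfolded weight_ideal_def, simplified, rule_format, of 0 j] that by simp
      \<comment> \<open>The part of the series \<open>x\<close> free of the outer variable is a
        series in the inner variable of order at least 2, hence divisible by its square.\<close>
      have "x $ 0 = fps_X ^ 2 * fps_shift 2 (x $ 0)"
        by (rule fps_ext) (use x0 in \<open>auto simp: fps_X_power_mult_nth not_less simp del: add_2_eq_Suc'\<close>)
      then have "x = fps_X * fps_shift 1 x + fps_const (fps_X ^ 2) * fps_const (fps_shift 2 (x $ 0))"
        using fps2_decompose[of x] by (simp add: mult.commute)
      then have "x = monom2 1 0 * fps_shift 1 x + monom2 0 2 * fps_const (fps_shift 2 (x $ 0))"
        by (simp add: monom2_def)
      moreover have "fps_shift 1 x \<in> weight_ideal (2 * n)" "fps_const (fps_shift 2 (x $ 0)) \<in> weight_ideal (2 * n)"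
        using f(2) unfolding weight_ideal_def by auto
      moreover have "monom2 1 0 \<in> weight_ideal 2" "monom2 0 2 \<in> weight_ideal 2"
        by (auto intro: monom2_weight_ideal)
      moreover have "f * g \<in> rel_prod ann (D 2) (D (2 * n))"
        if "f \<in> weight_ideal 2" "g \<in> weight_ideal (2 * n)" for f g
        using that weight_ideal_le_D by (intro rel_prod_mem) blast+
      ultimately have "x \<in> rel_prod ann (D 2) (D (2 * n))"
        using is_ideal_add[OF is_ideal_rel_prod] by metis
      then show "f \<in> rel_prod ann (D 2) (D (2 * n))"
        unfolding f(1) using f(3) rel_prod_ge[of ann] by (intro is_ideal_add is_ideal_rel_prod) auto
    qed
  qed
  then show ?case using Suc by simp
qed

section \<open>The quotient is nonzero, of finite length, with simple socle\<close>

lemma ann_proper: "ann \<noteq> UNIV"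
proof -
  have "coord (0, 0) 1 = 1" using p by (simp add: coord_def fps_one_nth)
  moreover have "(0, 0) \<in> T" using s sq by (simp add: T_iff)
  ultimately have "1 \<notin> ann" unfolding ann_iff using zero_neq_one by metis
  then show ?thesis by blast
qed

text \<open>Beyond the largest weight of a basis monomial the filtration has reached
  \<open>ann\<close>.\<close>

lemma len_ann_finite: "len ann UNIV \<noteq> \<infinity>"
proof -
  define N where "N = Suc (Max (wt ` T))"
  have "wt t < N" if "t \<in> T" for t unfolding N_def using that by (simp add: le_imp_less_Suc)
  then have "D N = ann" unfolding D_def using ann_iff by auto
  moreover have "len (D N) (D 0) = (\<Sum>i<N. len (D (Suc i)) (D i))"
    by (rule len_filtration[of D, OF is_ideal_D D_Suc_le])
  moreover have "(\<Sum>i<n. enat (h i)) = enat (\<Sum>i<n. h i)" for n and h :: "nat \<Rightarrow> nat"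
    by (induction n) (simp_all add: zero_enat_def)
  ultimately show ?thesis by (simp add: D_0 len_D)
qed

text \<open>On the socle \<phi>(f g) is the constant term of g times \<phi>(f), so there the kernel
  of \<open>\<phi>\<close> is \<open>ann\<close>. Thus \<open>\<phi>\<close> identifies the socle
  with k, with y^(q+s-1) as dual vector.\<close>

lemma len_socle: "len ann (colon ann fps2_max) = 1"
proof -
  have *: "ann = {f \<in> colon ann fps2_max. \<forall>t\<in>{()}. \<phi> f = 0}"
  proof (intro equalityI subsetI)
    fix f assume f: "f \<in> ann"
    then have "\<phi> (f * 1) = 0" unfolding ann_def by blast
    then show "f \<in> {f \<in> colon ann fps2_max. \<forall>t\<in>{()}. \<phi> f = 0}"
      using f colon_ge[OF is_ideal_ann] by auto
  next
    fix f assume f: "f \<in> {f \<in> colon ann fps2_max. \<forall>t\<in>{()}. \<phi> f = 0}"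
    have "\<phi> (f * g) = 0" for g
    proof -
      have "f * (g - fps2_const (g $ 0 $ 0)) \<in> ann"
        using f fps2_residue unfolding colon_def by blast
      then have "\<phi> (f * (g - fps2_const (g $ 0 $ 0)) * 1) = 0" unfolding ann_def by blast
      moreover have "f * g = fps2_const (g $ 0 $ 0) * f + f * (g - fps2_const (g $ 0 $ 0))"
        by (simp add: algebra_simps)
      ultimately show ?thesis using f by (simp add: \<phi>_add \<phi>_scale)
    qed
    then show "f \<in> ann" unfolding ann_def by blast
  qed
  have "len {f \<in> colon ann fps2_max. \<forall>t\<in>{()}. \<phi> f = 0} (colon ann fps2_max) = enat (card {()})"
  proof (rule len_eq_card_functionals[where e = "\<lambda>_. monom2 0 (q + s - 1)", THEN conjunct2])
    show "\<phi> (r * f) = 0" if "r \<in> fps2_max" "f \<in> colon ann fps2_max" for r f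
    proof -
      have "f * r \<in> ann" using that unfolding colon_def by blast
      then have "\<phi> (f * r * 1) = 0" unfolding ann_def by blast
      then show ?thesis by (simp add: mult.commute)
    qed
    show "monom2 0 (q + s - 1) \<in> colon ann fps2_max"
      unfolding colon_def ann_def
    proof safe
      fix r g :: "'k fps fps" assume "r \<in> fps2_max"
      then have "(r * g) $ 0 $ 0 = 0" by (simp add: fps2_max_def)
      then show "\<phi> (monom2 0 (q + s - 1) * r * g) = 0"
        unfolding \<phi>_def mult.assoc monom2_mult_nth using s sq by auto
    qed
    show "\<phi> (monom2 0 (q + s - 1)) = (if t = u then 1 else 0)" for t u :: unit
      unfolding \<phi>_def monom2_nth using p by simp
  qed (auto simp: is_ideal_colon is_ideal_ann \<phi>_add \<phi>_scale)
  then show ?thesis using * by (simp add: one_enat_def)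
qed

end


section \<open>The classification\<close>

lemma fps2_proper_le_max:
  "is_ideal P \<Longrightarrow> P \<noteq> UNIV \<Longrightarrow> P \<subseteq> (fps2_max :: 'k::field fps fps set)"
  by (rule fps2.proper_ideal_le_m)

lemma fps2_max_proper: "(fps2_max :: 'k::field fps fps set) \<noteq> UNIV"
  using fps2.one_notin_m by blast

definition realizable :: "'k::field itself \<Rightarrow> nat list \<Rightarrow> bool" where
  "realizable ty hs \<longleftrightarrow> (\<exists>J. ideal J (fps2_ring :: 'k fps fps ring) \<and>
            AG_algebra (ring_of_type_algebra :: 'k ring) (fps2_ring Quot J)
              (\<lambda>c. J +>\<^bsub>fps2_ring\<^esub> fps2_const c) \<and>
            (\<exists>I. ideal I (fps2_ring Quot J) \<and>
               (\<forall>i. gr_HF (fps2_ring Quot J) I i = enat (extend_by_zero hs i))))"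

text \<open>A condition decidable by evaluation: the last conjunct compares h_0, ..., h_u, and the
  bound on weights says that nothing is left beyond u.\<close>

definition realized_by :: "nat \<Rightarrow> nat \<Rightarrow> nat \<Rightarrow> nat list \<Rightarrow> bool" where
  "realized_by p s q hs \<longleftrightarrow> 1 \<le> p \<and> 1 \<le> s \<and> s \<le> q \<and>
     list_all (\<lambda>t. expo_weight p q t div 2 < length hs) (expo p s q) \<and>
     map (hilb p s q) [0..<length hs] = hs"

lemma realizable_if_realized_by:
  assumes "realized_by p s q hs"
  shows "realizable TYPE('k::field) hs"
proof -
  interpret xy_quotient "TYPE('k)" p s q
    by unfold_locales (use assms in \<open>auto simp: realized_by_def\<close>)
  interpret A: quotient_by ann by unfold_locales (rule is_ideal_ann)
  have hilb: "hilb p s q n = extend_by_zero hs n" for n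
  proof (cases "n < length hs")
    case True
    have "hs ! n = map (hilb p s q) [0..<length hs] ! n" using assms by (simp add: realized_by_def)
    then show ?thesis using True by (simp add: extend_by_zero_def)
  next
    case False
    then have "filter (\<lambda>t. expo_weight p q t div 2 = n) (expo p s q) = []"
      using assms by (auto simp: realized_by_def list_all_iff filter_empty_conv)
    then show ?thesis using False by (simp add: hilb_def extend_by_zero_def)
  qed
  have AG: "AG_algebra (ring_of_type_algebra :: 'k ring) A.\<A> (\<lambda>c. A.qm (fps2_const c))"
  proof (rule A.AG_algebraI[OF fps2.is_ideal_m fps2_max_proper fps2_proper_le_max ann_proper
        len_ann_finite len_socle])
    show "\<exists>c. r - fps2_const c \<in> fps2_max" for r :: "'k fps fps" using fps2_residue by blast
  qed (simp_all add: fps2_const_def)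
  let ?I = "A.qm ` D 2"
  have "gr_HF A.\<A> ?I i = enat (extend_by_zero hs i)" for i
    unfolding A.gr_HF_eq_len[OF A.ideal_qm_image[OF is_ideal_D]] A.pre_qm_image[OF is_ideal_D ann_le_D]
      rel_pow_D len_D_double hilb ..
  then show ?thesis
    unfolding realizable_def fps2_ring_def
    using AG A.ideal_qm_image[OF is_ideal_D] A.J.ideal_axioms by blast
qed

lemma realizable_constraints:
  assumes "realizable TYPE('k::field) hs" and "length hs = u + 1" "1 \<le> u" "hs ! 0 = 2" "hs ! u \<noteq> 0"
  defines "h \<equiv> extend_by_zero hs"
  shows "h u \<le> 2" "h 1 \<le> 4"
    and "i \<le> u \<Longrightarrow> h i \<noteq> 0"
    and "i \<le> u \<Longrightarrow> h i = 1 \<Longrightarrow> h u = 1"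
    and "u = 2 \<Longrightarrow> h 2 = 1 \<Longrightarrow> h 1 \<le> 3"
    and "u = 3 \<Longrightarrow> h 2 + h 3 \<le> 2 + h 1"
    and "u = 3 \<Longrightarrow> h 3 = 1 \<Longrightarrow> h 2 \<le> 3"
    and "h 1 \<le> 1 \<Longrightarrow> h 2 \<le> 1"
    and "h 1 \<le> 2 \<Longrightarrow> h 2 \<le> 2"
    and "u = 3 \<Longrightarrow> h 3 = 1 \<Longrightarrow> h 2 = 1 \<Longrightarrow> h 1 \<noteq> 4"
proof -
  obtain J :: "'k fps fps set" and I where
    J: "ideal J ring_of_type_algebra" and
    AG: "AG_algebra (ring_of_type_algebra :: 'k ring) (ring_of_type_algebra Quot J)
              (\<lambda>c. J +>\<^bsub>ring_of_type_algebra\<^esub> fps2_const c)" and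
    I: "ideal I (ring_of_type_algebra Quot J)" and
    HF: "\<And>i. gr_HF (ring_of_type_algebra Quot J) I i = enat (h i)"
    using assms(1) unfolding realizable_def fps2_ring_def h_def by blast
  interpret A: quotient_by J by unfold_locales (use J ideal_ring_of_type_algebra_iff in blast)
  have socle: "len J (colon J fps2_max) \<le> 1"
    using A.AG_algebraD(2)[OF AG fps2.is_ideal_m fps2_max_proper fps2_proper_le_max] by simp
  note preI = A.ideal_pre[OF I]
  have len: "len (rel_pow J (A.pre I) (Suc n)) (rel_pow J (A.pre I) n) = enat (h n)" for n
    using HF[of n] A.gr_HF_eq_len[OF I] by simp
  have h0: "h 0 = 2" "h u \<noteq> 0" "\<And>n. n > u \<Longrightarrow> h n = 0"
    using assms(2-5) by (auto simp: h_def extend_by_zero_def)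
  note c = fps2.hilbert_function_constraints[OF A.is_ideal_J socle preI(1,2) len h0 assms(3)]
  show "h u \<le> 2" by (rule c(1))
  show "h 1 \<le> 4" by (rule c(2))
  show "i \<le> u \<Longrightarrow> h i \<noteq> 0" by (rule c)
  show "i \<le> u \<Longrightarrow> h i = 1 \<Longrightarrow> h u = 1" by (rule c)
  show "u = 2 \<Longrightarrow> h 2 = 1 \<Longrightarrow> h 1 \<le> 3" by (rule c)
  show "u = 3 \<Longrightarrow> h 2 + h 3 \<le> 2 + h 1" by (rule c)
  show "u = 3 \<Longrightarrow> h 3 = 1 \<Longrightarrow> h 2 \<le> 3" by (rule c)
  show "h 1 \<le> 1 \<Longrightarrow> h 2 \<le> 1" by (rule c)
  show "h 1 \<le> 2 \<Longrightarrow> h 2 \<le> 2" by (rule c)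
  show "u = 3 \<Longrightarrow> h 3 = 1 \<Longrightarrow> h 2 = 1 \<Longrightarrow> h 1 \<noteq> 4" by (rule c)
qed

text \<open>With s = 1 the powers of y fill each degree with 2 until y^(q-1), each x^i with 0 < i <
  p adds 1 in degree i, and x^p sits at weight max(2p, q). With p = 2 and q >= 4 the powers of y run
  up to y^(q+s-1), and the monomials x y^j for j < s have weight 2 + j: for s = 2, 3, 4 they add 2,
  then 2 and 1, then 2 and 2, starting in degree 1.\<close>

lemma realized_by_small:
  "realized_by 1 1 2 [2,1]" "realized_by 1 1 3 [2,2]" "realized_by 1 1 4 [2,2,1]"
  "realized_by 1 1 5 [2,2,2]" "realized_by 1 1 6 [2,2,2,1]" "realized_by 1 1 7 [2,2,2,2]"
  "realized_by 2 1 2 [2,1,1]" "realized_by 2 1 4 [2,3,1]" "realized_by 2 1 5 [2,3,2]"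
  "realized_by 2 1 6 [2,3,2,1]" "realized_by 2 1 7 [2,3,2,2]"
  "realized_by 3 1 2 [2,1,1,1]" "realized_by 3 1 3 [2,2,1,1]" "realized_by 3 1 4 [2,3,1,1]"
  "realized_by 3 1 6 [2,3,3,1]" "realized_by 3 1 7 [2,3,3,2]"
  "realized_by 2 2 4 [2,4,2]" "realized_by 2 2 5 [2,4,2,1]" "realized_by 2 2 6 [2,4,2,2]"
  "realized_by 2 3 4 [2,4,3,1]" "realized_by 2 3 5 [2,4,3,2]" "realized_by 2 4 4 [2,4,4,2]"
  by code_simp+

theorem mainTheorem2:
  fixes hs :: "nat list" and u :: nat
  assumes "length hs = u + 1" and "1 \<le> u" and "u \<le> 3"
    and "hs ! 0 = 2" and "hs ! u \<noteq> 0"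
    and "admissible_over TYPE('r::comm_ring_1) 2 (extend_by_zero hs)"
  shows "(\<exists>J. ideal J (fps2_ring :: 'k::field fps fps ring) \<and>
            AG_algebra (ring_of_type_algebra :: 'k ring) (fps2_ring Quot J)
              (\<lambda>c. J +>\<^bsub>fps2_ring\<^esub> fps2_const c) \<and>
            (\<exists>I. ideal I (fps2_ring Quot J) \<and>
               (\<forall>i. gr_HF (fps2_ring Quot J) I i = enat (extend_by_zero hs i))))
         \<longleftrightarrow>
         hs \<in> {[2,1], [2,2], [2,1,1], [2,2,1], [2,2,2], [2,3,1], [2,3,2], [2,4,2],
               [2,1,1,1], [2,2,1,1], [2,2,2,1], [2,2,2,2], [2,3,1,1], [2,3,2,1],
               [2,3,2,2], [2,3,3,1], [2,3,3,2],
               [2,4,2,1], [2,4,2,2], [2,4,3,1], [2,4,3,2], [2,4,4,2]}"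
    (is "_ \<longleftrightarrow> hs \<in> ?L")
proof -
  have "realizable TYPE('k) hs \<longleftrightarrow> hs \<in> ?L"
  proof
    assume r: "realizable TYPE('k) hs"
    define h where "h = extend_by_zero hs"
    note c = realizable_constraints[OF r assms(1,2,4,5), folded h_def]
    have h: "hs ! i = h i" if "i \<le> u" for i using that assms(1) by (simp add: h_def extend_by_zero_def)
    have hs: "hs = map h [0..<Suc u]"
      by (rule nth_equalityI) (use assms(1) h in \<open>auto simp del: upt_Suc\<close>)
    have h0: "h 0 = 2" using h[of 0] assms(4) by simp
    have r4: "n = 0 \<or> n = 1 \<or> n = 2 \<or> n = 3 \<or> n = 4" if "n \<le> 4" for n :: nat using that by linarith
    consider "u = 1" | "u = 2" | "u = 3" using assms(2,3) by linarith
    then show "hs \<in> ?L"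
    proof cases
      case 1
      then have "hs = [2, h 1]" using hs h0 by simp
      moreover have "h 1 = 1 \<or> h 1 = 2" using c(1) c(3)[of 1] 1 by simp linarith
      ultimately show ?thesis by auto
    next
      case 2
      then have "hs = [2, h 1, h 2]" using hs h0 by (simp add: numeral_2_eq_2)
      moreover have "h 2 = 1 \<or> h 2 = 2" using c(1) c(3)[of 2] 2 by simp linarith
      moreover have "h 1 \<noteq> 0" "h 1 = 1 \<Longrightarrow> h 2 = 1" "h 2 = 1 \<Longrightarrow> h 1 \<le> 3"
        using c(3)[of 1] c(4)[of 1] c(5) 2 by auto
      ultimately show ?thesis using r4[OF c(2)] by auto
    next
      case 3
      define x y z where "x = h 1" and "y = h 2" and "z = h 3"
      have hs': "hs = [2, x, y, z]" using hs h0 3 by (simp add: x_def y_def z_def numeral_2_eq_2 numeral_3_eq_3)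
      have z: "z = 1 \<or> z = 2" using c(1) c(3)[of 3] 3 unfolding z_def by simp linarith
      have nz: "x \<noteq> 0" "y \<noteq> 0" "x = 1 \<longrightarrow> z = 1" "y = 1 \<longrightarrow> z = 1"
        using c(3)[of 1] c(3)[of 2] c(4)[of 1] c(4)[of 2] 3 unfolding x_def y_def z_def by auto
      have le: "x \<le> 4" "y + z \<le> 2 + x" "z = 1 \<longrightarrow> y \<le> 3" "x \<le> 1 \<longrightarrow> y \<le> 1" "x \<le> 2 \<longrightarrow> y \<le> 2"
        "z = 1 \<longrightarrow> y = 1 \<longrightarrow> x \<noteq> 4"
        using c(2,6-10) 3 unfolding x_def y_def z_def by blast+
      \<comment> \<open>If z = 2 this comes from y + z <= 2 + x <= 6; if z = 1, even y <= 3
        holds.\<close>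
      have "y \<le> 4" using z le by auto
      then have "x = 1 \<or> x = 2 \<or> x = 3 \<or> x = 4" "y = 1 \<or> y = 2 \<or> y = 3 \<or> y = 4"
        using nz(1,2) le(1) by (linarith, linarith)
      with z show ?thesis unfolding hs' using nz le by (elim disjE; simp)
    qed
  next
    assume "hs \<in> ?L"
    then show "realizable TYPE('k) hs"
      using realized_by_small[THEN realizable_if_realized_by[where 'k = 'k]] by auto
  qed
  then show ?thesis unfolding realizable_def .
qed

end
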